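(* Let $1\le p\le\infty$, $r\in\mathbb N=\{1,2,\dots\}$, and let $\alpha$ be a real number such that \begin{align*} \tfrac12&<\alpha\le 1 &&\text{if } p=1,\\ 1-\tfrac1{2p}&<\alpha<\tfrac32-\tfrac1{2p} &&\text{if } 1<p<\infty,\\ 1&\le\alpha<\tfrac32 &&\text{if } p=\infty. \end{align*} Then there exist positive constants $C_1,C_2$, not depending on $f$ and $n$, such that for every $f\in L_{p,\alpha}$ and every natural number $n\ge1$ $$ C_1E_n(f)_{p,\alpha}\le\hat\omega_r\left(f,\tfrac1n\right)_{p,\alpha}\le C_2\,\frac1{n^{2r}}\sum_{\nu=1}^n\nu^{2r-1}E_\nu(f)_{p,\alpha}. $$
   Context: Function spaces. For $1\le p<\infty$, $L_p$ is the set of Lebesgue measurable functions on $[-1,1]$ with $\|f\|_p=\left(\int_{-1}^1|f(x)|^p\,dx\right)^{1/p}<\infty$; $L_\infty$ denotes the set of functions continuous on $[-1,1]$, with $\|f\|_\infty=\max_{-1\le x\le1}|f(x)|$. $L_{p,\alpha}$ is the set of functions $f$ on $[-1,1]$ such that $f(x)(1-x^2)^\alpha\in L_p$, with $\|f\|_{p,\alpha}=\|f(x)(1-x^2)^\alpha\|_p$. Best approximation. $E_n(f)_{p,\alpha}=\inf_{P_n}\|f-P_n\|_{p,\alpha}$, the infimum being over all algebraic polynomials $P_n$ of degree at most $n-1$. Generalised translation. For $x,y,z\in[-1,1]$ put $R=xy-z\sqrt{1-x^2}\sqrt{1-y^2}$ and $$B_y(x,z,R)=2\left(\sqrt{1-x^2}\,y+xz\sqrt{1-y^2}+\sqrt{1-x^2}(1-y)(1-z^2)\right)^2-(1-R^2).$$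 For a summable function $f$ and $|t|<\pi$ define, with $y=\cos t$, $z=\cos\varphi$, $$\hat\tau_t(f,x)=\frac1{\pi(1-x^2)\cos^4\frac t2}\int_0^\pi B_{\cos t}(x,\cos\varphi,R)f(R)\,d\varphi .$$ Generalised differences and modulus of smoothness. $\Delta^1_{t_1}(f,x)=\Delta_{t_1}(f,x)=\hat\tau_{t_1}(f,x)-f(x)$ and $\Delta^r_{t_1,\dots,t_r}(f,x)=\Delta_{t_r}\left(\Delta^{r-1}_{t_1,\dots,t_{r-1}}(f,\cdot),x\right)$ for $r\ge2$. For $f\in L_{p,\alpha}$, $$\hat\omega_r(f,\delta)_{p,\alpha}=\sup_{|t_j|\le\delta,\ j=1,\dots,r}\left\|\Delta^r_{t_1,\dots,t_r}(f,x)\right\|_{p,\alpha}.$$ *)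

theory Defs
  imports "HOL-Analysis.Analysis" "HOL-Computational_Algebra.Polynomial"
begin

text \<open>
  Functions on $[-1,1]$ are represented by total functions \<^typ>\<open>real \<Rightarrow> real\<close>, of which only the
  values on \<^term>\<open>{-1..1::real}\<close> matter. The exponent ranges over \<^typ>\<open>ennreal\<close>, with
  \<^term>\<open>\<infinity> :: ennreal\<close> standing for the space of continuous functions.
\<close>

definition Lp_space :: "ennreal \<Rightarrow> (real \<Rightarrow> real) set" where
  "Lp_space p =
     (if p = \<infinity> then {f. continuous_on {-1..1} f}
      else {f. f \<in> borel_measurable (lebesgue_on {-1..1}) \<and>
               integrable (lebesgue_on {-1..1}) (\<lambda>x. \<bar>f x\<bar> powr enn2real p)})"

text \<open>
  The norm is \<^term>\<open>\<infinity> :: ennreal\<close> outside the space, so that a finite bound on the norm includes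
  membership. On the space the real-valued expressions below carry no default values.
\<close>

definition Lp_norm :: "ennreal \<Rightarrow> (real \<Rightarrow> real) \<Rightarrow> ennreal" where
  "Lp_norm p f =
     (if f \<notin> Lp_space p then \<infinity>
      else if p = \<infinity> then ennreal (SUP x\<in>{-1..1}. \<bar>f x\<bar>)
      else ennreal ((LINT x|lebesgue_on {-1..1}. \<bar>f x\<bar> powr enn2real p) powr (1 / enn2real p)))"

text \<open>
  At the endpoints the weight is \<^term>\<open>0 powr \<alpha> = (0::real)\<close>, the right value for positive
  $\alpha$, the only case of interest.
\<close>

definition weighted :: "real \<Rightarrow> (real \<Rightarrow> real) \<Rightarrow> real \<Rightarrow> real" where
  "weighted \<alpha> f x = f x * (1 - x\<^sup>2) powr \<alpha>"

definition Lpw_space :: "ennreal \<Rightarrow> real \<Rightarrow> (real \<Rightarrow> real) set" where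
  "Lpw_space p \<alpha> = {f. weighted \<alpha> f \<in> Lp_space p}"

definition Lpw_norm :: "ennreal \<Rightarrow> real \<Rightarrow> (real \<Rightarrow> real) \<Rightarrow> ennreal" where
  "Lpw_norm p \<alpha> f = Lp_norm p (weighted \<alpha> f)"

definition best_approx :: "ennreal \<Rightarrow> real \<Rightarrow> nat \<Rightarrow> (real \<Rightarrow> real) \<Rightarrow> ennreal" where
  "best_approx p \<alpha> n f =
     (INF P\<in>{P :: real poly. degree P \<le> n - 1}. Lpw_norm p \<alpha> (\<lambda>x. f x - poly P x))"

definition trans_arg :: "real \<Rightarrow> real \<Rightarrow> real \<Rightarrow> real" where
  "trans_arg x y z = x * y - z * sqrt (1 - x\<^sup>2) * sqrt (1 - y\<^sup>2)"

definition trans_kernel :: "real \<Rightarrow> real \<Rightarrow> real \<Rightarrow> real \<Rightarrow> real" where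
  "trans_kernel y x z R =
     2 * (sqrt (1 - x\<^sup>2) * y + x * z * sqrt (1 - y\<^sup>2)
          + sqrt (1 - x\<^sup>2) * (1 - y) * (1 - z\<^sup>2))\<^sup>2 - (1 - R\<^sup>2)"

text \<open>
  The integral is taken with respect to the completed Lebesgue measure because $f$ is only assumed
  to be Lebesgue measurable. At $x = \pm 1$ the translation has the irrelevant value 0.
\<close>

definition gen_translation :: "real \<Rightarrow> (real \<Rightarrow> real) \<Rightarrow> real \<Rightarrow> real" where
  "gen_translation t f x =
     1 / (pi * (1 - x\<^sup>2) * cos (t / 2) ^ 4) *
     (LINT \<phi>|lebesgue_on {0..pi}.
        trans_kernel (cos t) x (cos \<phi>) (trans_arg x (cos t) (cos \<phi>)) *
        f (trans_arg x (cos t) (cos \<phi>)))"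

definition gen_diff1 :: "real \<Rightarrow> (real \<Rightarrow> real) \<Rightarrow> real \<Rightarrow> real" where
  "gen_diff1 t f x = gen_translation t f x - f x"

text \<open>The increments $t_1,\dots,t_r$ are the values of \<open>t\<close> at \<open>1, \<dots>, r\<close>.\<close>

primrec gen_diff :: "nat \<Rightarrow> (nat \<Rightarrow> real) \<Rightarrow> (real \<Rightarrow> real) \<Rightarrow> real \<Rightarrow> real" where
  "gen_diff 0 t f = f"
| "gen_diff (Suc r) t f = gen_diff1 (t (Suc r)) (gen_diff r t f)"

definition gen_modulus :: "nat \<Rightarrow> ennreal \<Rightarrow> real \<Rightarrow> (real \<Rightarrow> real) \<Rightarrow> real \<Rightarrow> ennreal" where
  "gen_modulus r p \<alpha> f \<delta> =
     (SUP t\<in>{t. \<forall>j\<in>{1..r}. \<bar>t j\<bar> \<le> \<delta>}. Lpw_norm p \<alpha> (gen_diff r t f))"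

end

theory Submission
  imports Defs
begin

text \<open>
  Write $y = \cos t$. The translation acts on the sphere: $(1-x^2) f(x)$ is the weight 2 part of the
  function $(\xi_1 + i \xi_2)^2 f(\xi_3)$, and \<open>gen_translation t\<close> rotates the sphere by \<open>t\<close>, projects
  back to weight 2 and divides by $\cos^4 (t/2)$ (lemmas \<open>rotated_kernel\<close> and
  \<open>kernel_expansion\<close>). Hence it is diagonal in the basis \<open>eigen_poly k\<close>, with the Jacobi
  polynomial \<open>jac k y\<close> for the parameters $(0,4)$ as eigenvalue (\<open>gen_translation_eigen\<close>).

  The kernel is bounded by $1 - R^2$, so that the translation of \<open>f\<close> is dominated by the Legendre
  translation of $(1-x^2) |f|$. That operator is symmetric in $L_1$, and a pointwise inequality for
  $1 - R^2$ shows that it maps a weight $(1-x^2)^{-s}$ with $0 \le s < 1/2$ to at most a multiple of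
  itself. Schur's test then gives boundedness on the weighted space exactly for the exponents in
  question (\<open>raw_translation_power_bound\<close>, \<open>translation_bounded_inf\<close>). In all estimates
  the factor $\cos^4 (t/2)$ is kept, and with it the bound is uniform in \<open>t\<close>.

  Since polynomials are dense (\<open>poly_dense\<close>) and everything in sight is continuous, the direct
  inequality has to be proved for polynomials only, with constants that do not depend on the degree.
  There all operators are multipliers on the coefficients, and only three facts are used: \<open>N\<close> is a
  seminorm, the multipliers \<open>((1 + y) / 2)\<^sup>2 * jac k y\<close> are bounded uniformly in \<open>y\<close>, and \<open>jac k\<close> is the
  eigenfunction of a Sturm-Liouville operator with eigenvalue \<open>- kap k\<close>. The locale \<open>transl_seq\<close>
  carries this part. The equation turns differences into integrals of translations
  (\<open>difference_bound\<close>), orthogonality turns averages of translations against a polynomial kernel into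
  polynomials (\<open>jackson_multiplier\<close>), and averages over short intervals give a smooth approximant
  whose derivatives are controlled by differences (\<open>averaging_multiplier\<close>). Together they are the
  usual comparison of the modulus with a K-functional (\<open>direct_estimate\<close>).

  For the inverse inequality, the translation of a polynomial times $\cos^4(t/2)$ is a cosine
  polynomial in \<open>t\<close> with uniformly bounded values, and an interpolation formula for the second
  derivative at 0 yields the Bernstein inequality (\<open>bernstein\<close>). It is applied to the dyadic
  differences of near-best approximants (\<open>telescoped_bound\<close>, \<open>dyadic_sum\<close>).
\<close>


section \<open>The eigenvalues of the translation: Jacobi polynomials for the weight $(1+y)^4$\<close>

text \<open>The Jacobi polynomial with parameters $(0,4)$ that is 1 at $y = 1$. The form homogeneous in
  $(y-1)/2 = -\sin^2(t/2)$ and $(y+1)/2 = \cos^2(t/2)$ is the one in which it appears as a matrix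
  coefficient of a rotation in \<open>coeff_rotation\<close>.\<close>

definition jac_coeff :: "nat \<Rightarrow> nat \<Rightarrow> real" where
  "jac_coeff k j = real ((k choose j) * ((k + 4) choose j))"

definition jac :: "nat \<Rightarrow> real \<Rightarrow> real" where
  "jac k y = (\<Sum>j\<le>k. jac_coeff k j * (((y - 1) / 2) ^ j * ((y + 1) / 2) ^ (k - j)))"

text \<open>Up to the factor in front this is the Jacobi polynomial of degree \<open>k - 1\<close> with parameters $(1,5)$.\<close>

definition jac' :: "nat \<Rightarrow> real \<Rightarrow> real" where
  "jac' k y = (real k + 5) / 2 *
     (\<Sum>j<k. real ((k choose Suc j) * ((k + 4) choose j)) * (((y - 1) / 2) ^ j * ((y + 1) / 2) ^ (k - Suc j)))"

definition kap :: "nat \<Rightarrow> real" where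
  "kap k = real k * (real k + 5)"

lemma jac_1 [simp]: "jac k 1 = 1"
proof -
  have "jac k 1 = (\<Sum>j\<le>k. if j = 0 then 1 else 0)"
    unfolding jac_def by (intro sum.cong) (auto simp: jac_coeff_def)
  then show ?thesis by simp
qed

lemma jac_0 [simp]: "jac 0 y = 1"
  by (simp add: jac_def jac_coeff_def)

lemma choose_Suc_absorb: "(real j + 1) * real (n choose Suc j) = (real n - real j) * real (n choose j)"
proof (cases "j \<le> n")
  case True
  have "Suc j * (n choose Suc j) = (n - j) * (n choose j)"
    by (metis binomial_absorb_comp binomial_absorption)
  then have "real (Suc j * (n choose Suc j)) = real ((n - j) * (n choose j))" by presburger
  then show ?thesis using True by (simp only: of_nat_mult of_nat_diff of_nat_Suc) (simp add: algebra_simps)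
qed (simp add: binomial_eq_0)

lemma jac_has_derivative: "(jac k has_real_derivative jac' k y) (at y)"
proof -
  define p q where "p = (y - 1) / 2" and "q = (y + 1) / 2"
  have "(jac k has_real_derivative
      (\<Sum>j\<le>k. jac_coeff k j * (real j / 2 * p ^ (j - 1) * q ^ (k - j)
                     + p ^ j * (real (k - j) / 2 * q ^ (k - j - 1))))) (at y)"
    unfolding jac_def [abs_def] p_def q_def
    by (rule derivative_eq_intros refl | simp add: field_simps)+
  also have "(\<Sum>j\<le>k. jac_coeff k j * (real j / 2 * p ^ (j - 1) * q ^ (k - j)
                     + p ^ j * (real (k - j) / 2 * q ^ (k - j - 1))))
     = (\<Sum>j\<le>k. jac_coeff k j * (real j / 2 * p ^ (j - 1) * q ^ (k - j)))
     + (\<Sum>j\<le>k. jac_coeff k j * (p ^ j * (real (k - j) / 2 * q ^ (k - j - 1))))"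
    by (simp add: sum.distrib distrib_left)
  also have "(\<Sum>j\<le>k. jac_coeff k j * (real j / 2 * p ^ (j - 1) * q ^ (k - j)))
      = (\<Sum>j<k. jac_coeff k (Suc j) * (real (Suc j) / 2 * p ^ j * q ^ (k - Suc j)))"
    by (subst sum.atMost_shift) simp
  also have "(\<Sum>j\<le>k. jac_coeff k j * (p ^ j * (real (k - j) / 2 * q ^ (k - j - 1))))
      = (\<Sum>j<k. jac_coeff k j * (p ^ j * (real (k - j) / 2 * q ^ (k - Suc j))))"
    by (simp add: lessThan_Suc_atMost [symmetric])
  also have "(\<Sum>j<k. jac_coeff k (Suc j) * (real (Suc j) / 2 * p ^ j * q ^ (k - Suc j))) + \<dots>
      = (\<Sum>j<k. (jac_coeff k (Suc j) * (real j + 1) + jac_coeff k j * (real k - real j)) / 2 * (p ^ j * q ^ (k - Suc j)))"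
    unfolding sum.distrib [symmetric]
    by (intro sum.cong refl) (simp add: of_nat_diff algebra_simps add_divide_distrib diff_divide_distrib)
  also have "\<dots> = (\<Sum>j<k. ((real k + 5) / 2 * real ((k choose Suc j) * ((k + 4) choose j))) * (p ^ j * q ^ (k - Suc j)))"
  proof (intro sum.cong refl)
    fix j assume "j \<in> {..<k}"
    have 1: "(real j + 1) * real (k choose Suc j) = (real k - real j) * real (k choose j)"
      by (rule choose_Suc_absorb)
    have 2: "(real j + 1) * real (Suc (k + 4) choose Suc j) = (real (k + 4) + 1) * real ((k + 4) choose j)"
    proof -
      have "Suc j * (Suc (k + 4) choose Suc j) = Suc (k + 4) * ((k + 4) choose j)"
        by (rule Suc_times_binomial)
      then have "real (Suc j * (Suc (k + 4) choose Suc j)) = real (Suc (k + 4) * ((k + 4) choose j))"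
        by presburger
      then show ?thesis by (simp only: of_nat_mult of_nat_Suc) (simp add: algebra_simps)
    qed
    have 3: "real (Suc (k + 4) choose Suc j) = real ((k + 4) choose j) + real ((k + 4) choose Suc j)"
      by (simp only: binomial_Suc_Suc of_nat_add)
    have "jac_coeff k (Suc j) * (real j + 1) + jac_coeff k j * (real k - real j)
      = ((real j + 1) * real (k choose Suc j)) * real ((k + 4) choose Suc j) + ((real k - real j) * real (k choose j)) * real ((k + 4) choose j)"
      by (simp add: jac_coeff_def algebra_simps)
    also have "\<dots> = real (k choose Suc j) * ((real j + 1) * real (Suc (k + 4) choose Suc j))"
      unfolding 1 [symmetric] 3 by (simp add: algebra_simps)
    also have "\<dots> = (real k + 5) * real ((k choose Suc j) * ((k + 4) choose j))"
      unfolding 2 by simp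
    finally show "(jac_coeff k (Suc j) * (real j + 1) + jac_coeff k j * (real k - real j)) / 2 * (p ^ j * q ^ (k - Suc j))
       = ((real k + 5) / 2 * real ((k choose Suc j) * ((k + 4) choose j))) * (p ^ j * q ^ (k - Suc j))"
      by simp
  qed
  also have "\<dots> = jac' k y"
    by (simp add: jac'_def sum_distrib_left p_def q_def mult.assoc)
  finally show ?thesis .
qed

text \<open>Jacobi's equation in Sturm-Liouville form. As for the derivative above, comparing coefficients
  leaves an absorption identity for products of two binomial coefficients.\<close>

lemma jac_ode:
  "((\<lambda>v. (1 - v) * (1 + v) ^ 5 * jac' k v) has_real_derivative - kap k * (1 + v) ^ 4 * jac k v) (at v)"
proof -
  define p q where "p = (\<lambda>y::real. (y - 1) / 2)" and "q = (\<lambda>y::real. (y + 1) / 2)"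
  have eq: "(1 - v) * (1 + v) ^ 5 * jac' k v =
     - 32 * (real k + 5) * (\<Sum>j<k. real ((k choose Suc j) * ((k + 4) choose j)) * (p v ^ Suc j * q v ^ (k + 4 - j)))" for v
  proof -
    have v: "1 - v = - 2 * p v" "1 + v = 2 * q v" by (simp_all add: p_def q_def)
    have "jac' k v = (real k + 5) / 2 * (\<Sum>j<k. real ((k choose Suc j) * ((k + 4) choose j)) * (p v ^ j * q v ^ (k - Suc j)))"
      by (simp add: jac'_def p_def q_def)
    then have "(1 - v) * (1 + v) ^ 5 * jac' k v = - 32 * (real k + 5) *
       (\<Sum>j<k. real ((k choose Suc j) * ((k + 4) choose j)) * (p v ^ Suc j * (q v ^ 5 * q v ^ (k - Suc j))))"
      unfolding v sum_distrib_left
      by (simp add: sum_distrib_left power_mult_distrib) (intro sum.cong refl, simp add: algebra_simps)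
    also have "(\<Sum>j<k. real ((k choose Suc j) * ((k + 4) choose j)) * (p v ^ Suc j * (q v ^ 5 * q v ^ (k - Suc j))))
      = (\<Sum>j<k. real ((k choose Suc j) * ((k + 4) choose j)) * (p v ^ Suc j * q v ^ (k + 4 - j)))"
    proof (intro sum.cong refl)
      fix j assume "j \<in> {..<k}"
      then have "k + 4 - j = 5 + (k - Suc j)" by simp
      then show "real ((k choose Suc j) * ((k + 4) choose j)) * (p v ^ Suc j * (q v ^ 5 * q v ^ (k - Suc j)))
        = real ((k choose Suc j) * ((k + 4) choose j)) * (p v ^ Suc j * q v ^ (k + 4 - j))"
        by (simp only: power_add)
    qed
    finally show ?thesis .
  qed
  have "((\<lambda>v. \<Sum>j<k. real ((k choose Suc j) * ((k + 4) choose j)) * (p v ^ Suc j * q v ^ (k + 4 - j))) has_real_derivative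
      (\<Sum>j<k. real ((k choose Suc j) * ((k + 4) choose j)) *
        (real (Suc j) / 2 * p v ^ j * q v ^ (k + 4 - j) + p v ^ Suc j * (real (k + 4 - j) / 2 * q v ^ (k + 4 - j - 1))))) (at v)"
    unfolding p_def q_def
    by (rule derivative_eq_intros refl | simp add: field_simps del: power_Suc of_nat_Suc)+
  also have "(\<Sum>j<k. real ((k choose Suc j) * ((k + 4) choose j)) *
        (real (Suc j) / 2 * p v ^ j * q v ^ (k + 4 - j) + p v ^ Suc j * (real (k + 4 - j) / 2 * q v ^ (k + 4 - j - 1))))
     = (\<Sum>j<k. (real (k choose Suc j) * (real j + 1)) * real ((k + 4) choose j) / 2 * (p v ^ j * q v ^ (k + 4 - j)))
      + (\<Sum>j<k. real (k choose Suc j) * ((real (k + 4) - real j) * real ((k + 4) choose j)) / 2 * (p v ^ Suc j * q v ^ (k + 4 - Suc j)))"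
    unfolding sum.distrib [symmetric]
    by (intro sum.cong refl) (simp add: of_nat_diff algebra_simps add_divide_distrib diff_divide_distrib)
  also have "(\<Sum>j<k. (real (k choose Suc j) * (real j + 1)) * real ((k + 4) choose j) / 2 * (p v ^ j * q v ^ (k + 4 - j)))
     = (\<Sum>j\<le>k. jac_coeff k j * (real k - real j) / 2 * (p v ^ j * q v ^ (k + 4 - j)))"
    by (simp add: lessThan_Suc_atMost [symmetric] jac_coeff_def mult.commute [of _ "real _ + 1"] choose_Suc_absorb mult_ac)
  also have "(\<Sum>j<k. real (k choose Suc j) * ((real (k + 4) - real j) * real ((k + 4) choose j)) / 2 * (p v ^ Suc j * q v ^ (k + 4 - Suc j)))
     = (\<Sum>j\<le>k. jac_coeff k j * real j / 2 * (p v ^ j * q v ^ (k + 4 - j)))"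
    unfolding choose_Suc_absorb [symmetric]
    by (subst sum.atMost_shift) (simp add: jac_coeff_def mult_ac add_ac del: power_Suc binomial_Suc_Suc)
  also have "(\<Sum>j\<le>k. jac_coeff k j * (real k - real j) / 2 * (p v ^ j * q v ^ (k + 4 - j))) + \<dots>
     = (\<Sum>j\<le>k. real k / 2 * q v ^ 4 * (jac_coeff k j * (p v ^ j * q v ^ (k - j))))"
    unfolding sum.distrib [symmetric]
  proof (intro sum.cong refl)
    fix j assume "j \<in> {..k}"
    then have "q v ^ (k + 4 - j) = q v ^ 4 * q v ^ (k - j)"
      by (simp add: power_add [symmetric] add.commute)
    then show "jac_coeff k j * (real k - real j) / 2 * (p v ^ j * q v ^ (k + 4 - j)) + jac_coeff k j * real j / 2 * (p v ^ j * q v ^ (k + 4 - j))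
       = real k / 2 * q v ^ 4 * (jac_coeff k j * (p v ^ j * q v ^ (k - j)))"
      by (simp add: field_simps)
  qed
  also have "\<dots> = real k / 2 * q v ^ 4 * jac k v"
    by (simp add: jac_def p_def q_def sum_distrib_left)
  finally have "((\<lambda>v. (1 - v) * (1 + v) ^ 5 * jac' k v) has_real_derivative
      - 32 * (real k + 5) * (real k / 2 * q v ^ 4 * jac k v)) (at v)"
    unfolding eq by (rule DERIV_cmult)
  also have "- 32 * (real k + 5) * (real k / 2 * q v ^ 4 * jac k v) = - kap k * (1 + v) ^ 4 * jac k v"
    by (simp add: kap_def q_def power_divide add.commute [of v]) (simp add: algebra_simps)
  finally show ?thesis .
qed


section \<open>Orthogonality and growth of the eigenvalues\<close>

lemma jac_continuous_on [continuous_intros]: "continuous_on S (jac k)"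
  by (rule DERIV_continuous_on) (rule has_field_derivative_at_within, rule jac_has_derivative)

lemma jac'_1: "jac' k 1 = kap k / 2"
proof (cases k)
  case (Suc m)
  have "jac' k 1 = (real k + 5) / 2 * (\<Sum>j<k. if j = 0 then real k else 0)"
    unfolding jac'_def by (intro arg_cong2 [where f = "(*)"] sum.cong refl) (auto simp: Suc)
  then show ?thesis by (simp add: Suc kap_def)
qed (simp add: jac'_def kap_def)

lemma FTC_real:
  fixes F :: "real \<Rightarrow> real"
  assumes "a \<le> b" "\<And>x. (F has_real_derivative f x) (at x)"
  shows "(f has_integral F b - F a) {a..b}"
proof (rule fundamental_theorem_of_calculus [OF assms(1)])
  fix x
  show "(F has_vector_derivative f x) (at x within {a..b})"
    unfolding has_real_derivative_iff_has_vector_derivative [symmetric]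
    by (rule has_field_derivative_at_within) (rule assms(2))
qed

lemma jac_integral_identity:
  assumes "v \<le> 1"
  shows "((\<lambda>u. kap k * (1 + u) ^ 4 * jac k u) has_integral (1 - v) * (1 + v) ^ 5 * jac' k v) {v..1}"
  using has_integral_neg [OF FTC_real [OF assms jac_ode]] by simp

lemma jac_diff_integral:
  assumes "y \<le> 1"
  shows "(jac' k has_integral 1 - jac k y) {y..1}"
  using FTC_real [OF assms jac_has_derivative] by simp

text \<open>The Sturm-Liouville operator is symmetric and maps $(1+u)^d$ to a combination of $(1+u)^d$, with
  factor $-d(d+5)$, and $(1+u)^{d-1}$. For \<open>d < k\<close> the factor differs from \<open>- kap k\<close>, so that the moments
  vanish one after the other.\<close>

lemma jac_moment:
  "d < k \<Longrightarrow> ((\<lambda>u. (1 + u) ^ (4 + d) * jac k u) has_integral 0) {-1..1}"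
proof (induction d)
  case 0
  have "kap k \<noteq> 0" using 0 by (auto simp: kap_def)
  then show ?case
    using has_integral_mult_right [OF jac_integral_identity [of "-1" k], of "1 / kap k"] by simp
next
  case (Suc d)
  define e where "e = real (Suc d)"
  have e: "e > 0" "e < real k" using Suc.prems by (auto simp: e_def)
  define I where "I = integral {-1..1} (\<lambda>u. (1 + u) ^ (4 + Suc d) * jac k u)"
  have I: "((\<lambda>u. (1 + u) ^ (4 + Suc d) * jac k u) has_integral I) {-1..1}"
    unfolding I_def by (intro integrable_integral integrable_continuous_interval continuous_intros)
  have J: "((\<lambda>u. (1 + u) ^ (4 + d) * jac k u) has_integral 0) {-1..1}"
    using Suc by simp
  \<comment> \<open>Two integrations by parts against \<open>(1 + u) ^ Suc d\<close>: the boundary terms vanish at both ends.\<close>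
  define H where "H = (\<lambda>u. (1 - u) * (1 + u) ^ 5 * jac' k u)"
  have H: "(H has_real_derivative - kap k * (1 + u) ^ 4 * jac k u) (at u)" for u
    unfolding H_def by (rule jac_ode)
  define \<Psi> where "\<Psi> = (\<lambda>u. (1 + u) ^ Suc d * H u - e * (2 * (1 + u) ^ (5 + d) - (1 + u) ^ (6 + d)) * jac k u)"
  have d1: "(\<Psi> has_real_derivative
     (1 + u) ^ Suc d * (- kap k * (1 + u) ^ 4 * jac k u)
     + e * (1 + u) ^ d * ((1 - u) * (1 + u) ^ 5 * jac' k u)
     - (e * (2 * (5 + real d) * (1 + u) ^ (4 + d) - (6 + real d) * (1 + u) ^ (5 + d)) * jac k u
        + e * (2 * (1 + u) ^ (5 + d) - (1 + u) ^ (6 + d)) * jac' k u)) (at u)" for u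
  proof -
    have pw: "((\<lambda>u. (1 + u) ^ m) has_real_derivative real m * (1 + u) ^ (m - 1)) (at u)" for m u
      by (rule derivative_eq_intros refl | simp)+
    have 1: "((\<lambda>u. (1 + u) ^ Suc d * H u) has_real_derivative
       e * (1 + u) ^ d * H u + - kap k * (1 + u) ^ 4 * jac k u * (1 + u) ^ Suc d) (at u)"
      using DERIV_mult [OF pw [of "Suc d" u] H [of u]] by (simp only: e_def diff_Suc_1)
    have 2: "((\<lambda>u. 2 * (1 + u) ^ (5 + d) - (1 + u) ^ (6 + d)) has_real_derivative
       2 * (real (5 + d) * (1 + u) ^ (5 + d - 1)) - real (6 + d) * (1 + u) ^ (6 + d - 1)) (at u)"
      by (intro DERIV_diff DERIV_cmult pw)
    have 3: "5 + d - 1 = 4 + d" "6 + d - 1 = 5 + d" "real (5 + d) = 5 + real d" "real (6 + d) = 6 + real d" by simp_all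
    have 4: "((\<lambda>u. e * (2 * (1 + u) ^ (5 + d) - (1 + u) ^ (6 + d)) * jac k u) has_real_derivative
       e * (2 * ((5 + real d) * (1 + u) ^ (4 + d)) - (6 + real d) * (1 + u) ^ (5 + d)) * jac k u
       + jac' k u * (e * (2 * (1 + u) ^ (5 + d) - (1 + u) ^ (6 + d)))) (at u)"
      by (intro DERIV_mult DERIV_cmult 2 [unfolded 3] jac_has_derivative)
    show ?thesis
      unfolding \<Psi>_def using DERIV_diff [OF 1 4] by (simp only: H_def mult_ac add_ac)
  qed
  have d2: "(1 + u) ^ Suc d * (- kap k * (1 + u) ^ 4 * jac k u)
     + e * (1 + u) ^ d * ((1 - u) * (1 + u) ^ 5 * jac' k u)
     - (e * (2 * (5 + real d) * (1 + u) ^ (4 + d) - (6 + real d) * (1 + u) ^ (5 + d)) * jac k u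
        + e * (2 * (1 + u) ^ (5 + d) - (1 + u) ^ (6 + d)) * jac' k u)
    = (e * (e + 5) - kap k) * ((1 + u) ^ (4 + Suc d) * jac k u)
      - 2 * e * (e + 4) * ((1 + u) ^ (4 + d) * jac k u)" for u
  proof -
    define q where "q = 1 + u"
    define X where "X = q ^ d"
    have 1: "1 - u = 2 - q" "real d = e - 1" by (simp_all add: q_def e_def)
    define Q where "Q = q ^ 4"
    have 2: "q ^ Suc d = q * X" "q ^ (5 + d) = q * Q * X" "q ^ (6 + d) = q * q * Q * X" "q ^ (4 + d) = Q * X"
      "q ^ (4 + Suc d) = q * Q * X" "q ^ 5 = q * Q"
      by (simp_all add: X_def Q_def power_add numeral_eq_Suc mult_ac)
    show ?thesis unfolding 1 q_def [symmetric] 2 X_def [symmetric] Q_def [symmetric] by (simp add: algebra_simps)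
  qed
  have d3: "(\<Psi> has_real_derivative
      (e * (e + 5) - kap k) * ((1 + u) ^ (4 + Suc d) * jac k u)
      - 2 * e * (e + 4) * ((1 + u) ^ (4 + d) * jac k u)) (at u)" for u
    using d1 [of u] unfolding d2 .
  have i1: "((\<lambda>u. (e * (e + 5) - kap k) * ((1 + u) ^ (4 + Suc d) * jac k u)
      - 2 * e * (e + 4) * ((1 + u) ^ (4 + d) * jac k u)) has_integral \<Psi> 1 - \<Psi> (-1)) {-1..1}"
    by (rule FTC_real) (simp, rule d3)
  have i2: "\<Psi> 1 - \<Psi> (-1) = 0"
    by (simp add: \<Psi>_def H_def power_add)
  have i3: "((\<lambda>u. (e * (e + 5) - kap k) * ((1 + u) ^ (4 + Suc d) * jac k u)
      - 2 * e * (e + 4) * ((1 + u) ^ (4 + d) * jac k u)) has_integral (e * (e + 5) - kap k) * I - 2 * e * (e + 4) * 0) {-1..1}"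
    by (intro has_integral_diff has_integral_mult_right I J)
  have "(e * (e + 5) - kap k) * I = 0"
    using has_integral_unique [OF i3 i1] i2 by simp
  moreover have "e * (e + 5) < kap k"
    unfolding kap_def using e by (intro mult_strict_mono) auto
  ultimately have "I = 0" by simp
  with I show ?case by simp
qed

lemma jac_orthogonal:
  fixes q :: "real poly"
  assumes "degree q < k"
  shows "((\<lambda>u. poly q u * (1 + u) ^ 4 * jac k u) has_integral 0) {-1..1}"
proof -
  define p where "p = q \<circ>\<^sub>p [:-1, 1:]"
  have deg: "degree p = degree q" by (simp add: p_def degree_pcompose)
  have q: "poly q u = (\<Sum>d\<le>degree q. coeff p d * (1 + u) ^ d)" for u
  proof -
    have "poly q u = poly p (1 + u)" by (simp add: p_def poly_pcompose)
    then show ?thesis by (simp add: poly_altdef deg)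
  qed
  have "((\<lambda>u. \<Sum>d\<le>degree q. coeff p d * ((1 + u) ^ (4 + d) * jac k u)) has_integral (\<Sum>d\<le>degree q. coeff p d * 0)) {-1..1}"
    using assms by (intro has_integral_sum has_integral_mult_right jac_moment) auto
  also have "(\<lambda>u. \<Sum>d\<le>degree q. coeff p d * ((1 + u) ^ (4 + d) * jac k u)) = (\<lambda>u. poly q u * (1 + u) ^ 4 * jac k u)"
    by (simp add: q sum_distrib_right sum_distrib_left power_add mult_ac)
  finally show ?thesis by simp
qed

section \<open>Chebyshev polynomials and a positive kernel\<close>

lemma sin_ge_half:
  fixes x :: real
  assumes "0 \<le> x" "x \<le> pi / 2"
  shows "x / 2 \<le> sin x"
proof -
  define y where "y = x / 2"
  have y: "0 \<le> y" "y \<le> pi / 4" using assms by (auto simp: y_def)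
  have "sin 0 - 0 * cos 0 \<le> sin y - y * cos y"
  proof (rule DERIV_nonneg_imp_nondecreasing [OF y(1)])
    fix z assume z: "0 \<le> z" "z \<le> y"
    have "((\<lambda>y. sin y - y * cos y) has_real_derivative z * sin z) (at z)"
      by (rule derivative_eq_intros refl | simp)+
    moreover have "0 \<le> z * sin z" using z y pi_gt_zero by (intro mult_nonneg_nonneg sin_ge_zero) auto
    ultimately show "\<exists>d. ((\<lambda>y. sin y - y * cos y) has_real_derivative d) (at z) \<and> 0 \<le> d" by blast
  qed
  then have 1: "y * cos y \<le> sin y" by simp
  have c: "0 \<le> cos y" using y pi_gt_zero by (intro cos_ge_zero) auto
  have "cos (2 * y) \<ge> 0" using y pi_gt_zero by (intro cos_ge_zero) auto
  then have 2: "1 / 2 \<le> cos y * cos y" by (simp add: cos_double_cos power2_eq_square)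
  have "x / 2 \<le> x * (cos y * cos y)" using mult_left_mono [OF 2 assms(1)] by simp
  also have "\<dots> = 2 * (y * cos y) * cos y" by (simp add: y_def)
  also have "\<dots> \<le> 2 * sin y * cos y" using 1 c by (intro mult_right_mono) auto
  also have "\<dots> = sin x" by (simp add: sin_double [symmetric] y_def)
  finally show ?thesis .
qed

lemma one_minus_cos_ge:
  fixes t :: real
  assumes "0 \<le> t" "t \<le> pi"
  shows "t\<^sup>2 / 8 \<le> 1 - cos t"
proof -
  have "t / 4 \<le> sin (t / 2)" using sin_ge_half [of "t / 2"] assms by simp
  then have "(t / 4)\<^sup>2 \<le> (sin (t / 2))\<^sup>2" using assms by (intro power_mono) auto
  moreover have "cos t = 1 - 2 * (sin (t / 2))\<^sup>2" using cos_double_sin [of "t / 2"] by simp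
  ultimately show ?thesis by (simp add: power_divide)
qed

lemma one_minus_cos_le:
  fixes t :: real
  shows "1 - cos t \<le> t\<^sup>2 / 2"
proof -
  have "(sin (t / 2))\<^sup>2 \<le> (t / 2)\<^sup>2"
    using abs_sin_x_le_abs_x [of "t / 2"] unfolding abs_le_square_iff .
  moreover have "cos t = 1 - 2 * (sin (t / 2))\<^sup>2" using cos_double_sin [of "t / 2"] by simp
  ultimately show ?thesis by (simp add: power_divide)
qed

lemma one_minus_cos_mult_le:
  fixes t :: real
  shows "1 - cos (real N * t) \<le> (real N)\<^sup>2 * (1 - cos t)"
proof -
  have s: "\<bar>sin (real N * x)\<bar> \<le> real N * \<bar>sin x\<bar>" for x :: real
  proof (induction N)
    case (Suc N)
    have "sin (real (Suc N) * x) = sin (real N * x) * cos x + cos (real N * x) * sin x"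
      by (simp add: algebra_simps sin_add)
    also have "\<bar>\<dots>\<bar> \<le> \<bar>sin (real N * x)\<bar> * \<bar>cos x\<bar> + \<bar>cos (real N * x)\<bar> * \<bar>sin x\<bar>"
      by (metis abs_mult abs_triangle_ineq)
    also have "\<dots> \<le> \<bar>sin (real N * x)\<bar> * 1 + 1 * \<bar>sin x\<bar>"
      by (intro add_mono mult_left_mono mult_right_mono) auto
    finally show ?case using Suc by (simp add: algebra_simps)
  qed simp
  have "(sin (real N * (t / 2)))\<^sup>2 \<le> (real N * sin (t / 2))\<^sup>2"
    using s [of "t / 2"] by (simp add: abs_le_square_iff [symmetric] abs_mult)
  moreover have "cos t = 1 - 2 * (sin (t / 2))\<^sup>2" using cos_double_sin [of "t / 2"] by simp
  moreover have "cos (real N * t) = 1 - 2 * (sin (real N * (t / 2)))\<^sup>2"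
    using cos_double_sin [of "real N * (t / 2)"] by simp
  ultimately have "1 - cos (real N * t) \<le> (real N)\<^sup>2 * (2 * (sin (t / 2))\<^sup>2)"
    "2 * (sin (t / 2))\<^sup>2 = 1 - cos t"
    by (simp_all add: power_mult_distrib)
  then show ?thesis by metis
qed

text \<open>The Fejer kernel $(1 - \cos Nt)/(1 - \cos t)$ as a polynomial in $\cos t$; the recursion is the
  three term recurrence of the cosines. Its cube is a positive kernel of degree \<open>3 (N - 1)\<close> that is
  concentrated at distance \<open>1 / N\<^sup>2\<close> from 1, which is all that Jackson's argument needs.\<close>

fun fejer :: "nat \<Rightarrow> real poly" where
  "fejer 0 = 0"
| "fejer (Suc 0) = 1"
| "fejer (Suc (Suc N)) = [:0, 2:] * fejer (Suc N) - fejer N + [:2:]"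

lemma cos_three_term: "cos (real (Suc (Suc n)) * t) = 2 * cos t * cos (real (Suc n) * t) - cos (real n * t)" for t :: real
proof -
  have "cos ((real n + 1) * t + t) + cos ((real n + 1) * t - t) = 2 * (cos t * cos ((real n + 1) * t))"
    by (simp add: cos_add cos_diff)
  then show ?thesis by (simp add: algebra_simps)
qed

lemma fejer_cos: "(1 - cos t) * poly (fejer N) (cos t) = 1 - cos (real N * t)"
proof (induction N rule: fejer.induct)
  case (3 N)
  have "(1 - cos t) * poly (fejer (Suc (Suc N))) (cos t) =
      2 * cos t * ((1 - cos t) * poly (fejer (Suc N)) (cos t)) - (1 - cos t) * poly (fejer N) (cos t) + 2 * (1 - cos t)"
    by (simp add: algebra_simps)
  then show ?case unfolding 3 cos_three_term by (simp add: algebra_simps)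
qed auto

lemma degree_fejer: "degree (fejer N) \<le> N - 1"
proof (induction N rule: fejer.induct)
  case (3 N)
  have "degree ([:0, 2:] * fejer (Suc N)) \<le> Suc N"
    using 3 by (intro order_trans [OF degree_mult_le]) auto
  then show ?case using 3 by (auto intro!: degree_add_le degree_diff_le)
qed auto

lemma fejer_1: "poly (fejer N) 1 = (real N)\<^sup>2"
  by (induction N rule: fejer.induct) (auto simp: power2_eq_square algebra_simps)

lemma fejer_bounds:
  assumes y1: "-1 \<le> y" "y \<le> 1"
  shows "0 \<le> poly (fejer N) y \<and> poly (fejer N) y \<le> (real N)\<^sup>2 \<and> (1 - y) * poly (fejer N) y \<le> 2"
proof (cases "y = 1")
  case False
  with y1 have y: "-1 \<le> y" "y < 1" by auto
  define t where "t = arccos y"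
  have t: "cos t = y" using y by (simp add: t_def cos_arccos)
  have e: "(1 - y) * poly (fejer N) y = 1 - cos (real N * t)" using fejer_cos [of t N] t by simp
  have "0 \<le> (1 - y) * poly (fejer N) y" unfolding e by simp
  then have 1: "0 \<le> poly (fejer N) y" using y by (simp add: zero_le_mult_iff)
  have 2: "(1 - y) * poly (fejer N) y \<le> 2" unfolding e using cos_ge_minus_one [of "real N * t"] by linarith
  have "(1 - y) * poly (fejer N) y \<le> (1 - y) * (real N)\<^sup>2"
    unfolding e using one_minus_cos_mult_le [of N t] t by (simp add: mult.commute)
  then show ?thesis using y 1 2 by simp
qed (simp add: fejer_1)

text \<open>The bound on \<open>y\<close> forces $\arccos y \le 1/N$, where the cosine of $N \arccos y$ is still on its
  first quadratic piece.\<close>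

lemma fejer_lower:
  assumes N: "N \<ge> 1" and y: "1 - 1 / (8 * (real N)\<^sup>2) \<le> y" "y \<le> 1"
  shows "(real N)\<^sup>2 / 4 \<le> poly (fejer N) y"
proof (cases "y = 1")
  case False
  define t where "t = arccos y"
  have "1 \<le> (real N)\<^sup>2" using N by (intro one_le_power) simp
  then have "1 / (8 * (real N)\<^sup>2) \<le> 1" by (subst divide_le_eq_1_pos) linarith+
  then have y1: "-1 \<le> y" using y by linarith
  have t: "cos t = y" "0 \<le> t" "t \<le> pi" using y y1 by (auto simp: t_def cos_arccos arccos_lbound arccos_ubound)
  have "t\<^sup>2 / 8 \<le> 1 / (8 * (real N)\<^sup>2)" using one_minus_cos_ge [OF t(2,3)] y t(1) by linarith
  then have "(real N * t)\<^sup>2 \<le> 1\<^sup>2" using N by (simp add: field_simps)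
  then have "real N * t \<le> 1" by (rule power2_le_imp_le) simp
  then have Nt: "real N * t \<le> pi" using pi_gt3 by linarith
  have "(1 - y) * ((real N)\<^sup>2 / 4) \<le> (t\<^sup>2 / 2) * ((real N)\<^sup>2 / 4)"
    using one_minus_cos_le [of t] t(1) by (intro mult_right_mono) auto
  also have "\<dots> = (real N * t)\<^sup>2 / 8" by (simp add: power_mult_distrib)
  also have "\<dots> \<le> 1 - cos (real N * t)" using t Nt by (intro one_minus_cos_ge) auto
  also have "\<dots> = (1 - y) * poly (fejer N) y" using fejer_cos [of t N] t by simp
  finally show ?thesis using y False by simp
qed (simp add: fejer_1)


section \<open>Seminorms on sequences and multipliers\<close>

text \<open>A seminorm that sees only the coordinates up to \<open>m\<close>. It will be the weighted norm of the
  polynomial with these coefficients in the basis of eigenfunctions. Neither \<open>m\<close> nor \<open>K\<close> enters any of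
  the later constants, which are therefore uniform in the degree.\<close>

locale seminorm_seq =
  fixes N :: "(nat \<Rightarrow> real) \<Rightarrow> real" and m :: nat and K :: real
  assumes N_triangle: "N (\<lambda>k. c k + d k) \<le> N c + N d"
    and N_scale: "N (\<lambda>k. s * c k) = \<bar>s\<bar> * N c"
    and N_bound: "N c \<le> K * (\<Sum>k\<le>m. \<bar>c k\<bar>)"
begin

lemma N_zero [simp]: "N (\<lambda>k. 0) = 0"
  using N_scale [of 0] by simp

lemma N_nonneg: "0 \<le> N c"
proof -
  have "0 \<le> N (\<lambda>k. c k + (- 1) * c k)" by simp
  also have "\<dots> \<le> N c + N c" using N_triangle [of c "\<lambda>k. (- 1) * c k"] N_scale [of "- 1" c] by simp
  finally show ?thesis by simp
qed

lemma N_sum: "finite I \<Longrightarrow> N (\<lambda>k. \<Sum>i\<in>I. f i k) \<le> (\<Sum>i\<in>I. N (f i))"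
proof (induction I rule: finite_induct)
  case (insert i I)
  then show ?case using N_triangle [of "f i" "\<lambda>k. \<Sum>i\<in>I. f i k"] by simp
qed simp

lemma N_scale_le: "0 \<le> s \<Longrightarrow> N (\<lambda>k. s * c k) \<le> B \<Longrightarrow> N c * s \<le> B"
  unfolding N_scale by (simp add: mult.commute)

text \<open>A common fine tagged division of the interval turns the integral into a Riemann sum, to which
  the triangle inequality applies.\<close>

lemma N_integral:
  fixes a b :: real
  assumes F: "\<And>k. ((\<lambda>s. F s k) has_integral I k) {a..b}"
    and G: "(g has_integral G) {a..b}"
    and le: "\<And>s. s \<in> {a..b} \<Longrightarrow> N (F s) \<le> g s"
  shows "N I \<le> G"
proof -
  have *: "N I \<le> G + (\<bar>K\<bar> * (real m + 1) + 1) * e" if "e > 0" for e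
  proof -
    have "\<exists>\<gamma>. gauge \<gamma> \<and> (\<forall>D. D tagged_division_of {a..b} \<and> \<gamma> fine D \<longrightarrow>
        norm ((\<Sum>(x,J)\<in>D. measure lborel J *\<^sub>R F x k) - I k) < e)" for k
      by (rule F [of k, unfolded has_integral_real, rule_format, OF \<open>e > 0\<close>])
    then obtain \<gamma> where \<gamma>: "\<And>k. gauge (\<gamma> k)" "\<And>k D. D tagged_division_of {a..b} \<Longrightarrow> \<gamma> k fine D \<Longrightarrow>
        norm ((\<Sum>(x,J)\<in>D. measure lborel J *\<^sub>R F x k) - I k) < e"
      by metis
    obtain \<gamma>0 where \<gamma>0: "gauge \<gamma>0" "\<And>D. D tagged_division_of {a..b} \<Longrightarrow> \<gamma>0 fine D \<Longrightarrow>
        norm ((\<Sum>(x,J)\<in>D. measure lborel J *\<^sub>R g x) - G) < e"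
      using G [unfolded has_integral_real, rule_format, OF \<open>e > 0\<close>] by metis
    define \<delta> where "\<delta> x = \<gamma>0 x \<inter> (\<Inter>k\<in>{..m}. \<gamma> k x)" for x
    have "gauge \<delta>" using \<gamma>(1) \<gamma>0(1) by (auto simp: gauge_def \<delta>_def)
    then obtain D where D: "D tagged_division_of {a..b}" "\<delta> fine D"
      using fine_division_exists_real by blast
    have D0: "\<gamma>0 fine D" and Dk: "\<And>k. k \<le> m \<Longrightarrow> \<gamma> k fine D"
      using D(2) by (fastforce simp: fine_def \<delta>_def)+
    have fin: "finite D" using D(1) by (rule tagged_division_of_finite)
    define R where "R k = (\<Sum>(x,J)\<in>D. measure lborel J * F x k)" for k
    have "N R \<le> (\<Sum>p\<in>D. N (\<lambda>k. measure lborel (snd p) * F (fst p) k))"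
      unfolding R_def case_prod_unfold by (rule N_sum [OF fin])
    also have "\<dots> \<le> (\<Sum>p\<in>D. measure lborel (snd p) * g (fst p))"
    proof (rule sum_mono)
      fix p assume p: "p \<in> D"
      have "fst p \<in> {a..b}" using tag_in_interval [OF D(1), of "fst p" "snd p"] p by simp
      then show "N (\<lambda>k. measure lborel (snd p) * F (fst p) k) \<le> measure lborel (snd p) * g (fst p)"
        using le by (simp add: N_scale mult_left_mono)
    qed
    also have "\<dots> \<le> G + e" using \<gamma>0(2) [OF D(1) D0] by (simp add: case_prod_unfold abs_less_iff)
    finally have 1: "N R \<le> G + e" .
    have "N (\<lambda>k. I k - R k) \<le> K * (\<Sum>k\<le>m. \<bar>I k - R k\<bar>)" by (rule N_bound)
    also have "\<dots> \<le> \<bar>K\<bar> * (\<Sum>k\<le>m. \<bar>I k - R k\<bar>)" by (intro mult_right_mono sum_nonneg) auto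
    also have "\<dots> \<le> \<bar>K\<bar> * (\<Sum>k\<le>m. e)"
    proof (intro mult_left_mono sum_mono)
      fix k assume "k \<in> {..m}"
      then show "\<bar>I k - R k\<bar> \<le> e" using \<gamma>(2) [OF D(1) Dk, of k] by (simp add: R_def abs_minus_commute less_imp_le)
    qed simp
    finally have 2: "N (\<lambda>k. I k - R k) \<le> \<bar>K\<bar> * ((real m + 1) * e)" by (simp add: add.commute)
    have "N I \<le> N R + N (\<lambda>k. I k - R k)" using N_triangle [of R "\<lambda>k. I k - R k"] by simp
    with 1 2 show ?thesis by (simp add: algebra_simps)
  qed
  show ?thesis
  proof (rule field_le_epsilon)
    fix e :: real assume "e > 0"
    define B where "B = \<bar>K\<bar> * (real m + 1) + 1"
    have "B > 0" unfolding B_def by (intro add_nonneg_pos mult_nonneg_nonneg) auto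
    then show "N I \<le> G + e" using * [of "e / B"] \<open>e > 0\<close> by (simp add: B_def [symmetric])
  qed
qed

definition mult_bounded :: "(nat \<Rightarrow> real) \<Rightarrow> real \<Rightarrow> bool" where
  "mult_bounded a A \<longleftrightarrow> 0 \<le> A \<and> (\<forall>c. N (\<lambda>k. a k * c k) \<le> A * N c)"

lemma mult_boundedD: "mult_bounded a A \<Longrightarrow> N (\<lambda>k. a k * c k) \<le> A * N c"
  by (simp add: mult_bounded_def)

lemma mult_bounded_one: "mult_bounded (\<lambda>k. 1) 1"
  by (simp add: mult_bounded_def)

lemma mult_bounded_add: "mult_bounded a A \<Longrightarrow> mult_bounded b B \<Longrightarrow> mult_bounded (\<lambda>k. a k + b k) (A + B)"
  unfolding mult_bounded_def
proof (intro conjI allI)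
  fix c assume *: "0 \<le> A \<and> (\<forall>c. N (\<lambda>k. a k * c k) \<le> A * N c)" "0 \<le> B \<and> (\<forall>c. N (\<lambda>k. b k * c k) \<le> B * N c)"
  have "N (\<lambda>k. (a k + b k) * c k) \<le> N (\<lambda>k. a k * c k) + N (\<lambda>k. b k * c k)"
    using N_triangle [of "\<lambda>k. a k * c k" "\<lambda>k. b k * c k"] by (simp add: distrib_right)
  also have "\<dots> \<le> A * N c + B * N c" using * by (intro add_mono) auto
  finally show "N (\<lambda>k. (a k + b k) * c k) \<le> (A + B) * N c" by (simp add: distrib_right)
qed auto

lemma mult_bounded_minus: "mult_bounded a A \<Longrightarrow> mult_bounded (\<lambda>k. - a k) A"
  unfolding mult_bounded_def using N_scale [of "-1"] by simp

lemma mult_bounded_mult: "mult_bounded a A \<Longrightarrow> mult_bounded b B \<Longrightarrow> mult_bounded (\<lambda>k. a k * b k) (A * B)"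
  unfolding mult_bounded_def
proof (intro conjI allI)
  fix c assume *: "0 \<le> A \<and> (\<forall>c. N (\<lambda>k. a k * c k) \<le> A * N c)" "0 \<le> B \<and> (\<forall>c. N (\<lambda>k. b k * c k) \<le> B * N c)"
  have "N (\<lambda>k. a k * b k * c k) \<le> A * N (\<lambda>k. b k * c k)" using * by (simp add: mult.assoc)
  also have "\<dots> \<le> A * (B * N c)" using * by (intro mult_left_mono) auto
  finally show "N (\<lambda>k. a k * b k * c k) \<le> (A * B) * N c" by simp
qed auto

lemma mult_bounded_power: "mult_bounded a A \<Longrightarrow> mult_bounded (\<lambda>k. a k ^ i) (A ^ i)"
  by (induction i) (simp_all add: mult_bounded_one mult_bounded_mult)

lemma mult_bounded_sum:
  fixes r :: nat
  shows "(\<And>i. mult_bounded (a i) (A i)) \<Longrightarrow> mult_bounded (\<lambda>k. \<Sum>i<r. a i k) (\<Sum>i<r. A i)"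
  by (induction r) (simp add: mult_bounded_def, simp add: mult_bounded_add)

end

section \<open>Approximation with translations as multipliers\<close>

text \<open>For $y = \cos t$ the factor $((1+y)/2)^2$ is $\cos^4(t/2)$, by which the normalised translation may
  fail to be bounded when \<open>t\<close> approaches $\pi$.\<close>

locale transl_seq = seminorm_seq +
  fixes C :: real
  assumes C_ge_1: "1 \<le> C"
    and transl: "\<lbrakk>-1 < y; y \<le> 1\<rbrakk> \<Longrightarrow> N (\<lambda>k. ((1 + y) / 2)\<^sup>2 * jac k y * c k) \<le> C * N c"
begin

lemma transl_bound:
  assumes "-1 < y" "y \<le> 1"
  shows "N (\<lambda>k. jac k y * c k) \<le> 4 * C / (1 + y)\<^sup>2 * N c"
proof -
  have "N (\<lambda>k. jac k y * c k) * ((1 + y) / 2)\<^sup>2 \<le> C * N c"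
    using transl [OF assms, of c] by (intro N_scale_le) (simp_all add: mult.assoc)
  then have "N (\<lambda>k. jac k y * c k) \<le> C * N c / ((1 + y) / 2)\<^sup>2"
    using assms by (subst pos_le_divide_eq) auto
  then show ?thesis by (simp add: power_divide mult_ac)
qed

text \<open>By the Sturm-Liouville equation, \<open>(1 - v) * (1 + v) ^ 5 * jac' k v\<close> is the integral of
  \<open>(1 + u) ^ 4 * jac k u * kap k\<close>, an average of translations of \<open>kap k * c k\<close>.\<close>

lemma deriv_bound:
  assumes v: "-1 < v" "v \<le> 1"
  shows "N (\<lambda>k. jac' k v * c k) \<le> 16 * C / (1 + v) ^ 5 * N (\<lambda>k. kap k * c k)"
proof (cases "v = 1")
  case True
  have "N (\<lambda>k. jac' k v * c k) = 1 / 2 * N (\<lambda>k. kap k * c k)"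
    using N_scale [of "1 / 2" "\<lambda>k. kap k * c k"] by (simp add: True jac'_1)
  also have "\<dots> \<le> 16 * C / (1 + v) ^ 5 * N (\<lambda>k. kap k * c k)"
    using C_ge_1 N_nonneg by (intro mult_right_mono) (auto simp: True)
  finally show ?thesis .
next
  case False
  with v have v': "v < 1" by simp
  define M where "M = N (\<lambda>k. kap k * c k)"
  have M0: "M \<ge> 0" unfolding M_def by (rule N_nonneg)
  have "N (\<lambda>k. (1 - v) * (1 + v) ^ 5 * (jac' k v * c k)) \<le> (1 - v) * (16 * C * M)"
  proof (rule N_integral)
    show "((\<lambda>u. (1 + u) ^ 4 * (jac k u * (kap k * c k))) has_integral (1 - v) * (1 + v) ^ 5 * (jac' k v * c k)) {v..1}" for k
      using has_integral_mult_left [OF jac_integral_identity [OF v(2), of k], of "c k"] by (simp add: mult_ac)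
    show "((\<lambda>u. 16 * C * M) has_integral (1 - v) * (16 * C * M)) {v..1}"
      using has_integral_const_real [of "16 * C * M" v 1] v by simp
    fix u assume u: "u \<in> {v..1}"
    have "N (\<lambda>k. (1 + u) ^ 4 * (jac k u * (kap k * c k))) = (1 + u) ^ 4 * N (\<lambda>k. jac k u * (kap k * c k))"
      by (simp add: N_scale)
    also have "\<dots> \<le> (1 + u) ^ 4 * (4 * C / (1 + u)\<^sup>2 * M)"
      unfolding M_def using u v by (intro mult_left_mono transl_bound) auto
    also have "\<dots> = (1 + u)\<^sup>2 * (4 * C * M)"
    proof -
      have "(1 + u) ^ 4 = (1 + u)\<^sup>2 * (1 + u)\<^sup>2" by (simp flip: power_add)
      moreover have "(1 + u)\<^sup>2 \<noteq> 0" using u v by simp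
      moreover have "X * X * (4 * C / X * M) = X * (4 * C * M)" if "X \<noteq> 0" for X :: real
        using that by simp
      ultimately show ?thesis by metis
    qed
    also have "\<dots> \<le> 2\<^sup>2 * (4 * C * M)"
      using u v M0 C_ge_1 by (intro mult_right_mono power_mono) auto
    finally show "N (\<lambda>k. (1 + u) ^ 4 * (jac k u * (kap k * c k))) \<le> 16 * C * M" by simp
  qed
  then have "N (\<lambda>k. jac' k v * c k) * ((1 - v) * (1 + v) ^ 5) \<le> (1 - v) * (16 * C * M)"
    using v by (intro N_scale_le) auto
  then have "(1 - v) * (N (\<lambda>k. jac' k v * c k) * (1 + v) ^ 5) \<le> (1 - v) * (16 * C * M)"
    by (simp add: mult_ac)
  then have "N (\<lambda>k. jac' k v * c k) * (1 + v) ^ 5 \<le> 16 * C * M"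
    using v' by simp
  then show ?thesis using v by (simp add: M_def [symmetric] field_simps)
qed

text \<open>Since $1 - y$ is comparable to $t^2$ for $y = \cos t$, this says that the difference with step \<open>t\<close> is
  of the order $t^2$ times the second order derivative. The power of \<open>1 + y\<close> is not larger than that of
  the weight $(1+y)^4$ against which translations are averaged.\<close>

lemma difference_bound:
  assumes y: "-1 < y" "y \<le> 1"
  shows "N (\<lambda>k. (1 - jac k y) * c k) \<le> 8 * C * (1 - y) / (1 + y) ^ 4 * N (\<lambda>k. kap k * c k)"
proof -
  define M where "M = N (\<lambda>k. kap k * c k)"
  have M0: "M \<ge> 0" unfolding M_def by (rule N_nonneg)
  have "N (\<lambda>k. (1 - jac k y) * c k) \<le> - (4 * C * M / (1 + 1) ^ 4) - (- (4 * C * M / (1 + y) ^ 4))"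
  proof (rule N_integral)
    show "((\<lambda>v. jac' k v * c k) has_integral (1 - jac k y) * c k) {y..1}" for k
      by (rule has_integral_mult_left [OF jac_diff_integral [OF y(2)]])
    have d: "((\<lambda>v. - (4 * C * M / (1 + v) ^ 4)) has_vector_derivative 16 * C / (1 + v) ^ 5 * M) (at v within {y..1})"
      if "v \<in> {y..1}" for v
    proof -
      have *: "((\<lambda>w. - (4 * C * M / w ^ 4)) has_real_derivative 16 * C / w ^ 5 * M) (at w)" if "w > 0" for w
        using that by (auto intro!: derivative_eq_intros simp: field_simps eval_nat_numeral)
      have "((\<lambda>v. - (4 * C * M / (v + 1) ^ 4)) has_real_derivative 16 * C / (v + 1) ^ 5 * M) (at v)"
        using * [of "v + 1"] that y DERIV_shift [of "\<lambda>w. - (4 * C * M / w ^ 4)" "16 * C / (v + 1) ^ 5 * M" v 1] by simp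
      then have "((\<lambda>v. - (4 * C * M / (1 + v) ^ 4)) has_real_derivative 16 * C / (1 + v) ^ 5 * M) (at v)"
        by (simp only: add.commute [of 1])
      then show ?thesis
        unfolding has_real_derivative_iff_has_vector_derivative [symmetric]
        by (rule has_field_derivative_at_within)
    qed
    show "((\<lambda>v. 16 * C / (1 + v) ^ 5 * M) has_integral - (4 * C * M / (1 + 1) ^ 4) - (- (4 * C * M / (1 + y) ^ 4))) {y..1}"
      by (rule fundamental_theorem_of_calculus [OF y(2) d])
    show "N (\<lambda>k. jac' k v * c k) \<le> 16 * C / (1 + v) ^ 5 * M" if "v \<in> {y..1}" for v
      unfolding M_def using that y by (intro deriv_bound) auto
  qed
  also have "\<dots> = C * M / 4 * ((16 - (1 + y) ^ 4) / (1 + y) ^ 4)"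
    using y by (simp add: field_simps)
  also have "\<dots> \<le> C * M / 4 * ((32 * (1 - y)) / (1 + y) ^ 4)"
  proof -
    define q where "q = 1 + y"
    have q: "0 < q" "q \<le> 2" using y by (auto simp: q_def)
    have "q\<^sup>2 \<le> 2\<^sup>2" using q by (intro power_mono) auto
    then have "(2 + q) * (4 + q\<^sup>2) \<le> 4 * 8" using q by (intro mult_mono) auto
    then have "(2 - q) * ((2 + q) * (4 + q\<^sup>2)) \<le> (2 - q) * 32" using q by (intro mult_left_mono) auto
    moreover have "16 - q ^ 4 = (2 - q) * ((2 + q) * (4 + q\<^sup>2))" by (simp add: algebra_simps eval_nat_numeral)
    ultimately have "16 - (1 + y) ^ 4 \<le> 32 * (1 - y)" by (simp add: q_def)
    then show ?thesis using C_ge_1 M0 y by (intro mult_left_mono divide_right_mono) auto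
  qed
  also have "\<dots> = 8 * C * (1 - y) / (1 + y) ^ 4 * M"
  proof -
    define z X where "z = 1 - y" and "X = (1 + y) ^ 4"
    show ?thesis unfolding z_def [symmetric] X_def [symmetric] by simp
  qed
  finally show ?thesis unfolding M_def .
qed

end


section \<open>Jackson operators and smoothing\<close>

lemma fejer_cube_integral_upper:
  assumes N: "N \<ge> 1"
  shows "integral {-1..1} (\<lambda>y. (1 - y) * poly (fejer N ^ 3) y) \<le> 32 * (real N)\<^sup>2"
proof -
  define \<epsilon> where "\<epsilon> = 2 / (real N)\<^sup>2"
  have \<epsilon>: "\<epsilon> > 0" using N by (simp add: \<epsilon>_def)
  have int: "((\<lambda>y. 64 / (1 - y + \<epsilon>)\<^sup>2) has_integral 64 / (1 - 1 + \<epsilon>) - 64 / (1 - (-1) + \<epsilon>)) {-1..1}"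
  proof (rule fundamental_theorem_of_calculus)
    fix y :: real assume "y \<in> {-1..1}"
    then have "1 - y + \<epsilon> > 0" using \<epsilon> by auto
    then have "((\<lambda>y. 64 / (1 - y + \<epsilon>)) has_real_derivative 64 / (1 - y + \<epsilon>)\<^sup>2) (at y)"
      by (auto intro!: derivative_eq_intros simp: power2_eq_square)
    then show "((\<lambda>y. 64 / (1 - y + \<epsilon>)) has_vector_derivative 64 / (1 - y + \<epsilon>)\<^sup>2) (at y within {-1..1})"
      unfolding has_real_derivative_iff_has_vector_derivative [symmetric]
      by (rule has_field_derivative_at_within)
  qed simp
  have "integral {-1..1} (\<lambda>y. (1 - y) * poly (fejer N ^ 3) y) \<le> 64 / (1 - 1 + \<epsilon>) - 64 / (1 - (-1) + \<epsilon>)"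
  proof (rule has_integral_le [OF integrable_integral int])
    show "(\<lambda>y. (1 - y) * poly (fejer N ^ 3) y) integrable_on {-1..1}"
      by (intro integrable_continuous_interval continuous_intros)
    fix y :: real assume y: "y \<in> {-1..1}"
    define P where "P = poly (fejer N) y"
    have P: "0 \<le> P" "P \<le> (real N)\<^sup>2" "(1 - y) * P \<le> 2" using fejer_bounds [of y N] y by (auto simp: P_def)
    have z: "0 \<le> 1 - y" "1 - y + \<epsilon> > 0" using y \<epsilon> by auto
    have "P * \<epsilon> \<le> (real N)\<^sup>2 * \<epsilon>" using P \<epsilon> by (intro mult_right_mono) auto
    also have "\<dots> = 2" using N by (simp add: \<epsilon>_def)
    finally have A: "P * (1 - y + \<epsilon>) \<le> 4" using P(3) by (simp add: algebra_simps)
    have "(1 - y) * P ^ 3 * (1 - y + \<epsilon>)\<^sup>2 \<le> (1 - y + \<epsilon>) * P ^ 3 * (1 - y + \<epsilon>)\<^sup>2"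
      using P z \<epsilon> by (intro mult_right_mono) auto
    also have "\<dots> = (P * (1 - y + \<epsilon>)) ^ 3" by (simp add: power_mult_distrib eval_nat_numeral mult_ac)
    also have "\<dots> \<le> 4 ^ 3" using A P z by (intro power_mono mult_nonneg_nonneg) auto
    finally have "(1 - y) * P ^ 3 * (1 - y + \<epsilon>)\<^sup>2 \<le> 64" by simp
    moreover have "0 < (1 - y + \<epsilon>)\<^sup>2" using z by simp
    ultimately show "(1 - y) * poly (fejer N ^ 3) y \<le> 64 / (1 - y + \<epsilon>)\<^sup>2"
      by (simp add: pos_le_divide_eq P_def)
  qed
  also have "\<dots> \<le> 64 / \<epsilon>" using \<epsilon> by simp
  also have "\<dots> = 32 * (real N)\<^sup>2" by (simp add: \<epsilon>_def)
  finally show ?thesis .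
qed

lemma fejer_cube_integral_lower:
  assumes N: "N \<ge> 1"
  shows "(real N) ^ 4 / 512 \<le> integral {-1..1} (\<lambda>y. poly (fejer N ^ 3) y * (1 + y) ^ 4)"
proof -
  define \<delta> where "\<delta> = 1 / (8 * (real N)\<^sup>2)"
  have "1 \<le> (real N)\<^sup>2" using N by (intro one_le_power) simp
  then have "1 \<le> 8 * (real N)\<^sup>2" by linarith
  then have \<delta>: "0 < \<delta>" "\<delta> \<le> 1" using N by (simp_all add: \<delta>_def)
  have 1: "(real N) ^ 4 / 512 = integral {1 - \<delta>..1} (\<lambda>y. ((real N)\<^sup>2 / 4) ^ 3 * 1)"
    using \<delta> N by (simp add: \<delta>_def field_simps eval_nat_numeral)
  also have "\<dots> \<le> integral {1 - \<delta>..1} (\<lambda>y. poly (fejer N ^ 3) y * (1 + y) ^ 4)"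
  proof (rule integral_le)
    show "(\<lambda>y. ((real N)\<^sup>2 / 4) ^ 3 * 1) integrable_on {1 - \<delta>..1}"
      "(\<lambda>y. poly (fejer N ^ 3) y * (1 + y) ^ 4) integrable_on {1 - \<delta>..1}"
      by (intro integrable_continuous_interval continuous_intros)+
    fix y assume y: "y \<in> {1 - \<delta>..1}"
    have 1: "(real N)\<^sup>2 / 4 \<le> poly (fejer N) y" using y by (intro fejer_lower N) (auto simp: \<delta>_def)
    then have 2: "0 \<le> poly (fejer N) y" by (rule order_trans [rotated]) simp
    have 3: "1 \<le> (1 + y) ^ 4" using y \<delta> by (intro one_le_power) auto
    show "((real N)\<^sup>2 / 4) ^ 3 * 1 \<le> poly (fejer N ^ 3) y * (1 + y) ^ 4"
      unfolding poly_power using 1 2 3 by (intro mult_mono power_mono) auto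
  qed
  also have "\<dots> \<le> integral {-1..1} (\<lambda>y. poly (fejer N ^ 3) y * (1 + y) ^ 4)"
  proof (rule integral_subset_le)
    show "\<forall>y\<in>{-1..1}. 0 \<le> poly (fejer N ^ 3) y * (1 + y) ^ 4"
      using fejer_bounds [of _ N] by simp
  qed (use \<delta> in \<open>auto intro!: integrable_continuous_interval continuous_intros\<close>)
  finally show ?thesis .
qed

context transl_seq
begin

text \<open>Averaging the translation with density \<open>poly P y * (1 + y) ^ 4\<close>, where \<open>P\<close> is a positive polynomial
  of degree below \<open>n\<close>, annihilates all eigenfunctions from \<open>n\<close> on by orthogonality, and is near the
  identity because the density sits near 1. The constant is 9 times the quotient of the bounds for the
  two integrals of the cube above, the 9 coming from \<open>n \<le> 3 * L\<close>.\<close>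

definition jackson_const :: real where "jackson_const = 8 * C * 147456"

lemma jackson_multiplier:
  assumes n: "n \<ge> 1"
  obtains j where "\<And>k. n \<le> k \<Longrightarrow> j k = 0"
    "\<And>c. N (\<lambda>k. (1 - j k) * c k) \<le> jackson_const / (real n)\<^sup>2 * N (\<lambda>k. kap k * c k)"
proof -
  define L where "L = (n - 1) div 3 + 1"
  have "n \<le> 3 * L" unfolding L_def using n by presburger
  moreover have "3 * ((n - 1) div 3) < n" using n by presburger
  ultimately have L: "L \<ge> 1" "real n \<le> 3 * real L" "3 * (L - 1) < n" by (simp_all add: L_def)
  define P where "P = fejer L ^ 3"
  have degP: "degree P < n"
  proof -
    have "degree P \<le> degree (fejer L) * 3" unfolding P_def by (rule degree_power_le)
    also have "\<dots> \<le> (L - 1) * 3" using degree_fejer by (intro mult_right_mono) auto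
    finally show ?thesis using L by simp
  qed
  have P0: "0 \<le> poly P y" if "y \<in> {-1..1}" for y
    using fejer_bounds [of y L] that by (simp add: P_def)
  define Z where "Z = integral {-1..1} (\<lambda>y. poly P y * (1 + y) ^ 4)"
  define U where "U = integral {-1..1} (\<lambda>y. (1 - y) * poly P y)"
  have Z: "real L ^ 4 / 512 \<le> Z" and U: "U \<le> 32 * (real L)\<^sup>2"
    unfolding Z_def U_def P_def
    by (rule fejer_cube_integral_lower [OF L(1)], rule fejer_cube_integral_upper [OF L(1)])
  have Z0: "Z > 0" using Z L by (intro less_le_trans [OF _ Z]) simp
  define j where "j k = integral {-1..1} (\<lambda>y. poly P y * (1 + y) ^ 4 * jac k y) / Z" for k
  have j0: "j k = 0" if "n \<le> k" for k
    using integral_unique [OF jac_orthogonal [of P k]] degP that by (simp add: j_def)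
  have main: "N (\<lambda>k. (1 - j k) * c k) \<le> jackson_const / (real n)\<^sup>2 * N (\<lambda>k. kap k * c k)" for c
  proof -
    define M where "M = N (\<lambda>k. kap k * c k)"
    have M0: "M \<ge> 0" unfolding M_def by (rule N_nonneg)
    have "N (\<lambda>k. Z * ((1 - j k) * c k)) \<le> 8 * C * M * U"
    proof (rule N_integral)
      fix k
      have "((\<lambda>y. poly P y * (1 + y) ^ 4 - poly P y * (1 + y) ^ 4 * jac k y) has_integral Z - Z * j k) {-1..1}"
        unfolding Z_def [symmetric] j_def using Z0
        by (intro has_integral_diff)
          (auto simp: Z_def intro!: integrable_integral integrable_continuous_interval continuous_intros)
      from has_integral_mult_left [OF this, of "c k"]
      show "((\<lambda>y. poly P y * (1 + y) ^ 4 * ((1 - jac k y) * c k)) has_integral Z * ((1 - j k) * c k)) {-1..1}"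
        by (simp add: algebra_simps)
      have "((\<lambda>y. (1 - y) * poly P y) has_integral U) {-1..1}"
        unfolding U_def by (intro integrable_integral integrable_continuous_interval continuous_intros)
      then show "((\<lambda>y. 8 * C * M * ((1 - y) * poly P y)) has_integral 8 * C * M * U) {-1..1}"
        by (rule has_integral_mult_right)
      fix y :: real assume y: "y \<in> {-1..1}"
      show "N (\<lambda>k. poly P y * (1 + y) ^ 4 * ((1 - jac k y) * c k)) \<le> 8 * C * M * ((1 - y) * poly P y)"
      proof (cases "y = -1")
        case True
        then show ?thesis using M0 C_ge_1 P0 [OF y] by simp
      next
        case False
        with y have y': "-1 < y" "y \<le> 1" by auto
        have "N (\<lambda>k. poly P y * (1 + y) ^ 4 * ((1 - jac k y) * c k)) = poly P y * (1 + y) ^ 4 * N (\<lambda>k. (1 - jac k y) * c k)"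
          using P0 [OF y] N_scale [of "poly P y * (1 + y) ^ 4" "\<lambda>k. (1 - jac k y) * c k"] by simp
        also have "\<dots> \<le> poly P y * (1 + y) ^ 4 * (8 * C * (1 - y) / (1 + y) ^ 4 * M)"
          unfolding M_def using P0 [OF y] y' by (intro mult_left_mono difference_bound mult_nonneg_nonneg) auto
        also have "\<dots> = 8 * C * M * ((1 - y) * poly P y)"
        proof -
          have "p * X * (8 * C * z / X * M) = 8 * C * M * (z * p)" if "X \<noteq> 0" for p X z :: real
            using that by simp
          moreover have "(1 + y) ^ 4 \<noteq> 0" using y' by simp
          ultimately show ?thesis by metis
        qed
        finally show ?thesis .
      qed
    qed
    then have "N (\<lambda>k. (1 - j k) * c k) * Z \<le> 8 * C * M * U"
      using Z0 by (intro N_scale_le) auto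
    also have "\<dots> \<le> 8 * C * M * (32 * (real L)\<^sup>2)"
      using U M0 C_ge_1 by (intro mult_left_mono) auto
    also have "\<dots> \<le> 8 * C * M * (147456 / (real n)\<^sup>2 * (real L ^ 4 / 512))"
    proof (intro mult_left_mono)
      have "(real n)\<^sup>2 \<le> (3 * real L)\<^sup>2" using L by (intro power_mono) auto
      then have "(real n)\<^sup>2 * (real L)\<^sup>2 \<le> 9 * (real L)\<^sup>2 * (real L)\<^sup>2"
        by (intro mult_right_mono) (auto simp: power_mult_distrib)
      then have "(real n)\<^sup>2 * (real L)\<^sup>2 \<le> 9 * real L ^ 4" by (simp add: eval_nat_numeral mult_ac)
      then show "32 * (real L)\<^sup>2 \<le> 147456 / (real n)\<^sup>2 * (real L ^ 4 / 512)"
        using n by (simp add: field_simps)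
    qed (use M0 C_ge_1 in auto)
    also have "\<dots> \<le> 8 * C * M * (147456 / (real n)\<^sup>2 * Z)"
      using Z M0 C_ge_1 by (intro mult_left_mono) auto
    also have "\<dots> = jackson_const / (real n)\<^sup>2 * M * Z" by (simp add: jackson_const_def)
    finally show ?thesis using Z0 by (simp only: M_def mult_le_cancel_right_pos)
  qed
  from that [OF j0 main] show thesis .
qed

text \<open>An average, possibly signed, of the differences \<open>1 - jac k v\<close> over \<open>v\<close> between \<open>\<eta>\<close> and 1 with total mass
  at most \<open>B\<close> has this property. Only the property is needed, and it is inherited by powers
  when mixed differences with independent steps are bounded.\<close>

definition smoothed :: "real \<Rightarrow> (nat \<Rightarrow> real) \<Rightarrow> real \<Rightarrow> bool" where
  "smoothed \<eta> e B \<longleftrightarrow> (\<forall>c M. (\<forall>v\<in>{\<eta>..1}. N (\<lambda>k. (1 - jac k v) * c k) \<le> M) \<longrightarrow> N (\<lambda>k. e k * c k) \<le> B * M)"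

lemma smoothed_power:
  assumes e: "smoothed \<eta> e B"
    and M: "\<And>ys. (\<And>j. j \<in> {1..r} \<Longrightarrow> ys j \<in> {\<eta>..1}) \<Longrightarrow> N (\<lambda>k. (\<Prod>j=1..r. 1 - jac k (ys j)) * c k) \<le> M"
  shows "N (\<lambda>k. e k ^ r * c k) \<le> B ^ r * M"
  using M
proof (induction r arbitrary: c M)
  case 0
  from "0.prems" [of "\<lambda>_. 1"] show ?case by simp
next
  case (Suc r)
  have "N (\<lambda>k. (\<Prod>j=1..r. 1 - jac k (ys j)) * (e k * c k)) \<le> B * M"
    if ys: "\<And>j. j \<in> {1..r} \<Longrightarrow> ys j \<in> {\<eta>..1}" for ys
  proof -
    have "N (\<lambda>k. (1 - jac k v) * ((\<Prod>j=1..r. 1 - jac k (ys j)) * c k)) \<le> M" if v: "v \<in> {\<eta>..1}" for v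
    proof -
      have "N (\<lambda>k. (\<Prod>j=1..Suc r. 1 - jac k ((ys(Suc r := v)) j)) * c k) \<le> M"
        using v ys by (intro Suc.prems) auto
      moreover have "(\<Prod>j=1..Suc r. 1 - jac k ((ys(Suc r := v)) j)) = (1 - jac k v) * (\<Prod>j=1..r. 1 - jac k (ys j))" for k
      proof -
        have "(\<Prod>j=1..r. 1 - jac k ((ys(Suc r := v)) j)) = (\<Prod>j=1..r. 1 - jac k (ys j))"
          by (intro prod.cong) auto
        then show ?thesis by simp
      qed
      ultimately show ?thesis by (simp only: mult.assoc)
    qed
    then have "N (\<lambda>k. e k * ((\<Prod>j=1..r. 1 - jac k (ys j)) * c k)) \<le> B * M"
      using e by (simp add: smoothed_def)
    then show ?thesis by (simp add: mult_ac)
  qed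
  from Suc.IH [OF this] have "N (\<lambda>k. e k ^ r * (e k * c k)) \<le> B ^ r * (B * M)" by simp
  then show ?case by (simp add: mult_ac)
qed


text \<open>The density \<open>(u - \<eta>) * (1 + u) ^ 4\<close> vanishes at \<open>\<eta>\<close>. Integrating by parts twice against the
  Sturm-Liouville operator therefore leaves differences only: one at \<open>\<eta>\<close> and an average over the interval.
  The mass of the density is of the order $(1-\eta)^2$ and that of the result $1-\eta$, so that the quotient
  is of the order $n^2$.\<close>

lemma averaging_multiplier:
  assumes n: "n \<ge> 1"
  defines "\<eta> \<equiv> cos (1 / real n)"
  obtains a where "mult_bounded a (4 * C)" "smoothed \<eta> (\<lambda>k. 1 - a k) 1"
    "smoothed \<eta> (\<lambda>k. kap k * a k) (1536 * (real n)\<^sup>2)"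
proof -
  have n1: "1 / real n \<le> 1" "0 \<le> 1 / real n" using n by auto
  have \<eta>: "0 \<le> \<eta>" "\<eta> \<le> 1" "1 / (8 * (real n)\<^sup>2) \<le> 1 - \<eta>"
  proof -
    show "0 \<le> \<eta>" unfolding \<eta>_def using n1 pi_gt3 by (intro cos_ge_zero) linarith+
    show "1 / (8 * (real n)\<^sup>2) \<le> 1 - \<eta>"
      using one_minus_cos_ge [of "1 / real n"] n1 pi_gt3 by (simp add: \<eta>_def power_divide)
  qed (simp add: \<eta>_def)
  have \<eta>1: "\<eta> < 1"
  proof -
    have "0 < 1 / (8 * (real n)\<^sup>2)" using n by simp
    with \<eta> show ?thesis by linarith
  qed
  define \<rho> where "\<rho> u = (u - \<eta>) * (1 + u) ^ 4" for u
  define Z where "Z = integral {\<eta>..1} \<rho>"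
  have \<rho>c: "continuous_on S \<rho>" for S unfolding \<rho>_def [abs_def] by (intro continuous_intros)
  have \<rho>Z: "(\<rho> has_integral Z) {\<eta>..1}"
    unfolding Z_def by (intro integrable_integral integrable_continuous_interval \<rho>c)
  have Z: "(1 - \<eta>)\<^sup>2 / 2 \<le> Z"
  proof (rule has_integral_le [OF _ \<rho>Z])
    have "((\<lambda>u. (u - \<eta>)\<^sup>2 / 2) has_real_derivative u - \<eta>) (at u)" for u
      by (auto intro!: derivative_eq_intros)
    from FTC_real [OF \<eta>(2) this] show "((\<lambda>u. u - \<eta>) has_integral (1 - \<eta>)\<^sup>2 / 2) {\<eta>..1}" by simp
    fix u assume u: "u \<in> {\<eta>..1}"
    have "1 \<le> (1 + u) ^ 4" using u \<eta> by (intro one_le_power) auto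
    then show "u - \<eta> \<le> \<rho> u" using u unfolding \<rho>_def by (simp add: mult_le_cancel_left1)
  qed
  have Z0: "Z > 0" using \<eta>1 by (intro less_le_trans [OF _ Z]) simp
  have \<rho>0: "0 \<le> \<rho> u" if "u \<in> {\<eta>..1}" for u using that \<eta> by (simp add: \<rho>_def)
  define a where "a k = integral {\<eta>..1} (\<lambda>u. \<rho> u * jac k u) / Z" for k
  have aZ: "((\<lambda>u. \<rho> u * jac k u) has_integral Z * a k) {\<eta>..1}" for k
    unfolding a_def using Z0
    by (auto intro!: integrable_integral integrable_continuous_interval continuous_intros \<rho>c)
  have "mult_bounded a (4 * C)"
    unfolding mult_bounded_def
  proof (intro conjI allI)
    fix c
    have "N (\<lambda>k. Z * (a k * c k)) \<le> Z * (4 * C * N c)"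
    proof (rule N_integral)
      show "((\<lambda>u. \<rho> u * (jac k u * c k)) has_integral Z * (a k * c k)) {\<eta>..1}" for k
        using has_integral_mult_left [OF aZ [of k], of "c k"] by (simp add: mult.assoc)
      show "((\<lambda>u. \<rho> u * (4 * C * N c)) has_integral Z * (4 * C * N c)) {\<eta>..1}"
        by (rule has_integral_mult_left [OF \<rho>Z])
      fix u assume u: "u \<in> {\<eta>..1}"
      have "N (\<lambda>k. jac k u * c k) \<le> 4 * C / (1 + u)\<^sup>2 * N c"
        using u \<eta> by (intro transl_bound) auto
      also have "\<dots> \<le> 4 * C / 1 * N c"
        using u \<eta> C_ge_1 N_nonneg by (intro mult_right_mono divide_left_mono one_le_power) auto
      finally have "\<rho> u * N (\<lambda>k. jac k u * c k) \<le> \<rho> u * (4 * C * N c)"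
        using \<rho>0 [OF u] by (intro mult_left_mono) auto
      then show "N (\<lambda>k. \<rho> u * (jac k u * c k)) \<le> \<rho> u * (4 * C * N c)"
        using \<rho>0 [OF u] by (simp add: N_scale)
    qed
    then have "N (\<lambda>k. a k * c k) * Z \<le> Z * (4 * C * N c)" using Z0 by (intro N_scale_le) auto
    then show "N (\<lambda>k. a k * c k) \<le> 4 * C * N c" using Z0 by simp
  qed (use C_ge_1 in simp)
  moreover have "smoothed \<eta> (\<lambda>k. 1 - a k) 1"
    unfolding smoothed_def
  proof (intro allI impI)
    fix c M assume M: "\<forall>v\<in>{\<eta>..1}. N (\<lambda>k. (1 - jac k v) * c k) \<le> M"
    have "N (\<lambda>k. Z * ((1 - a k) * c k)) \<le> Z * M"
    proof (rule N_integral)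
      show "((\<lambda>u. \<rho> u * ((1 - jac k u) * c k)) has_integral Z * ((1 - a k) * c k)) {\<eta>..1}" for k
        using has_integral_mult_left [OF has_integral_diff [OF \<rho>Z aZ [of k]], of "c k"] by (simp add: algebra_simps)
      show "((\<lambda>u. \<rho> u * M) has_integral Z * M) {\<eta>..1}"
        by (rule has_integral_mult_left [OF \<rho>Z])
      fix u assume u: "u \<in> {\<eta>..1}"
      have "\<rho> u * N (\<lambda>k. (1 - jac k u) * c k) \<le> \<rho> u * M"
        using \<rho>0 [OF u] M u by (intro mult_left_mono) auto
      then show "N (\<lambda>k. \<rho> u * ((1 - jac k u) * c k)) \<le> \<rho> u * M"
        using \<rho>0 [OF u] N_scale [of "\<rho> u" "\<lambda>k. (1 - jac k u) * c k"] by simp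
    qed
    then have "N (\<lambda>k. (1 - a k) * c k) * Z \<le> Z * M" using Z0 by (intro N_scale_le) auto
    then show "N (\<lambda>k. (1 - a k) * c k) \<le> 1 * M" using Z0 by simp
  qed
  moreover have "smoothed \<eta> (\<lambda>k. kap k * a k) (1536 * (real n)\<^sup>2)"
    unfolding smoothed_def
  proof (intro allI impI)
    fix c M assume M: "\<forall>v\<in>{\<eta>..1}. N (\<lambda>k. (1 - jac k v) * c k) \<le> M"
    have M0: "0 \<le> M" using M N_nonneg \<eta> by (meson atLeastAtMost_iff order_refl order_trans)
    define b where "b = (1 - \<eta>) * (1 + \<eta>) ^ 5"
    define \<sigma> where "\<sigma> v = (1 + v) ^ 4 * (4 - 6 * v)" for v :: real
    define s where "s k = kap k * (Z * a k) - b * (1 - jac k \<eta>)" for k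
    have s: "((\<lambda>v. \<sigma> v * (1 - jac k v)) has_integral s k) {\<eta>..1}" for k
    proof -
      define H where "H = (\<lambda>v. (1 - v) * (1 + v) ^ 5 * jac' k v)"
      define D where "D = (\<lambda>v::real. (1 - v) * (1 + v) ^ 5)"
      define \<Psi> where "\<Psi> = (\<lambda>v. (v - \<eta>) * H v + D v * (1 - jac k v))"
      have H: "(H has_real_derivative - kap k * (1 + v) ^ 4 * jac k v) (at v)" for v
        unfolding H_def by (rule jac_ode)
      have D: "(D has_real_derivative \<sigma> v) (at v)" for v
        unfolding D_def \<sigma>_def
        by (rule derivative_eq_intros refl | simp)+ (simp add: algebra_simps eval_nat_numeral)
      have "(\<Psi> has_real_derivative \<sigma> v * (1 - jac k v) - kap k * (\<rho> v * jac k v)) (at v)" for v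
      proof -
        have "(\<Psi> has_real_derivative (1 * H v + (- kap k * (1 + v) ^ 4 * jac k v) * (v - \<eta>))
            + (\<sigma> v * (1 - jac k v) + (0 - jac' k v) * D v)) (at v)"
          unfolding \<Psi>_def
          by (intro DERIV_add DERIV_mult H D DERIV_diff DERIV_const jac_has_derivative)
            (auto intro!: derivative_eq_intros)
        also have "(1 * H v + (- kap k * (1 + v) ^ 4 * jac k v) * (v - \<eta>))
            + (\<sigma> v * (1 - jac k v) + (0 - jac' k v) * D v) = \<sigma> v * (1 - jac k v) - kap k * (\<rho> v * jac k v)"
        proof -
          have "H v = jac' k v * D v" by (simp add: H_def D_def)
          then show ?thesis by (simp add: \<rho>_def mult_ac)
        qed
        finally show ?thesis .
      qed
      from FTC_real [OF \<eta>(2) this]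
      have "((\<lambda>v. \<sigma> v * (1 - jac k v) - kap k * (\<rho> v * jac k v)) has_integral - (b * (1 - jac k \<eta>))) {\<eta>..1}"
        by (simp add: \<Psi>_def D_def b_def H_def)
      from has_integral_add [OF this has_integral_mult_right [OF aZ [of k], of "kap k"]]
      show ?thesis by (simp add: s_def)
    qed
    have s_le: "N (\<lambda>k. s k * c k) \<le> (1 - \<eta>) * (64 * M)"
    proof (rule N_integral)
      show "((\<lambda>v. \<sigma> v * ((1 - jac k v) * c k)) has_integral s k * c k) {\<eta>..1}" for k
        using has_integral_mult_left [OF s [of k], of "c k"] by (simp add: mult.assoc)
      show "((\<lambda>u. 64 * M) has_integral (1 - \<eta>) * (64 * M)) {\<eta>..1}"
        using has_integral_const_real [of "64 * M" \<eta> 1] \<eta> by simp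
      fix v assume v: "v \<in> {\<eta>..1}"
      have "\<bar>\<sigma> v\<bar> \<le> 2 ^ 4 * 4"
        unfolding \<sigma>_def abs_mult using v \<eta> power_mono [of "1 + v" 2 4] by (intro mult_mono) auto
      then have "\<bar>\<sigma> v\<bar> * N (\<lambda>k. (1 - jac k v) * c k) \<le> 64 * M"
        using M v N_nonneg by (intro mult_mono) auto
      then show "N (\<lambda>k. \<sigma> v * ((1 - jac k v) * c k)) \<le> 64 * M"
        using N_scale [of "\<sigma> v" "\<lambda>k. (1 - jac k v) * c k"] by simp
    qed
    have b: "0 \<le> b" "b \<le> (1 - \<eta>) * 32"
    proof -
      have "(1 + \<eta>) ^ 5 \<le> 2 ^ 5" using \<eta> by (intro power_mono) auto
      then show "b \<le> (1 - \<eta>) * 32" unfolding b_def using \<eta> by (intro mult_left_mono) auto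
    qed (use \<eta> in \<open>simp add: b_def\<close>)
    have "N (\<lambda>k. b * ((1 - jac k \<eta>) * c k)) = b * N (\<lambda>k. (1 - jac k \<eta>) * c k)"
      using b N_scale [of b "\<lambda>k. (1 - jac k \<eta>) * c k"] by simp
    also have "\<dots> \<le> (1 - \<eta>) * 32 * M"
      using b M \<eta> N_nonneg by (intro mult_mono) auto
    finally have b_le: "N (\<lambda>k. b * ((1 - jac k \<eta>) * c k)) \<le> (1 - \<eta>) * 32 * M" .
    have "N (\<lambda>k. Z * (kap k * a k * c k)) = N (\<lambda>k. s k * c k + b * ((1 - jac k \<eta>) * c k))"
      by (rule arg_cong [where f = N]) (simp add: s_def algebra_simps)
    also have "\<dots> \<le> (1 - \<eta>) * (64 * M) + (1 - \<eta>) * 32 * M"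
      by (rule order_trans [OF N_triangle add_mono [OF s_le b_le]])
    also have "\<dots> = 96 * M * (1 - \<eta>)" by simp
    finally have "N (\<lambda>k. kap k * a k * c k) * Z \<le> 96 * M * (1 - \<eta>)"
      using Z0 by (intro N_scale_le) auto
    moreover have "N (\<lambda>k. kap k * a k * c k) * ((1 - \<eta>)\<^sup>2 / 2) \<le> N (\<lambda>k. kap k * a k * c k) * Z"
      using Z N_nonneg by (intro mult_left_mono) auto
    ultimately have Q: "N (\<lambda>k. kap k * a k * c k) * ((1 - \<eta>)\<^sup>2 / 2) \<le> 96 * M * (1 - \<eta>)" by linarith
    have Q2: "(1 - \<eta>) * (Q * (1 - \<eta>)) = 2 * (Q * ((1 - \<eta>)\<^sup>2 / 2))" for Q
      by (simp add: power2_eq_square)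
    have "(1 - \<eta>) * (N (\<lambda>k. kap k * a k * c k) * (1 - \<eta>)) \<le> 2 * (96 * M * (1 - \<eta>))"
      unfolding Q2 using Q by linarith
    then have "(1 - \<eta>) * (N (\<lambda>k. kap k * a k * c k) * (1 - \<eta>)) \<le> (1 - \<eta>) * (192 * M)" by (simp add: mult_ac)
    then have "N (\<lambda>k. kap k * a k * c k) * (1 - \<eta>) \<le> 192 * M" using \<eta>1 by simp
    moreover have "N (\<lambda>k. kap k * a k * c k) * (1 / (8 * (real n)\<^sup>2)) \<le> N (\<lambda>k. kap k * a k * c k) * (1 - \<eta>)"
      using \<eta> N_nonneg by (intro mult_left_mono) auto
    ultimately have "N (\<lambda>k. kap k * a k * c k) * (1 / (8 * (real n)\<^sup>2)) \<le> 192 * M" by linarith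
    then show "N (\<lambda>k. kap k * a k * c k) \<le> 1536 * (real n)\<^sup>2 * M"
      using n by (simp add: field_simps)
  qed
  ultimately show thesis by (rule that)
qed

definition direct_const :: "nat \<Rightarrow> real" where
  "direct_const r = (\<Sum>i<r. (4 * C) ^ i) ^ r + (jackson_const * 1536) ^ r * (\<Sum>i<r. (1 + (4 * C) ^ r) ^ i)"

text \<open>With \<open>a\<close> the smoothing and \<open>j\<close> the Jackson multiplier, \<open>g = (1 - (1 - a ^ r) ^ r) * c\<close> is a smooth
  approximant: \<open>c - g\<close> contains the factor \<open>(1 - a) ^ r\<close>, and \<open>kap ^ r * g\<close> the factor \<open>(kap * a) ^ r\<close>, both of
  which are averages of differences. Then \<open>d = (1 - (1 - j) ^ r) * g\<close> has the right degree, and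
  \<open>g - d = (1 - j) ^ r * g\<close> gains \<open>r\<close> factors $n^{-2}$ against \<open>kap ^ r * g\<close>.\<close>

lemma direct_estimate:
  assumes n: "n \<ge> 1"
    and M: "\<And>ys. (\<And>j. j \<in> {1..r} \<Longrightarrow> ys j \<in> {cos (1 / real n)..1}) \<Longrightarrow>
       N (\<lambda>k. (\<Prod>j=1..r. 1 - jac k (ys j)) * c k) \<le> M"
  obtains d where "\<And>k. n \<le> k \<Longrightarrow> d k = 0" "N (\<lambda>k. c k - d k) \<le> direct_const r * M"
proof -
  define \<eta> where "\<eta> = cos (1 / real n)"
  obtain a where a: "mult_bounded a (4 * C)" "smoothed \<eta> (\<lambda>k. 1 - a k) 1"
    "smoothed \<eta> (\<lambda>k. kap k * a k) (1536 * (real n)\<^sup>2)"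
    using averaging_multiplier [OF n] unfolding \<eta>_def by blast
  obtain j where j: "\<And>k. n \<le> k \<Longrightarrow> j k = 0"
    "\<And>c. N (\<lambda>k. (1 - j k) * c k) \<le> jackson_const / (real n)\<^sup>2 * N (\<lambda>k. kap k * c k)"
    using jackson_multiplier [OF n] by blast
  have jc: "0 \<le> jackson_const / (real n)\<^sup>2" using C_ge_1 by (simp add: jackson_const_def)
  define A where "A k = a k ^ r" for k
  define g where "g k = (1 - (1 - A k) ^ r) * c k" for k
  define S where "S k = (\<Sum>i<r. (1 - A k) ^ i)" for k
  define BS where "BS = (\<Sum>i<r. (1 + (4 * C) ^ r) ^ i)"
  have S: "mult_bounded S BS"
    unfolding S_def [abs_def] BS_def A_def diff_conv_add_uminus
    by (intro mult_bounded_sum mult_bounded_power mult_bounded_add mult_bounded_one mult_bounded_minus a)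
  have T: "mult_bounded (\<lambda>k. (\<Sum>i<r. a k ^ i) ^ r) ((\<Sum>i<r. (4 * C) ^ i) ^ r)"
    by (intro mult_bounded_sum mult_bounded_power a)
  have M1: "N (\<lambda>k. (1 - a k) ^ r * c k) \<le> 1 ^ r * M"
    by (rule smoothed_power [OF a(2)]) (use M in \<open>simp add: \<eta>_def\<close>)
  have M2: "N (\<lambda>k. (kap k * a k) ^ r * c k) \<le> (1536 * (real n)\<^sup>2) ^ r * M"
    by (rule smoothed_power [OF a(3)]) (use M in \<open>simp add: \<eta>_def\<close>)
  have "N (\<lambda>k. c k - g k) = N (\<lambda>k. (\<Sum>i<r. a k ^ i) ^ r * ((1 - a k) ^ r * c k))"
  proof (rule arg_cong [where f = N], rule ext)
    fix k
    have "c k - g k = (1 - A k) ^ r * c k" by (simp add: g_def algebra_simps)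
    also have "1 - A k = (1 - a k) * (\<Sum>i<r. a k ^ i)" unfolding A_def by (rule one_diff_power_eq)
    finally show "c k - g k = (\<Sum>i<r. a k ^ i) ^ r * ((1 - a k) ^ r * c k)"
      by (simp add: power_mult_distrib mult_ac)
  qed
  also have "\<dots> \<le> (\<Sum>i<r. (4 * C) ^ i) ^ r * N (\<lambda>k. (1 - a k) ^ r * c k)"
    by (rule mult_boundedD [OF T])
  also have "\<dots> \<le> (\<Sum>i<r. (4 * C) ^ i) ^ r * M"
    using M1 T by (intro mult_left_mono) (auto simp: mult_bounded_def)
  finally have cg: "N (\<lambda>k. c k - g k) \<le> (\<Sum>i<r. (4 * C) ^ i) ^ r * M" .
  have "N (\<lambda>k. kap k ^ r * g k) = N (\<lambda>k. S k * ((kap k * a k) ^ r * c k))"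
  proof (rule arg_cong [where f = N], rule ext)
    fix k
    have "1 - (1 - A k) ^ r = (1 - (1 - A k)) * S k" unfolding S_def by (rule one_diff_power_eq)
    then show "kap k ^ r * g k = S k * ((kap k * a k) ^ r * c k)"
      by (simp add: g_def A_def power_mult_distrib mult_ac)
  qed
  also have "\<dots> \<le> BS * N (\<lambda>k. (kap k * a k) ^ r * c k)" by (rule mult_boundedD [OF S])
  also have "\<dots> \<le> BS * ((1536 * (real n)\<^sup>2) ^ r * M)"
    using M2 S by (intro mult_left_mono) (auto simp: mult_bounded_def)
  finally have kg: "N (\<lambda>k. kap k ^ r * g k) \<le> BS * ((1536 * (real n)\<^sup>2) ^ r * M)" .
  have "N (\<lambda>k. (1 - j k) ^ i * h k) \<le> (jackson_const / (real n)\<^sup>2) ^ i * N (\<lambda>k. kap k ^ i * h k)" for i h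
  proof (induction i arbitrary: h)
    case (Suc i)
    have "N (\<lambda>k. (1 - j k) ^ Suc i * h k) = N (\<lambda>k. (1 - j k) ^ i * ((1 - j k) * h k))"
      by (simp add: mult_ac)
    also have "\<dots> \<le> (jackson_const / (real n)\<^sup>2) ^ i * N (\<lambda>k. kap k ^ i * ((1 - j k) * h k))" by (rule Suc)
    also have "N (\<lambda>k. kap k ^ i * ((1 - j k) * h k)) = N (\<lambda>k. (1 - j k) * (kap k ^ i * h k))"
      by (simp add: mult_ac)
    also have "(jackson_const / (real n)\<^sup>2) ^ i * N (\<lambda>k. (1 - j k) * (kap k ^ i * h k))
       \<le> (jackson_const / (real n)\<^sup>2) ^ i * (jackson_const / (real n)\<^sup>2 * N (\<lambda>k. kap k * (kap k ^ i * h k)))"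
      using jc by (intro mult_left_mono j zero_le_power)
    finally show ?case by (simp add: mult_ac)
  qed simp
  from this [of r g] have "N (\<lambda>k. (1 - j k) ^ r * g k) \<le> (jackson_const / (real n)\<^sup>2) ^ r * N (\<lambda>k. kap k ^ r * g k)" .
  also have "\<dots> \<le> (jackson_const / (real n)\<^sup>2) ^ r * (BS * ((1536 * (real n)\<^sup>2) ^ r * M))"
    using kg jc by (intro mult_left_mono zero_le_power)
  also have "\<dots> = (jackson_const / (real n)\<^sup>2 * (1536 * (real n)\<^sup>2)) ^ r * BS * M"
    by (simp only: power_mult_distrib mult_ac)
  also have "jackson_const / (real n)\<^sup>2 * (1536 * (real n)\<^sup>2) = jackson_const * 1536" using n by simp
  finally have jg: "N (\<lambda>k. (1 - j k) ^ r * g k) \<le> (jackson_const * 1536) ^ r * BS * M" .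
  define d where "d k = (1 - (1 - j k) ^ r) * g k" for k
  show thesis
  proof (rule that)
    show "d k = 0" if "n \<le> k" for k using j(1) [OF that] by (simp add: d_def)
    have "N (\<lambda>k. c k - d k) = N (\<lambda>k. (c k - g k) + (1 - j k) ^ r * g k)"
      by (rule arg_cong [where f = N]) (simp add: d_def algebra_simps)
    also have "\<dots> \<le> N (\<lambda>k. c k - g k) + N (\<lambda>k. (1 - j k) ^ r * g k)" by (rule N_triangle)
    also have "\<dots> \<le> direct_const r * M"
      using cg jg by (simp add: direct_const_def BS_def distrib_right)
    finally show "N (\<lambda>k. c k - d k) \<le> direct_const r * M" .
  qed
qed

end


section \<open>An inequality of Bernstein type\<close>

fun cheb :: "nat \<Rightarrow> real poly" where
  "cheb 0 = 1"
| "cheb (Suc 0) = [:0, 1:]"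
| "cheb (Suc (Suc n)) = [:0, 2:] * cheb (Suc n) - cheb n"

lemma cheb_cos: "poly (cheb n) (cos t) = cos (real n * t)"
proof (induction n rule: cheb.induct)
  case (3 n)
  have "poly (cheb (Suc (Suc n))) (cos t) = 2 * cos t * poly (cheb (Suc n)) (cos t) - poly (cheb n) (cos t)"
    by simp
  then show ?case unfolding 3 cos_three_term .
qed auto

lemma cheb_1: "poly (cheb n) 1 = 1"
  using cheb_cos [of n 0] by simp

lemma cheb_deriv_1: "poly (pderiv (cheb n)) 1 = (real n)\<^sup>2"
proof (induction n rule: cheb.induct)
  case (3 n)
  then show ?case
    by (simp add: pderiv_diff pderiv_mult pderiv_pCons pderiv_smult cheb_1) (simp add: power2_eq_square algebra_simps)
qed (auto simp: pderiv_pCons)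

lemma degree_cheb: "degree (cheb n) \<le> n \<and> coeff (cheb n) n > 0"
proof (induction n rule: cheb.induct)
  case (3 n)
  have "degree ([:0, 2:] * cheb (Suc n)) \<le> Suc (Suc n)"
    using 3 by (intro order_trans [OF degree_mult_le]) auto
  moreover have "coeff (cheb n) (Suc (Suc n)) = 0" using 3 by (intro coeff_eq_0) auto
  ultimately show ?case using 3 by (auto intro!: degree_diff_le)
qed auto

lemma triangular_basis:
  fixes b :: "nat \<Rightarrow> 'a :: field poly"
  assumes b: "\<And>k. degree (b k) \<le> k \<and> coeff (b k) k \<noteq> 0"
  shows "degree q \<le> L \<Longrightarrow> \<exists>a. q = (\<Sum>i\<le>L. smult (a i) (b i))"
proof (induction L arbitrary: q)
  case 0
  then have "q = [:coeff q 0:]" "b 0 = [:coeff (b 0) 0:]" "coeff (b 0) 0 \<noteq> 0"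
    using b [of 0] degree_0_id by (metis le_zero_eq)+
  then have "q = smult (coeff q 0 / coeff (b 0) 0) (b 0)"
    by (metis mult_zero_right nonzero_eq_divide_eq smult_pCons smult_0_right)
  then show ?case by (intro exI [of _ "\<lambda>_. coeff q 0 / coeff (b 0) 0"]) simp
next
  case (Suc L)
  define c where "c = coeff q (Suc L) / coeff (b (Suc L)) (Suc L)"
  have "degree (q - smult c (b (Suc L))) \<le> L"
  proof (rule degree_le, intro allI impI)
    fix i assume i: "L < i"
    show "coeff (q - smult c (b (Suc L))) i = 0"
    proof (cases "i = Suc L")
      case True
      then show ?thesis using b [of "Suc L"] by (simp add: c_def)
    next
      case False
      then have "coeff q i = 0" "coeff (b (Suc L)) i = 0"
        using i Suc.prems b [of "Suc L"] by (auto intro!: coeff_eq_0)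
      then show ?thesis by simp
    qed
  qed
  from Suc.IH [OF this] obtain a where a: "q - smult c (b (Suc L)) = (\<Sum>i\<le>L. smult (a i) (b i))" by blast
  have "q = (\<Sum>i\<le>Suc L. smult ((a(Suc L := c)) i) (b i))"
    using a by (simp add: algebra_simps)
  then show ?case by blast
qed

text \<open>Multiplication by \<open>2 * cos (a / 2)\<close> turns the terms into differences, and the end values agree.\<close>

lemma alternating_cos_sum:
  assumes "k < L"
  shows "(\<Sum>j<2 * L. (- 1) ^ j * cos (real j * (real k * pi / real L))) = 0"
proof -
  define a where "a = real k * pi / real L"
  have L: "L > 0" using assms by simp
  define g where "g j = (- 1) ^ j * cos ((real j - 1 / 2) * a)" for j
  have g: "- (g (Suc j) - g j) = (- 1) ^ j * cos (real j * a) * (2 * cos (a / 2))" for j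
  proof -
    have "cos ((real j + 1 / 2) * a) + cos ((real j - 1 / 2) * a) = 2 * (cos (real j * a) * cos (a / 2))"
      by (simp add: distrib_right left_diff_distrib cos_add cos_diff)
    then have "(- 1) ^ j * (cos ((real j + 1 / 2) * a) + cos ((real j - 1 / 2) * a))
       = (- 1) ^ j * (2 * (cos (real j * a) * cos (a / 2)))" by simp
    moreover have "real (Suc j) - 1 / 2 = real j + 1 / 2" by simp
    ultimately show ?thesis by (simp add: g_def algebra_simps)
  qed
  have "(\<Sum>j<2 * L. (- 1) ^ j * cos (real j * a)) * (2 * cos (a / 2)) = (\<Sum>j<2 * L. - (g (Suc j) - g j))"
    unfolding g by (simp add: sum_distrib_right)
  also have "\<dots> = - (g (2 * L) - g 0)"
    by (simp only: sum_negf sum_lessThan_telescope)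
  also have "g (2 * L) = g 0"
  proof -
    have "(real (2 * L) - 1 / 2) * a = - (a / 2) + 2 * real k * pi"
      using L by (simp add: a_def field_simps)
    then have "cos ((real (2 * L) - 1 / 2) * a) = cos (- (a / 2) + real k * (2 * pi))" by (simp add: mult_ac)
    also have "\<dots> = cos (- (a / 2))"
      using cos.plus_of_nat [of "- (a / 2)" k] by simp
    finally show ?thesis by (simp add: g_def)
  qed
  finally have *: "(\<Sum>j<2 * L. (- 1) ^ j * cos (real j * a)) * (2 * cos (a / 2)) = 0" by simp
  have "a / 2 < pi / 2" "0 \<le> a / 2" using assms by (simp_all add: a_def field_simps)
  then have "cos (a / 2) > 0" by (intro cos_gt_zero_pi) (use pi_gt_zero in linarith)+
  with * show ?thesis by (simp add: a_def)
qed

definition node :: "nat \<Rightarrow> nat \<Rightarrow> real" where "node L j = real j * pi / real L"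

definition node_weight :: "nat \<Rightarrow> nat \<Rightarrow> real" where
  "node_weight L j = (- 1) ^ j / (2 * (sin (node L j / 2))\<^sup>2)"

lemma sin_node_pos:
  assumes "0 < j" "j < 2 * L"
  shows "0 < sin (node L j / 2)"
  using assms by (intro sin_gt_zero) (auto simp: node_def field_simps)

text \<open>Both sides vanish at \<open>k = 0\<close> and have the value 1 at \<open>k = 1\<close>, and both have the second difference 2:
  on the left it is \<open>2 * cos x - 2\<close> with \<open>x\<close> the node, which cancels the sine in the weight and leaves the
  alternating sum.\<close>

lemma node_weight_cos:
  "k \<le> L \<Longrightarrow> (\<Sum>j=1..<2 * L. node_weight L j * (cos (real k * node L j) - 1)) = (real k)\<^sup>2"
proof (induction k rule: cheb.induct)
  case 1
  then show ?case by simp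
next
  case 2
  have "(\<Sum>j=1..<2 * L. node_weight L j * (cos (node L j) - 1)) = (\<Sum>j=1..<2 * L. - ((- 1) ^ j))"
  proof (intro sum.cong refl)
    fix j assume "j \<in> {1..<2 * L}"
    then have "sin (node L j / 2) \<noteq> 0" using sin_node_pos [of j L] by auto
    moreover have "cos (node L j) = 1 - 2 * (sin (node L j / 2))\<^sup>2"
      using cos_double_sin [of "node L j / 2"] by simp
    ultimately show "node_weight L j * (cos (node L j) - 1) = - ((- 1) ^ j)"
      by (simp add: node_weight_def)
  qed
  also have "\<dots> = 1"
  proof -
    have "(\<Sum>j<2 * L. (- 1 :: real) ^ j) = 0" by (induction L) auto
    moreover have "(\<Sum>j<2 * L. (- 1 :: real) ^ j) = 1 + (\<Sum>j=1..<2 * L. (- 1) ^ j)"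
      using 2 by (subst lessThan_atLeast0, subst sum.atLeast_Suc_lessThan) auto
    ultimately show ?thesis by (simp add: sum_negf)
  qed
  finally show ?case by simp
next
  case (3 k)
  define S where "S k = (\<Sum>j=1..<2 * L. node_weight L j * (cos (real k * node L j) - 1))" for k
  have "S (Suc (Suc k)) - 2 * S (Suc k) + S k = (\<Sum>j=1..<2 * L. - 2 * ((- 1) ^ j * cos (real (Suc k) * node L j)))"
    unfolding S_def sum_distrib_left sum_subtractf [symmetric] sum.distrib [symmetric]
  proof (intro sum.cong refl)
    fix j assume "j \<in> {1..<2 * L}"
    then have s: "sin (node L j / 2) \<noteq> 0" using sin_node_pos [of j L] by auto
    have c: "cos (node L j) = 1 - 2 * (sin (node L j / 2))\<^sup>2"
      using cos_double_sin [of "node L j / 2"] by simp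
    have "node_weight L j * (cos (real (Suc (Suc k)) * node L j) - 1) - 2 * (node_weight L j * (cos (real (Suc k) * node L j) - 1))
        + node_weight L j * (cos (real k * node L j) - 1)
      = node_weight L j * (2 * (cos (node L j) - 1)) * cos (real (Suc k) * node L j)"
      unfolding cos_three_term by (simp add: algebra_simps)
    also have "node_weight L j * (2 * (cos (node L j) - 1)) = - 2 * (- 1) ^ j"
      unfolding c using s by (simp add: node_weight_def)
    finally show "node_weight L j * (cos (real (Suc (Suc k)) * node L j) - 1) - 2 * (node_weight L j * (cos (real (Suc k) * node L j) - 1))
        + node_weight L j * (cos (real k * node L j) - 1) = - 2 * ((- 1) ^ j * cos (real (Suc k) * node L j))"
      by simp
  qed
  also have "\<dots> = 2"
  proof -
    have "Suc k < L" using 3 by simp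
    from alternating_cos_sum [OF this]
    have "0 = (\<Sum>j<2 * L. (- 1) ^ j * cos (real (Suc k) * node L j))"
      by (simp add: node_def mult_ac)
    also have "\<dots> = 1 + (\<Sum>j=1..<2 * L. (- 1) ^ j * cos (real (Suc k) * node L j))"
      using 3 by (subst lessThan_atLeast0, subst sum.atLeast_Suc_lessThan) (auto simp: node_def)
    finally show ?thesis by (simp only: sum_distrib_left [symmetric])
  qed
  finally have "S (Suc (Suc k)) - 2 * S (Suc k) + S k = 2" .
  moreover have "S (Suc k) = (real (Suc k))\<^sup>2" "S k = (real k)\<^sup>2" using 3 by (simp_all add: S_def)
  ultimately have "S (Suc (Suc k)) = (real (Suc (Suc k)))\<^sup>2" by (simp add: power2_eq_square algebra_simps)
  then show ?case by (simp add: S_def)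
qed

lemma pderiv_sum_atMost:
  fixes f :: "nat \<Rightarrow> real poly"
  shows "pderiv (\<Sum>i\<le>L. f i) = (\<Sum>i\<le>L. pderiv (f i))"
  by (induction L) (simp_all add: pderiv_add)

text \<open>For a Chebyshev polynomial the derivative at 1 is the square of its degree, so that the previous
  lemma is the case of the Chebyshev polynomials.\<close>

lemma node_weight_deriv:
  assumes "degree q \<le> L"
  shows "(\<Sum>j=1..<2 * L. node_weight L j * (poly q (cos (node L j)) - poly q 1)) = poly (pderiv q) 1"
proof -
  obtain a where q: "q = (\<Sum>i\<le>L. smult (a i) (cheb i))"
    using triangular_basis [of cheb q L] degree_cheb assms by (metis less_irrefl)
  have "(\<Sum>j=1..<2 * L. node_weight L j * (poly q (cos (node L j)) - poly q 1))
      = (\<Sum>j=1..<2 * L. \<Sum>i\<le>L. a i * (node_weight L j * (cos (real i * node L j) - 1)))"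
    by (simp add: q poly_sum cheb_cos cheb_1 sum_subtractf [symmetric] sum_distrib_left algebra_simps)
  also have "\<dots> = (\<Sum>i\<le>L. a i * (\<Sum>j=1..<2 * L. node_weight L j * (cos (real i * node L j) - 1)))"
    by (subst sum.swap) (simp add: sum_distrib_left)
  also have "\<dots> = (\<Sum>i\<le>L. a i * (real i)\<^sup>2)"
    by (intro sum.cong refl) (use node_weight_cos in simp)
  also have "\<dots> = poly (pderiv q) 1"
    by (simp add: q pderiv_sum_atMost pderiv_smult poly_sum cheb_deriv_1)
  finally show ?thesis .
qed

lemma sum_inverse_squares: "(\<Sum>j=1..<n. 1 / (real j)\<^sup>2) \<le> 2"
proof -
  have "(\<Sum>j=1..<Suc (Suc m). 1 / (real j)\<^sup>2) \<le> 2 - 1 / real (Suc m)" for m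
  proof (induction m)
    case (Suc m)
    have "1 / (real m + 2)\<^sup>2 \<le> 1 / ((real m + 1) * (real m + 2))"
      by (intro divide_left_mono) (auto simp: power2_eq_square)
    also have "\<dots> = 1 / (real m + 1) - 1 / (real m + 2)" by (simp add: field_simps)
    finally have *: "1 / (real m + 2)\<^sup>2 \<le> 1 / (real m + 1) - 1 / (real m + 2)" .
    have "(\<Sum>j=1..<Suc (Suc (Suc m)). 1 / (real j)\<^sup>2) = (\<Sum>j=1..<Suc (Suc m). 1 / (real j)\<^sup>2) + 1 / (real m + 2)\<^sup>2"
      by (simp add: add_ac)
    also have "\<dots> \<le> 2 - 1 / real (Suc (Suc m))" using Suc * by (simp add: add_ac)
    finally show ?case .
  qed simp
  note * = this
  show ?thesis
  proof (cases "n \<le> 1")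
    case False
    then obtain m where "n = Suc (Suc m)" by (metis Suc_le_D not_less_eq_eq One_nat_def)
    moreover have "2 - 1 / real (Suc m) \<le> 2" by simp
    ultimately show ?thesis using * [of m] by (metis order_trans)
  qed simp
qed

lemma node_weight_bound:
  assumes L: "L \<ge> 1"
  shows "(\<Sum>j=1..<2 * L. \<bar>node_weight L j\<bar>) \<le> 8 * (real L)\<^sup>2"
proof -
  have half: "\<bar>node_weight L j\<bar> \<le> 2 * (real L)\<^sup>2 * (1 / (real j)\<^sup>2 + 1 / (real (2 * L - j))\<^sup>2)"
    if j: "j \<in> {1..<2 * L}" for j
  proof -
    have *: "1 / (2 * (sin (real i * pi / real L / 2))\<^sup>2) \<le> 2 * (real L)\<^sup>2 * (1 / (real i)\<^sup>2)" if i: "1 \<le> i" "i \<le> L" for i :: nat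
    proof -
      have "real i * pi / real L / 2 / 2 \<le> sin (real i * pi / real L / 2)"
        using i by (intro sin_ge_half) (auto simp: field_simps)
      moreover have "real i / (2 * real L) \<le> real i * pi / real L / 2 / 2"
        using i pi_gt3 by (simp add: field_simps)
      ultimately have "real i / (2 * real L) \<le> sin (real i * pi / real L / 2)" by linarith
      then have "(real i / (2 * real L))\<^sup>2 \<le> (sin (real i * pi / real L / 2))\<^sup>2" by (intro power_mono) auto
      then have "1 / (2 * (sin (real i * pi / real L / 2))\<^sup>2) \<le> 1 / (2 * (real i / (2 * real L))\<^sup>2)"
        using i by (intro frac_le mult_left_mono) auto
      also have "\<dots> = 2 * (real L)\<^sup>2 * (1 / (real i)\<^sup>2)" using i by (simp add: field_simps)
      finally show ?thesis .
    qed
    have a: "\<bar>node_weight L j\<bar> = 1 / (2 * (sin (node L j / 2))\<^sup>2)" by (simp add: node_weight_def abs_divide abs_mult power_abs)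
    show ?thesis
    proof (cases "j \<le> L")
      case True
      then have "\<bar>node_weight L j\<bar> \<le> 2 * (real L)\<^sup>2 * (1 / (real j)\<^sup>2)"
        unfolding a node_def using j by (intro *) auto
      also have "\<dots> \<le> 2 * (real L)\<^sup>2 * (1 / (real j)\<^sup>2 + 1 / (real (2 * L - j))\<^sup>2)"
        by (intro mult_left_mono) auto
      finally show ?thesis .
    next
      case False
      have "node L j / 2 = pi - real (2 * L - j) * pi / real L / 2"
        using j L by (simp add: node_def of_nat_diff field_simps)
      then have "sin (node L j / 2) = sin (real (2 * L - j) * pi / real L / 2)" by (simp only: sin_pi_minus)
      then have "\<bar>node_weight L j\<bar> \<le> 2 * (real L)\<^sup>2 * (1 / (real (2 * L - j))\<^sup>2)"
        unfolding a using j False by (simp only:) (intro *, auto)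
      also have "\<dots> \<le> 2 * (real L)\<^sup>2 * (1 / (real j)\<^sup>2 + 1 / (real (2 * L - j))\<^sup>2)"
        by (intro mult_left_mono) auto
      finally show ?thesis .
    qed
  qed
  have "(\<Sum>j=1..<2 * L. \<bar>node_weight L j\<bar>) \<le> (\<Sum>j=1..<2 * L. 2 * (real L)\<^sup>2 * (1 / (real j)\<^sup>2 + 1 / (real (2 * L - j))\<^sup>2))"
    by (intro sum_mono half)
  also have "\<dots> = 2 * (real L)\<^sup>2 * ((\<Sum>j=1..<2 * L. 1 / (real j)\<^sup>2) + (\<Sum>j=1..<2 * L. 1 / (real (2 * L - j))\<^sup>2))"
    by (simp only: sum_distrib_left [symmetric] sum.distrib [symmetric])
  also have "(\<Sum>j=1..<2 * L. 1 / (real (2 * L - j))\<^sup>2) = (\<Sum>j=1..<2 * L. 1 / (real j)\<^sup>2)"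
    by (rule sum.reindex_bij_witness [of _ "\<lambda>j. 2 * L - j" "\<lambda>j. 2 * L - j"]) auto
  also have "2 * (real L)\<^sup>2 * ((\<Sum>j=1..<2 * L. 1 / (real j)\<^sup>2) + (\<Sum>j=1..<2 * L. 1 / (real j)\<^sup>2)) \<le> 2 * (real L)\<^sup>2 * (2 + 2)"
    by (intro mult_left_mono add_mono sum_inverse_squares) auto
  finally show ?thesis by simp
qed

definition jac_poly :: "nat \<Rightarrow> real poly" where
  "jac_poly k = (\<Sum>j\<le>k. smult (jac_coeff k j) ([:- 1 / 2, 1 / 2:] ^ j * [:1 / 2, 1 / 2:] ^ (k - j)))"

lemma poly_jac_poly: "poly (jac_poly k) y = jac k y"
  by (simp add: jac_poly_def jac_def poly_sum diff_divide_distrib add_divide_distrib)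
    (simp add: algebra_simps)

lemma degree_jac_poly: "degree (jac_poly k) \<le> k"
  unfolding jac_poly_def
proof (intro degree_sum_le)
  fix j assume "j \<in> {..k}"
  have "degree ([:- 1 / 2, 1 / 2 :: real:] ^ j) \<le> j" "degree ([:1 / 2, 1 / 2 :: real:] ^ (k - j)) \<le> k - j"
    using degree_power_le [of "[:- 1 / 2, 1 / 2 :: real:]" j] degree_power_le [of "[:1 / 2, 1 / 2 :: real:]" "k - j"] by auto
  then have "degree ([:- 1 / 2, 1 / 2 :: real:] ^ j * [:1 / 2, 1 / 2:] ^ (k - j)) \<le> j + (k - j)"
    by (intro order_trans [OF degree_mult_le] add_mono)
  also have "\<dots> = k" using \<open>j \<in> {..k}\<close> by simp
  finally show "degree (smult (jac_coeff k j) ([:- 1 / 2, 1 / 2:] ^ j * [:1 / 2, 1 / 2:] ^ (k - j))) \<le> k"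
    by (intro order_trans [OF degree_smult_le])
qed simp

context transl_seq
begin

text \<open>The polynomial \<open>((1 + y) / 2)\<^sup>2 * jac k y\<close> of degree \<open>k + 2\<close> has the derivative \<open>1 + kap k / 2\<close> at 1. The
  interpolation formula writes this derivative as a combination of values, each of which is a bounded
  multiplier.\<close>

lemma bernstein:
  assumes m: "m' \<ge> 1" and c: "\<And>k. m' \<le> k \<Longrightarrow> c k = 0"
  shows "N (\<lambda>k. kap k * c k) \<le> 130 * C * (real m')\<^sup>2 * N c"
proof -
  define L where "L = m' + 1"
  define q where "q k = [:1 / 2, 1 / 2:] ^ 2 * jac_poly k" for k
  have q: "poly (q k) y = ((1 + y) / 2)\<^sup>2 * jac k y" for k y
    by (simp add: q_def poly_jac_poly add_divide_distrib)
  have deriv: "poly (pderiv (q k)) 1 = 1 + kap k / 2" for k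
  proof -
    have "((\<lambda>y. ((1 + y) / 2)\<^sup>2 * jac k y) has_real_derivative 1 + kap k / 2) (at 1)"
      by (auto intro!: derivative_eq_intros jac_has_derivative simp: jac'_1)
    moreover have "((\<lambda>y. ((1 + y) / 2)\<^sup>2 * jac k y) has_real_derivative poly (pderiv (q k)) 1) (at 1)"
      using poly_DERIV [of "q k" 1] by (simp only: q)
    ultimately show ?thesis by (rule DERIV_unique [THEN sym])
  qed
  have id: "kap k * c k = (- 2) * c k + (\<Sum>j=1..<2 * L. 2 * node_weight L j * (((1 + cos (node L j)) / 2)\<^sup>2 * jac k (cos (node L j)) * c k + (- 1) * c k))" for k
  proof (cases "k < m'")
    case True
    have "degree ([:1 / 2, 1 / 2 :: real:] ^ 2) \<le> 2" using degree_power_le [of "[:1 / 2, 1 / 2 :: real:]" 2] by simp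
    then have "degree (q k) \<le> 2 + k" unfolding q_def using degree_jac_poly [of k]
      by (intro order_trans [OF degree_mult_le] add_mono)
    then have "degree (q k) \<le> L" using True by (simp add: L_def)
    from node_weight_deriv [OF this]
    have "1 + kap k / 2 = (\<Sum>j=1..<2 * L. node_weight L j * (((1 + cos (node L j)) / 2)\<^sup>2 * jac k (cos (node L j)) - 1))"
      by (simp add: deriv q)
    then have "kap k = 2 * (\<Sum>j=1..<2 * L. node_weight L j * (((1 + cos (node L j)) / 2)\<^sup>2 * jac k (cos (node L j)) - 1)) - 2"
      by linarith
    moreover have "(\<Sum>j=1..<2 * L. 2 * node_weight L j * (((1 + cos (node L j)) / 2)\<^sup>2 * jac k (cos (node L j)) * c k + (- 1) * c k))
      = 2 * (\<Sum>j=1..<2 * L. node_weight L j * (((1 + cos (node L j)) / 2)\<^sup>2 * jac k (cos (node L j)) - 1)) * c k"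
      unfolding sum_distrib_left sum_distrib_right by (intro sum.cong refl) (simp add: algebra_simps)
    ultimately show ?thesis by (simp only: left_diff_distrib)
  qed (simp add: c)
  have tr: "N (\<lambda>k. ((1 + y) / 2)\<^sup>2 * jac k y * c k) \<le> C * N c" if y: "-1 \<le> y" "y \<le> 1" for y
  proof (cases "y = -1")
    case True
    then show ?thesis using N_nonneg C_ge_1 by simp
  qed (use y transl in auto)
  have "N (\<lambda>k. kap k * c k) \<le> N (\<lambda>k. (- 2) * c k) + N (\<lambda>k. \<Sum>j=1..<2 * L. 2 * node_weight L j * (((1 + cos (node L j)) / 2)\<^sup>2 * jac k (cos (node L j)) * c k + (- 1) * c k))"
    unfolding id by (rule N_triangle)
  also have "\<dots> \<le> 2 * N c + (\<Sum>j=1..<2 * L. \<bar>2 * node_weight L j\<bar> * (C * N c + N c))"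
  proof (intro add_mono order_trans [OF N_sum] sum_mono)
    show "N (\<lambda>k. (- 2) * c k) \<le> 2 * N c" unfolding N_scale by simp
    fix j
    have "N (\<lambda>k. ((1 + cos (node L j)) / 2)\<^sup>2 * jac k (cos (node L j)) * c k + (- 1) * c k) \<le> C * N c + N c"
      by (rule order_trans [OF N_triangle]) (intro add_mono tr, auto simp: N_scale [of "- 1", simplified])
    then show "N (\<lambda>k. 2 * node_weight L j * (((1 + cos (node L j)) / 2)\<^sup>2 * jac k (cos (node L j)) * c k + (- 1) * c k))
        \<le> \<bar>2 * node_weight L j\<bar> * (C * N c + N c)"
      unfolding N_scale by (intro mult_left_mono) auto
  qed simp
  also have "(\<Sum>j=1..<2 * L. \<bar>2 * node_weight L j\<bar> * (C * N c + N c)) = 2 * (\<Sum>j=1..<2 * L. \<bar>node_weight L j\<bar>) * (C * N c + N c)"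
    by (simp add: sum_distrib_left sum_distrib_right abs_mult)
  also have "2 * N c + \<dots> \<le> 2 * C * (real m')\<^sup>2 * N c + 2 * (8 * (real L)\<^sup>2) * (C * N c + C * N c)"
  proof (intro add_mono mult_mono)
    have "1 * 1 \<le> C * (real m')\<^sup>2" using C_ge_1 m by (intro mult_mono) auto
    then show "2 \<le> 2 * C * (real m')\<^sup>2" by simp
    show "(\<Sum>j=1..<2 * L. \<bar>node_weight L j\<bar>) \<le> 8 * (real L)\<^sup>2" by (rule node_weight_bound) (simp add: L_def)
    show "N c \<le> C * N c" using mult_right_mono [OF C_ge_1 N_nonneg [of c]] by simp
  qed (use C_ge_1 N_nonneg in \<open>auto intro!: sum_nonneg\<close>)
  also have "2 * (8 * (real L)\<^sup>2) * (C * N c + C * N c) \<le> 2 * (8 * (4 * (real m')\<^sup>2)) * (C * N c + C * N c)"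
  proof (intro mult_right_mono mult_left_mono)
    have "(real L)\<^sup>2 \<le> (2 * real m')\<^sup>2" using m by (intro power_mono) (auto simp: L_def)
    then show "(real L)\<^sup>2 \<le> 4 * (real m')\<^sup>2" by simp
  qed (use C_ge_1 N_nonneg in auto)
  finally show ?thesis by (simp add: algebra_simps)
qed

end


section \<open>Eigenfunctions of the generalised translation\<close>

text \<open>Let $\zeta = \xi_1 + i \xi_2$ and $x = \xi_3$ on the unit sphere. The coefficients of the powers of \<open>z\<close> in
  $(-\bar\zeta + 2 x z + \zeta z^2)^l$ are the spherical harmonics of degree \<open>l\<close>, because the quadratic form is
  the product of the point with a null vector. For $l = k + 2$ and the weight 2 the coefficient is
  $\zeta^2$ times a polynomial in \<open>x\<close> (a Jacobi polynomial with parameters $(2,2)$); its expansion by the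
  binomial theorem is the definition.\<close>

definition eigen_poly :: "nat \<Rightarrow> real poly" where
  "eigen_poly k = (\<Sum>i\<le>k + 2. \<Sum>h\<le>i. if 2 * h = i + 2 then
      smult (real ((k + 2 choose i) * (i choose h))) ([:0, 2:] ^ (k + 2 - i) * [:- 1, 0, 1:] ^ (i - h)) else 0)"

lemma eigen_poly_term:
  assumes "i \<le> k + 2" "h \<le> i" "2 * h = i + 2"
  shows "degree ([:0, 2 :: real:] ^ (k + 2 - i) * [:- 1, 0, 1:] ^ (i - h)) = k"
    "coeff ([:0, 2 :: real:] ^ (k + 2 - i) * [:- 1, 0, 1:] ^ (i - h)) k > 0"
proof -
  have *: "degree ([:0, 2 :: real:] ^ (k + 2 - i) * [:- 1, 0, 1:] ^ (i - h)) = (k + 2 - i) + (i - h) * 2"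
    by (subst degree_mult_eq) (auto simp: degree_power_eq)
  also have "\<dots> = k" using assms by simp
  finally show d: "degree ([:0, 2 :: real:] ^ (k + 2 - i) * [:- 1, 0, 1:] ^ (i - h)) = k" .
  have "lead_coeff ([:0, 2 :: real:] ^ (k + 2 - i) * [:- 1, 0, 1:] ^ (i - h)) > 0"
    by (simp only: lead_coeff_mult lead_coeff_power) simp
  then show "coeff ([:0, 2 :: real:] ^ (k + 2 - i) * [:- 1, 0, 1:] ^ (i - h)) k > 0"
    unfolding d .
qed

lemma eigen_poly_degree: "degree (eigen_poly k) \<le> k \<and> coeff (eigen_poly k) k \<noteq> 0"
proof
  show "degree (eigen_poly k) \<le> k"
    unfolding eigen_poly_def
  proof (intro degree_sum_le)
    fix i h assume "i \<in> {..k + 2}" "h \<in> {..i}"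
    then show "degree (if 2 * h = i + 2 then
      smult (real ((k + 2 choose i) * (i choose h))) ([:0, 2:] ^ (k + 2 - i) * [:- 1, 0, 1:] ^ (i - h)) else 0) \<le> k"
      using eigen_poly_term(1) [of i k h] degree_smult_le [of "real ((k + 2 choose i) * (i choose h))" "[:0, 2:] ^ (k + 2 - i) * [:- 1, 0, 1:] ^ (i - h)"]
      by (cases "2 * h = i + 2") (simp_all only: if_True if_False atMost_iff degree_0 le0 simp_thms)
  qed auto
  define T where "T i h = coeff (if 2 * h = i + 2 then
      smult (real ((k + 2 choose i) * (i choose h))) ([:0, 2:] ^ (k + 2 - i) * [:- 1, 0, 1:] ^ (i - h)) else 0 :: real poly) k" for i h
  have T0: "0 \<le> T i h" if "i \<le> k + 2" "h \<le> i" for i h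
    using mult_nonneg_nonneg [OF of_nat_0_le_iff less_imp_le [OF eigen_poly_term(2) [OF that]]]
    by (cases "2 * h = i + 2") (simp_all only: T_def if_True if_False coeff_smult coeff_0 order_refl simp_thms)
  have T2: "0 < T 2 2"
  proof -
    have "0 < (k + 2 choose 2) * (2 choose 2)" by (simp add: zero_less_binomial_iff)
    then show ?thesis using eigen_poly_term(2) [of 2 k 2] by (simp add: T_def del: of_nat_mult)
  qed
  have "0 < (\<Sum>i\<le>k + 2. \<Sum>h\<le>i. T i h)"
  proof (rule sum_pos2 [of _ 2])
    show "0 < (\<Sum>h\<le>2. T 2 h)" by (rule sum_pos2 [of _ 2]) (use T0 T2 in auto)
  qed (use T0 in \<open>auto intro!: sum_nonneg\<close>)
  also have "(\<Sum>i\<le>k + 2. \<Sum>h\<le>i. T i h) = coeff (eigen_poly k) k"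
    by (simp only: eigen_poly_def coeff_sum T_def)
  finally show "coeff (eigen_poly k) k \<noteq> 0" by simp
qed

lemma coeff_of_nat_times: "coeff (of_nat n * p) N = of_nat n * coeff p N"
  for p :: "'a :: comm_ring_1 poly"
  by (simp add: of_nat_poly)

lemma coeff_trinomial_power:
  fixes a b c :: "'a :: comm_ring_1"
  shows "coeff ([:a, b, c:] ^ l) N =
    (\<Sum>i\<le>l. \<Sum>h\<le>i. if l - i + 2 * h = N then of_nat ((l choose i) * (i choose h)) * b ^ (l - i) * (c ^ h * a ^ (i - h)) else 0)"
proof -
  have "[:a, b, c:] = (monom c 2 + monom a 0) + monom b 1"
    by (simp add: monom_altdef numeral_2_eq_2)
  then have "[:a, b, c:] ^ l = (\<Sum>i\<le>l. of_nat (l choose i) * (\<Sum>h\<le>i. of_nat (i choose h) * monom (c ^ h * a ^ (i - h)) (2 * h)) * monom (b ^ (l - i)) (l - i))"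
    by (simp add: binomial_ring [of "monom c 2 + monom a 0"] binomial_ring [of "monom c 2"] monom_power mult_monom mult.assoc)
  also have "\<dots> = (\<Sum>i\<le>l. \<Sum>h\<le>i. of_nat ((l choose i) * (i choose h)) * monom (b ^ (l - i) * (c ^ h * a ^ (i - h))) (l - i + 2 * h))"
    by (simp add: sum_distrib_left sum_distrib_right mult_monom mult_ac add_ac)
  finally have e: "[:a, b, c:] ^ l = (\<Sum>i\<le>l. \<Sum>h\<le>i. of_nat ((l choose i) * (i choose h)) * monom (b ^ (l - i) * (c ^ h * a ^ (i - h))) (l - i + 2 * h))" .
  have *: "coeff (of_nat n * monom y d) N = (if d = N then of_nat n * y else 0)" for n d and y :: 'a
    unfolding coeff_of_nat_times coeff_monom by simp
  show ?thesis unfolding e coeff_sum * by (simp only: mult.assoc)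
qed

lemma coeff_eigen:
  fixes \<zeta> :: complex and x :: real
  assumes "\<zeta> * cnj \<zeta> = of_real (1 - x\<^sup>2)"
  shows "coeff ([:- cnj \<zeta>, of_real (2 * x), \<zeta>:] ^ (k + 2)) (k + 4) = \<zeta>\<^sup>2 * of_real (poly (eigen_poly k) x)"
proof -
  have "coeff ([:- cnj \<zeta>, of_real (2 * x), \<zeta>:] ^ (k + 2)) (k + 4) =
    (\<Sum>i\<le>k + 2. \<Sum>h\<le>i. if k + 2 - i + 2 * h = k + 4 then of_nat ((k + 2 choose i) * (i choose h)) * of_real (2 * x) ^ (k + 2 - i) * (\<zeta> ^ h * (- cnj \<zeta>) ^ (i - h)) else 0)"
    by (rule coeff_trinomial_power)
  also have "\<dots> = (\<Sum>i\<le>k + 2. \<Sum>h\<le>i. \<zeta>\<^sup>2 * of_real (if 2 * h = i + 2 then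
      real ((k + 2 choose i) * (i choose h)) * ((2 * x) ^ (k + 2 - i) * (x\<^sup>2 - 1) ^ (i - h)) else 0))"
  proof (intro sum.cong refl)
    fix i h assume "i \<in> {..k + 2}" "h \<in> {..i}"
    then have ih: "i \<le> k + 2" "h \<le> i" by auto
    show "(if k + 2 - i + 2 * h = k + 4 then of_nat ((k + 2 choose i) * (i choose h)) * of_real (2 * x) ^ (k + 2 - i) * (\<zeta> ^ h * (- cnj \<zeta>) ^ (i - h)) else 0)
      = \<zeta>\<^sup>2 * of_real (if 2 * h = i + 2 then real ((k + 2 choose i) * (i choose h)) * ((2 * x) ^ (k + 2 - i) * (x\<^sup>2 - 1) ^ (i - h)) else 0)"
    proof (cases "2 * h = i + 2")
      case True
      then have "k + 2 - i + 2 * h = k + 4" using ih by simp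
      moreover have "\<zeta> ^ h * (- cnj \<zeta>) ^ (i - h) = \<zeta>\<^sup>2 * of_real ((x\<^sup>2 - 1) ^ (i - h))"
      proof -
        have "h = 2 + (i - h)" using True ih by simp
        then have "\<zeta> ^ h = \<zeta>\<^sup>2 * \<zeta> ^ (i - h)" by (metis power_add)
        then have "\<zeta> ^ h * (- cnj \<zeta>) ^ (i - h) = \<zeta>\<^sup>2 * (- (\<zeta> * cnj \<zeta>)) ^ (i - h)"
          by (simp add: power_mult_distrib [symmetric] mult.assoc)
        also have "- (\<zeta> * cnj \<zeta>) = of_real (x\<^sup>2 - 1)" unfolding assms by simp
        finally show ?thesis by simp
      qed
      ultimately show ?thesis using True by (simp add: mult_ac)
    next
      case False
      then have "k + 2 - i + 2 * h \<noteq> k + 4" using ih by linarith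
      then show ?thesis using False by simp
    qed
  qed
  also have "\<dots> = \<zeta>\<^sup>2 * of_real (\<Sum>i\<le>k + 2. \<Sum>h\<le>i. if 2 * h = i + 2 then
      real ((k + 2 choose i) * (i choose h)) * ((2 * x) ^ (k + 2 - i) * (x\<^sup>2 - 1) ^ (i - h)) else 0)"
    by (simp only: sum_distrib_left [symmetric] of_real_sum)
  also have "(\<Sum>i\<le>k + 2. \<Sum>h\<le>i. if 2 * h = i + 2 then
      real ((k + 2 choose i) * (i choose h)) * ((2 * x) ^ (k + 2 - i) * (x\<^sup>2 - 1) ^ (i - h)) else 0) = poly (eigen_poly k) x"
    unfolding eigen_poly_def poly_sum
    by (intro sum.cong refl) (auto simp: power2_eq_square mult_ac)
  finally show ?thesis .
qed

lemma coeff_linear_power':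
  fixes a b :: "'a :: comm_ring_1"
  shows "coeff ([:a, b:] ^ n) j = of_nat (n choose j) * b ^ j * a ^ (n - j)"
proof -
  have "[:a, b:] = monom b 1 + monom a 0" by (simp add: monom_altdef)
  then have e: "[:a, b:] ^ n = (\<Sum>j\<le>n. of_nat (n choose j) * monom (b ^ j * a ^ (n - j)) j)"
    by (simp add: binomial_ring monom_power mult_monom mult.assoc)
  have "coeff ([:a, b:] ^ n) j = (\<Sum>i\<le>n. if i = j then of_nat (n choose j) * b ^ j * a ^ (n - j) else 0)"
    unfolding e coeff_sum coeff_of_nat_times coeff_monom by (intro sum.cong refl) (auto simp: mult.assoc)
  also have "\<dots> = of_nat (n choose j) * b ^ j * a ^ (n - j)"
    by (simp add: binomial_eq_0)
  finally show ?thesis .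
qed

text \<open>The rotation by \<open>t\<close> acts on the two spinor coordinates by the linear forms with coefficients
  \<open>cos (t / 2)\<close> and \<open>sin (t / 2)\<close>. This coefficient is the diagonal entry for the weight 2.\<close>

lemma coeff_rotation:
  fixes t :: real
  defines "s \<equiv> sin (t / 2)" and "c \<equiv> cos (t / 2)"
  shows "coeff ([:c, s:] ^ k * [:- s, c:] ^ (k + 4)) (k + 4) = c ^ 4 * jac k (cos t)"
proof -
  have y: "(cos t - 1) / 2 = - (s\<^sup>2)" "(cos t + 1) / 2 = c\<^sup>2"
    using cos_double_sin [of "t / 2"] cos_double_cos [of "t / 2"] by (simp_all add: s_def c_def)
  have "coeff ([:c, s:] ^ k * [:- s, c:] ^ (k + 4)) (k + 4) =
     (\<Sum>i\<le>k + 4. (real (k choose i) * s ^ i * c ^ (k - i)) * (real (k + 4 choose (k + 4 - i)) * c ^ (k + 4 - i) * (- s) ^ (k + 4 - (k + 4 - i))))"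
    by (simp add: coeff_mult coeff_linear_power')
  also have "\<dots> = (\<Sum>i\<le>k. (real (k choose i) * s ^ i * c ^ (k - i)) * (real (k + 4 choose (k + 4 - i)) * c ^ (k + 4 - i) * (- s) ^ (k + 4 - (k + 4 - i))))"
    by (rule sum.mono_neutral_right) (auto simp: binomial_eq_0)
  also have "\<dots> = (\<Sum>i\<le>k. c ^ 4 * (jac_coeff k i * ((- (s\<^sup>2)) ^ i * (c\<^sup>2) ^ (k - i))))"
  proof (intro sum.cong refl)
    fix i assume "i \<in> {..k}"
    then have i: "i \<le> k" by simp
    then have "k + 4 choose (k + 4 - i) = k + 4 choose i" by (intro binomial_symmetric [symmetric]) simp
    moreover have "k + 4 - (k + 4 - i) = i" "k + 4 - i = 4 + (k - i)" using i by auto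
    moreover have "s ^ i * (- s) ^ i = (- (s\<^sup>2)) ^ i"
      by (simp add: power_mult_distrib [symmetric] power2_eq_square)
    moreover have "c ^ (k - i) * c ^ (k - i) = (c\<^sup>2) ^ (k - i)"
      by (simp add: power_mult_distrib [symmetric] power2_eq_square)
    moreover have "(real (k choose i) * X * W) * (real (k + 4 choose i) * (c ^ 4 * W) * Z)
        = c ^ 4 * (jac_coeff k i * ((X * Z) * (W * W)))" for X W Z
      by (simp add: jac_coeff_def)
    ultimately show "(real (k choose i) * s ^ i * c ^ (k - i)) * (real (k + 4 choose (k + 4 - i)) * c ^ (k + 4 - i) * (- s) ^ (k + 4 - (k + 4 - i)))
      = c ^ 4 * (jac_coeff k i * ((- (s\<^sup>2)) ^ i * (c\<^sup>2) ^ (k - i)))"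
      by (simp only: power_add)
  qed
  also have "\<dots> = c ^ 4 * jac k (cos t)"
    by (simp add: jac_def y sum_distrib_left)
  finally show ?thesis .
qed

lemma poly_as_sum:
  fixes p :: "'a :: comm_ring_1 poly"
  assumes "degree p \<le> n"
  shows "poly p z = (\<Sum>i\<le>n. coeff p i * z ^ i)"
proof -
  have "poly p z = (\<Sum>i\<le>degree p. coeff p i * z ^ i)" by (rule poly_altdef)
  also have "\<dots> = (\<Sum>i\<le>n. coeff p i * z ^ i)"
    using assms by (intro sum.mono_neutral_left) (auto intro: le_degree)
  finally show ?thesis .
qed

lemma real_coeff_power:
  fixes p :: "complex poly"
  assumes "\<And>i. coeff p i \<in> \<real>"
  shows "coeff (p ^ n) i \<in> \<real>"
proof (induction n arbitrary: i)
  case 0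
  show ?case by (cases i) auto
next
  case (Suc n)
  then show ?case using assms by (auto simp: coeff_mult intro!: sum_in_Reals)
qed

lemma degree_trinomial_power: "degree ([:a, b, c :: 'a :: comm_ring_1:] ^ l) \<le> 2 * l"
proof -
  have "degree ([:a, b, c:] ^ l) \<le> degree [:a, b, c:] * l" by (rule degree_power_le)
  also have "\<dots> \<le> 2 * l" by (intro mult_right_mono) (auto simp: degree_pCons_eq_if)
  finally show ?thesis .
qed

text \<open>The rotation by \<open>t\<close> about the second axis carries the point with polar angle $\arccos x$ and azimuth \<open>\<phi>\<close> to
  the point with coordinates \<open>rot_U t x \<phi>\<close>, \<open>rot_V x \<phi>\<close> and \<open>R = trans_arg x (cos t) (cos \<phi>)\<close>.\<close>

definition rot_U :: "real \<Rightarrow> real \<Rightarrow> real \<Rightarrow> real" where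
  "rot_U t x \<phi> = x * sin t + sqrt (1 - x\<^sup>2) * cos t * cos \<phi>"

definition rot_V :: "real \<Rightarrow> real \<Rightarrow> real" where
  "rot_V x \<phi> = sqrt (1 - x\<^sup>2) * sin \<phi>"

lemma rotated_kernel:
  fixes t x \<phi> :: real
  assumes t: "0 \<le> t" "t \<le> pi" and x: "-1 \<le> x" "x \<le> 1"
  defines "R \<equiv> trans_arg x (cos t) (cos \<phi>)" and "\<zeta> \<equiv> Complex (rot_U t x \<phi>) (rot_V x \<phi>)"
  shows "R = x * cos t - sqrt (1 - x\<^sup>2) * sin t * cos \<phi>"
    "\<zeta> * cnj \<zeta> = of_real (1 - R\<^sup>2)"
    "trans_kernel (cos t) x (cos \<phi>) R = Re (cis (- 2 * \<phi>) * \<zeta>\<^sup>2)"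
    "1 - R\<^sup>2 = (rot_U t x \<phi>)\<^sup>2 + (rot_V x \<phi>)\<^sup>2"
proof -
  define \<sigma> where "\<sigma> = sqrt (1 - x\<^sup>2)"
  have "x\<^sup>2 \<le> 1" using x by (simp add: abs_square_le_1 abs_le_iff)
  then have \<sigma>: "\<sigma>\<^sup>2 = 1 - x\<^sup>2" by (simp add: \<sigma>_def)
  have st: "sqrt (1 - (cos t)\<^sup>2) = sin t"
    using t sin_ge_zero [of t] by (simp add: sin_squared_eq [symmetric])
  show R: "R = x * cos t - sqrt (1 - x\<^sup>2) * sin t * cos \<phi>"
    by (simp add: R_def trans_arg_def st mult_ac)
  define ct st' cp sp where "ct = cos t" and "st' = sin t" and "cp = cos \<phi>" and "sp = sin \<phi>"
  have tt: "st'\<^sup>2 = 1 - ct\<^sup>2" "sp\<^sup>2 = 1 - cp\<^sup>2" by (simp_all add: st'_def ct_def sp_def cp_def sin_squared_eq)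
  have U: "rot_U t x \<phi> = x * st' + \<sigma> * ct * cp" "rot_V x \<phi> = \<sigma> * sp" "R = x * ct - \<sigma> * st' * cp"
    by (simp_all add: rot_U_def rot_V_def R \<sigma>_def ct_def st'_def cp_def sp_def)
  show RUV: "1 - R\<^sup>2 = (rot_U t x \<phi>)\<^sup>2 + (rot_V x \<phi>)\<^sup>2"
    unfolding U using \<sigma> tt by algebra
  show "\<zeta> * cnj \<zeta> = of_real (1 - R\<^sup>2)"
    unfolding RUV \<zeta>_def by (simp add: complex_eq_iff power2_eq_square)
  define A where "A = \<sigma> * ct + x * cp * st' + \<sigma> * (1 - ct) * (1 - cp\<^sup>2)"
  have A: "A = rot_U t x \<phi> * cp + rot_V x \<phi> * sp"
    unfolding A_def U using tt by algebra
  have "trans_kernel (cos t) x (cos \<phi>) R = 2 * A\<^sup>2 - (1 - R\<^sup>2)"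
    by (simp add: trans_kernel_def A_def st \<sigma>_def ct_def st'_def cp_def)
  also have "\<dots> = (rot_U t x \<phi> * cp + rot_V x \<phi> * sp)\<^sup>2 - (rot_V x \<phi> * cp - rot_U t x \<phi> * sp)\<^sup>2"
    unfolding RUV A using tt by algebra
  also have "\<dots> = Re ((cis (- \<phi>) * \<zeta>)\<^sup>2)"
    by (simp add: \<zeta>_def power2_eq_square cp_def sp_def algebra_simps)
  also have "(cis (- \<phi>) * \<zeta>)\<^sup>2 = cis (- 2 * \<phi>) * \<zeta>\<^sup>2"
    by (simp add: power_mult_distrib Complex.DeMoivre)
  finally show "trans_kernel (cos t) x (cos \<phi>) R = Re (cis (- 2 * \<phi>) * \<zeta>\<^sup>2)" .
qed

lemma Re_of_real_times: "Re (of_real a * z) = a * Re z"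
  by simp

text \<open>In the quadratic form for the rotated point, the substitution of the linear forms \<open>p\<close> and \<open>q\<close> in \<open>z\<close>
  gives $2xpq + \sigma (q^2 e^{i\phi} - p^2 e^{-i\phi})$ with $\sigma = \sqrt{1-x^2}$. Comparing the coefficients of
  $z^{k+4}$ in the powers of both forms expands the integrand into cosines of integer multiples of \<open>\<phi>\<close>.
  The constant term belongs to the index \<open>k + 4\<close>, where \<open>coeff_rotation\<close> applies.\<close>

lemma kernel_expansion:
  fixes t x :: real
  assumes t: "0 \<le> t" "t \<le> pi" and x: "-1 \<le> x" "x \<le> 1"
  defines "R \<equiv> \<lambda>\<phi>. trans_arg x (cos t) (cos \<phi>)"
  obtains w where
    "\<And>\<phi>. trans_kernel (cos t) x (cos \<phi>) (R \<phi>) * poly (eigen_poly k) (R \<phi>) =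
       (\<Sum>n\<le>2 * (k + 2). w n * cos ((real n - real (k + 4)) * \<phi>))"
    "w (k + 4) = (1 - x\<^sup>2) * cos (t / 2) ^ 4 * jac k (cos t) * poly (eigen_poly k) x"
proof -
  define l where "l = k + 2"
  define \<sigma> where "\<sigma> = sqrt (1 - x\<^sup>2)"
  have "x\<^sup>2 \<le> 1" using x by (simp add: abs_square_le_1 abs_le_iff)
  then have \<sigma>: "\<sigma>\<^sup>2 = 1 - x\<^sup>2" by (simp add: \<sigma>_def)
  define s c where "s = sin (t / 2)" and "c = cos (t / 2)"
  define Y where "Y = [:- complex_of_real \<sigma>, of_real (2 * x), of_real \<sigma>:] ^ l"
  define y where "y n = Re (coeff Y n)" for n
  have Yr: "coeff Y n = of_real (y n)" for n
  proof -
    have "coeff Y n \<in> \<real>" unfolding Y_def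
      by (rule real_coeff_power) (auto simp: coeff_pCons split: nat.split)
    then show ?thesis by (simp add: y_def)
  qed
  define C where "C n = coeff ([:c, s:] ^ (2 * l - n) * [:- s, c:] ^ n) (k + 4)" for n
  have yl: "y (k + 4) = (1 - x\<^sup>2) * poly (eigen_poly k) x"
  proof -
    have "coeff Y (k + 4) = (of_real \<sigma>)\<^sup>2 * of_real (poly (eigen_poly k) x)"
      using coeff_eigen [of "of_real \<sigma>" x k] \<sigma> by (simp add: Y_def l_def power2_eq_square del: of_real_mult flip: of_real_mult of_real_power)
    then have "of_real (y (k + 4)) = complex_of_real (\<sigma>\<^sup>2 * poly (eigen_poly k) x)"
      unfolding Yr by simp
    then show ?thesis unfolding \<sigma> of_real_eq_iff .
  qed
  have Cl: "C (k + 4) = c ^ 4 * jac k (cos t)"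
    using coeff_rotation [of t k] by (simp add: C_def l_def s_def c_def)
  have "trans_kernel (cos t) x (cos \<phi>) (R \<phi>) * poly (eigen_poly k) (R \<phi>) =
       (\<Sum>n\<le>2 * l. y n * C n * cos ((real n - real (k + 4)) * \<phi>))" for \<phi>
  proof -
    define \<zeta> where "\<zeta> = Complex (rot_U t x \<phi>) (rot_V x \<phi>)"
    define Q where "Q = [:- cnj \<zeta>, of_real (2 * R \<phi>), \<zeta>:]"
    have R\<phi>: "R \<phi> = trans_arg x (cos t) (cos \<phi>)" by (simp add: R_def)
    note rk = rotated_kernel [OF t x, of \<phi>, folded R\<phi> \<zeta>_def]
    define pz qz where "pz z = c + s * z" and "qz z = - s + c * z" for z :: real
    have ct: "cos t = c\<^sup>2 - s\<^sup>2" "sin t = 2 * s * c" "s\<^sup>2 + c\<^sup>2 = 1"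
      using cos_double [of "t / 2"] sin_double [of "t / 2"] by (simp_all add: s_def c_def)
    have "poly Q (of_real z) = of_real (2 * x * pz z * qz z) + of_real \<sigma> * (of_real ((qz z)\<^sup>2) * cis \<phi> - of_real ((pz z)\<^sup>2) * cis (- \<phi>))" for z
    proof (rule complex_eqI)
      define cp sp where "cp = cos \<phi>" and "sp = sin \<phi>"
      have "Re (poly Q (of_real z)) = (z\<^sup>2 - 1) * rot_U t x \<phi> + 2 * z * R \<phi>"
        by (simp add: Q_def \<zeta>_def power2_eq_square algebra_simps)
      also have "\<dots> = 2 * x * pz z * qz z + \<sigma> * ((qz z)\<^sup>2 * cp - (pz z)\<^sup>2 * cp)"
        unfolding rk(1) rot_U_def \<sigma>_def [symmetric] cp_def [symmetric] ct(1,2) pz_def qz_def by algebra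
      finally show "Re (poly Q (of_real z)) = Re (of_real (2 * x * pz z * qz z) + of_real \<sigma> * (of_real ((qz z)\<^sup>2) * cis \<phi> - of_real ((pz z)\<^sup>2) * cis (- \<phi>)))"
        by (simp add: cp_def)
      have "Im (poly Q (of_real z)) = (z\<^sup>2 + 1) * rot_V x \<phi>"
        by (simp add: Q_def \<zeta>_def power2_eq_square algebra_simps)
      also have "\<dots> = \<sigma> * ((qz z)\<^sup>2 * sp + (pz z)\<^sup>2 * sp)"
        unfolding rot_V_def \<sigma>_def [symmetric] sp_def [symmetric] pz_def qz_def using ct(3) by algebra
      finally show "Im (poly Q (of_real z)) = Im (of_real (2 * x * pz z * qz z) + of_real \<sigma> * (of_real ((qz z)\<^sup>2) * cis \<phi> - of_real ((pz z)\<^sup>2) * cis (- \<phi>)))"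
        by (simp add: sp_def)
    qed
    note Qz = this
    define P1 where "P1 = (\<Sum>N\<le>2 * l. monom (Re (cis (- 2 * \<phi>) * coeff (Q ^ l) N)) N)"
    define P2 where "P2 = (\<Sum>n\<le>2 * l. smult (y n * cos ((real n - real (k + 4)) * \<phi>)) ([:c, s:] ^ (2 * l - n) * [:- s, c:] ^ n))"
    have eq: "poly P1 z = poly P2 z" if z: "pz z \<noteq> 0" for z
    proof -
      define u v where "u = complex_of_real (pz z)" and "v = of_real (qz z) * cis \<phi>"
      have u: "u \<noteq> 0" using z by (simp add: u_def)
      have Y1: "poly Q (of_real z) = cis (- \<phi>) * (u\<^sup>2 * poly [:- complex_of_real \<sigma>, of_real (2 * x), of_real \<sigma>:] (v / u))"
      proof -
        have p: "u\<^sup>2 * poly [:- complex_of_real \<sigma>, of_real (2 * x), of_real \<sigma>:] (v / u) = - of_real \<sigma> * u\<^sup>2 + of_real (2 * x) * u * v + of_real \<sigma> * v\<^sup>2"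
          using u by (simp add: field_simps power2_eq_square)
        have alg: "X * U * Q + S * (Q\<^sup>2 * E - U\<^sup>2 * F) = F * (- S * U\<^sup>2 + X * U * (Q * E) + S * (Q * E)\<^sup>2)"
          if "E * F = 1" for X S U Q E F :: complex
          using that by algebra
        have "cis \<phi> * cis (- \<phi>) = 1" by (simp add: cis_mult)
        from alg [OF this, of "of_real (2 * x)" u "of_real (qz z)" "of_real \<sigma>"] show ?thesis
          unfolding Qz p unfolding v_def by (simp add: u_def)
      qed
      have "poly P1 z = Re (cis (- 2 * \<phi>) * (\<Sum>N\<le>2 * l. coeff (Q ^ l) N * of_real z ^ N))"
        by (simp add: P1_def poly_sum poly_monom sum_distrib_left Re_sum flip: of_real_power)
          (intro sum.cong refl, simp add: algebra_simps)
      also have "(\<Sum>N\<le>2 * l. coeff (Q ^ l) N * of_real z ^ N) = poly Q (of_real z) ^ l"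
        unfolding Q_def by (subst poly_as_sum [symmetric, OF degree_trinomial_power]) simp
      also have "\<dots> = cis (- \<phi>) ^ l * (u ^ (2 * l) * poly Y (v / u))"
        unfolding Y1 Y_def by (simp add: power_mult_distrib power_mult)
      also have "poly Y (v / u) = (\<Sum>n\<le>2 * l. of_real (y n) * (v / u) ^ n)"
        unfolding Yr [symmetric] unfolding Y_def by (rule poly_as_sum [OF degree_trinomial_power])
      also have "u ^ (2 * l) * \<dots> = (\<Sum>n\<le>2 * l. of_real (y n) * (u ^ (2 * l - n) * v ^ n))"
        unfolding sum_distrib_left
      proof (intro sum.cong refl)
        fix n assume "n \<in> {..2 * l}"
        then have "u ^ (2 * l) = u ^ (2 * l - n) * u ^ n" by (simp flip: power_add)
        then show "u ^ (2 * l) * (of_real (y n) * (v / u) ^ n) = of_real (y n) * (u ^ (2 * l - n) * v ^ n)"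
          using u by (simp add: power_divide)
      qed
      also have "cis (- 2 * \<phi>) * (cis (- \<phi>) ^ l * (\<Sum>n\<le>2 * l. of_real (y n) * (u ^ (2 * l - n) * v ^ n)))
         = (\<Sum>n\<le>2 * l. of_real (y n * (pz z ^ (2 * l - n) * qz z ^ n)) * cis ((real n - real (k + 4)) * \<phi>))"
        unfolding sum_distrib_left
      proof (intro sum.cong refl)
        fix n
        have "cis (- 2 * \<phi>) * cis (- \<phi>) ^ l * cis \<phi> ^ n = cis ((real n - real (k + 4)) * \<phi>)"
          by (simp add: Complex.DeMoivre cis_mult l_def algebra_simps)
        moreover have "cis (- 2 * \<phi>) * (cis (- \<phi>) ^ l * (of_real (y n) * (u ^ (2 * l - n) * v ^ n)))
          = of_real (y n * (pz z ^ (2 * l - n) * qz z ^ n)) * (cis (- 2 * \<phi>) * cis (- \<phi>) ^ l * cis \<phi> ^ n)"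
          by (simp add: u_def v_def power_mult_distrib mult_ac)
        ultimately show "cis (- 2 * \<phi>) * (cis (- \<phi>) ^ l * (of_real (y n) * (u ^ (2 * l - n) * v ^ n)))
          = of_real (y n * (pz z ^ (2 * l - n) * qz z ^ n)) * cis ((real n - real (k + 4)) * \<phi>)" by simp
      qed
      also have "Re \<dots> = (\<Sum>n\<le>2 * l. y n * (pz z ^ (2 * l - n) * qz z ^ n) * cos ((real n - real (k + 4)) * \<phi>))"
        by (simp only: Re_sum Re_of_real_times cis.sel)
      also have "\<dots> = poly P2 z"
        by (simp add: P2_def poly_sum pz_def qz_def mult_ac)
      finally show ?thesis .
    qed
    have "P1 = P2"
    proof -
      have "\<exists>S. infinite S \<and> (\<forall>z\<in>S. pz z \<noteq> 0)"
      proof (cases "s = 0")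
        case True
        then have "c \<noteq> 0" using ct(3) by auto
        then show ?thesis using True by (intro exI [of _ UNIV]) (auto simp: pz_def infinite_UNIV_char_0)
      next
        case False
        then have "pz z \<noteq> 0" if "z \<in> - {- c / s}" for z using that by (auto simp: pz_def field_simps)
        moreover have "infinite (- {- c / s})" by (simp add: Compl_eq_Diff_UNIV Diff_infinite_finite infinite_UNIV_char_0)
        ultimately show ?thesis by blast
      qed
      then obtain S where S: "infinite S" "\<And>z. z \<in> S \<Longrightarrow> pz z \<noteq> 0" by blast
      have "P1 - P2 = 0"
      proof (rule ccontr)
        assume "P1 - P2 \<noteq> 0"
        then have "finite {z. poly (P1 - P2) z = 0}" by (rule poly_roots_finite)
        moreover have "S \<subseteq> {z. poly (P1 - P2) z = 0}" using eq S(2) by auto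
        ultimately show False using S(1) finite_subset by blast
      qed
      then show ?thesis by simp
    qed
    then have "coeff P1 (k + 4) = coeff P2 (k + 4)" by simp
    moreover have "coeff P1 (k + 4) = Re (cis (- 2 * \<phi>) * coeff (Q ^ l) (k + 4))"
    proof -
      have "k + 4 \<le> 2 * l" by (simp add: l_def)
      then show ?thesis
        unfolding P1_def coeff_sum coeff_monom by (simp only: sum.delta finite_atMost atMost_iff if_True)
    qed
    moreover have "coeff (Q ^ l) (k + 4) = \<zeta>\<^sup>2 * of_real (poly (eigen_poly k) (R \<phi>))"
      unfolding Q_def l_def by (rule coeff_eigen [OF rk(2)])
    moreover have "Re (cis (- 2 * \<phi>) * (\<zeta>\<^sup>2 * of_real (poly (eigen_poly k) (R \<phi>)))) = Re (cis (- 2 * \<phi>) * \<zeta>\<^sup>2) * poly (eigen_poly k) (R \<phi>)"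
      using Re_of_real_times [of "poly (eigen_poly k) (R \<phi>)" "cis (- 2 * \<phi>) * \<zeta>\<^sup>2"] by (simp only: mult_ac)
    moreover have "coeff P2 (k + 4) = (\<Sum>n\<le>2 * l. y n * C n * cos ((real n - real (k + 4)) * \<phi>))"
      unfolding P2_def coeff_sum coeff_smult C_def by (simp add: mult_ac)
    ultimately show ?thesis unfolding rk(3) by simp
  qed
  moreover have "y (k + 4) * C (k + 4) = (1 - x\<^sup>2) * cos (t / 2) ^ 4 * jac k (cos t) * poly (eigen_poly k) x"
    unfolding yl Cl c_def by simp
  ultimately show thesis using that [of "\<lambda>n. y n * C n"] unfolding l_def by blast
qed

lemma cos_integral:
  fixes m :: int
  shows "((\<lambda>\<phi>. cos (of_int m * \<phi>)) has_integral (if m = 0 then pi else 0)) {0..pi}"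
proof (cases "m = 0")
  case True
  then show ?thesis using has_integral_const_real [of "1 :: real" 0 pi] by simp
next
  case False
  have "((\<lambda>\<phi>. sin (of_int m * \<phi>) / of_int m) has_real_derivative cos (of_int m * \<phi>)) (at \<phi>)" for \<phi> :: real
    using False by (auto intro!: derivative_eq_intros)
  from FTC_real [OF _ this, of 0 pi] show ?thesis
    using False sin_npi_int [of m] by (simp add: mult.commute)
qed

lemma gen_translation_eigen:
  assumes t: "\<bar>t\<bar> < pi" and x: "-1 < x" "x < 1"
  shows "gen_translation t (poly (eigen_poly k)) x = jac k (cos t) * poly (eigen_poly k) x"
proof -
  define T where "T = \<bar>t\<bar>"
  have T: "0 \<le> T" "T \<le> pi" "cos T = cos t" using t by (auto simp: T_def abs_if)
  have cT: "cos (T / 2) = cos (t / 2)" by (auto simp: T_def abs_if)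
  have x': "-1 \<le> x" "x \<le> 1" using x by auto
  have x2: "x\<^sup>2 < 1" using x by (simp add: abs_square_less_1 abs_less_iff)
  have c0: "cos (t / 2) \<noteq> 0" using t cos_gt_zero_pi [of "t / 2"] by (auto simp: abs_less_iff)
  obtain w where w: "\<And>\<phi>. trans_kernel (cos t) x (cos \<phi>) (trans_arg x (cos t) (cos \<phi>)) * poly (eigen_poly k) (trans_arg x (cos t) (cos \<phi>)) =
       (\<Sum>n\<le>2 * (k + 2). w n * cos ((real n - real (k + 4)) * \<phi>))"
    "w (k + 4) = (1 - x\<^sup>2) * cos (t / 2) ^ 4 * jac k (cos t) * poly (eigen_poly k) x"
    by (rule kernel_expansion [OF T(1,2) x', of k, unfolded T(3) cT]) (rule that; assumption)
  define F where "F \<phi> = (\<Sum>n\<le>2 * (k + 2). w n * cos ((real n - real (k + 4)) * \<phi>))" for \<phi>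
  have "(F has_integral (\<Sum>n\<le>2 * (k + 2). w n * (if int n - int (k + 4) = 0 then pi else 0))) {0..pi}"
    unfolding F_def
    using cos_integral [of "int n - int (k + 4)" for n]
    by (intro has_integral_sum has_integral_mult_right) auto
  also have "(\<Sum>n\<le>2 * (k + 2). w n * (if int n - int (k + 4) = 0 then pi else 0)) = (\<Sum>n\<le>2 * (k + 2). if n = k + 4 then w (k + 4) * pi else 0)"
    by (intro sum.cong refl) auto
  also have "\<dots> = w (k + 4) * pi" by simp
  finally have F: "(F has_integral w (k + 4) * pi) {0..pi}" .
  have "integrable (lebesgue_on {0..pi}) F"
    unfolding F_def by (intro continuous_imp_integrable_real continuous_intros)
  then have "(LINT \<phi>|lebesgue_on {0..pi}. F \<phi>) = w (k + 4) * pi"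
    using lebesgue_integral_eq_integral [of "{0..pi}" F] integral_unique [OF F] by simp
  then show ?thesis
    using x c0 unfolding gen_translation_def w F_def [symmetric] w(2)
    using x2 by simp
qed


section \<open>Boundedness of the translation\<close>

text \<open>The left side of the first inequality is the square of one of the two coordinates whose squares add
  up to \<open>1 - R\<^sup>2\<close>. The kernel is the real part of a number of that modulus.\<close>

lemma trans_gap:
  assumes x: "-1 \<le> x" "x \<le> 1" and y: "-1 \<le> y" "y \<le> 1"
  defines "R \<equiv> \<lambda>\<phi>. trans_arg x y (cos \<phi>)"
  shows "(1 - x\<^sup>2) * (sin \<phi>)\<^sup>2 \<le> 1 - (R \<phi>)\<^sup>2"
    "\<bar>trans_kernel y x (cos \<phi>) (R \<phi>)\<bar> \<le> 1 - (R \<phi>)\<^sup>2"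
proof -
  define t where "t = arccos y"
  have t: "0 \<le> t" "t \<le> pi" "cos t = y" using y by (auto simp: t_def arccos_lbound arccos_ubound cos_arccos)
  define \<zeta> where "\<zeta> = Complex (rot_U t x \<phi>) (rot_V x \<phi>)"
  note rk = rotated_kernel [OF t(1,2) x, of \<phi>, unfolded t(3), folded \<zeta>_def]
  have "x\<^sup>2 \<le> 1" using x by (simp add: abs_square_le_1 abs_le_iff)
  then have "(rot_V x \<phi>)\<^sup>2 = (1 - x\<^sup>2) * (sin \<phi>)\<^sup>2" by (simp add: rot_V_def power_mult_distrib)
  then show "(1 - x\<^sup>2) * (sin \<phi>)\<^sup>2 \<le> 1 - (R \<phi>)\<^sup>2" using rk(4) by (simp add: R_def)
  have "\<bar>trans_kernel y x (cos \<phi>) (R \<phi>)\<bar> \<le> cmod (cis (- 2 * \<phi>) * \<zeta>\<^sup>2)"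
    unfolding R_def rk(3) by (rule abs_Re_le_cmod)
  also have "\<dots> = (cmod \<zeta>)\<^sup>2" by (simp add: norm_mult norm_power)
  also have "\<dots> = 1 - (R \<phi>)\<^sup>2"
    using rk(4) by (simp add: R_def \<zeta>_def cmod_power2)
  finally show "\<bar>trans_kernel y x (cos \<phi>) (R \<phi>)\<bar> \<le> 1 - (R \<phi>)\<^sup>2" .
qed

lemma one_minus_square_pos: "-1 < x \<Longrightarrow> x < 1 \<Longrightarrow> 0 < 1 - x\<^sup>2" for x :: real
  by (simp add: abs_square_less_1 abs_less_iff)

lemma trans_arg_interior:
  assumes x: "-1 < x" "x < 1" and y: "-1 \<le> y" "y \<le> 1" and \<phi>: "0 < \<phi>" "\<phi> < pi"
  shows "0 < 1 - (trans_arg x y (cos \<phi>))\<^sup>2" "trans_arg x y (cos \<phi>) \<in> {-1<..<1}"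
proof -
  have "0 < (1 - x\<^sup>2) * (sin \<phi>)\<^sup>2"
    using one_minus_square_pos [OF x] sin_gt_zero [OF \<phi>] by simp
  also have "\<dots> \<le> 1 - (trans_arg x y (cos \<phi>))\<^sup>2" using x y by (intro trans_gap) auto
  finally show *: "0 < 1 - (trans_arg x y (cos \<phi>))\<^sup>2" .
  then have "(trans_arg x y (cos \<phi>))\<^sup>2 < 1" by simp
  then show "trans_arg x y (cos \<phi>) \<in> {-1<..<1}" unfolding abs_square_less_1 by (auto simp: abs_less_iff)
qed

lemma trans_arg_measurable [measurable]:
  "(\<lambda>\<phi>. trans_arg x y (cos \<phi>)) \<in> borel_measurable borel"
  "(\<lambda>p. trans_arg (fst p) y (cos (snd p))) \<in> borel_measurable (borel \<Otimes>\<^sub>M borel)"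
  unfolding trans_arg_def by measurable

lemma trans_kernel_measurable [measurable]:
  "(\<lambda>\<phi>. trans_kernel y x (cos \<phi>) (trans_arg x y (cos \<phi>))) \<in> borel_measurable borel"
  "(\<lambda>p. trans_kernel y (fst p) (cos (snd p)) (trans_arg (fst p) y (cos (snd p)))) \<in> borel_measurable (borel \<Otimes>\<^sub>M borel)"
  unfolding trans_kernel_def by measurable

text \<open>Up to the factor $1/\pi$ this is the Legendre translation, the mean of \<open>b\<close> over a circle on the sphere.\<close>

definition legendre :: "(real \<Rightarrow> real) \<Rightarrow> real \<Rightarrow> real \<Rightarrow> ennreal" where
  "legendre b y x = (\<integral>\<^sup>+\<phi>. ennreal (b (trans_arg x y (cos \<phi>)) * indicator {0<..<pi} \<phi>) \<partial>lborel)"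

text \<open>Changing the variable from \<open>\<phi>\<close> to \<open>\<rho> = R\<close> gives an integral kernel whose discriminant is symmetric in
  \<open>x\<close>, \<open>y\<close> and \<open>\<rho>\<close>; this symmetry is the reason that the Legendre translation is self-adjoint.\<close>

definition leg_discr :: "real \<Rightarrow> real \<Rightarrow> real \<Rightarrow> real" where
  "leg_discr y x \<rho> = 1 - x\<^sup>2 - y\<^sup>2 - \<rho>\<^sup>2 + 2 * x * y * \<rho>"

definition leg_kernel :: "real \<Rightarrow> real \<Rightarrow> real \<Rightarrow> real" where
  "leg_kernel y x \<rho> = (if 0 < leg_discr y x \<rho> \<and> x \<in> {-1<..<1} \<and> \<rho> \<in> {-1<..<1}
     then 1 / sqrt (leg_discr y x \<rho>) else 0)"

lemma leg_kernel_sym: "leg_kernel y x \<rho> = leg_kernel y \<rho> x"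
proof -
  have "leg_discr y x \<rho> = leg_discr y \<rho> x" by (simp add: leg_discr_def mult_ac)
  then show ?thesis by (auto simp: leg_kernel_def)
qed

lemma leg_kernel_measurable [measurable]:
  "(\<lambda>\<rho>. leg_kernel y x \<rho>) \<in> borel_measurable borel"
  "(\<lambda>p. leg_kernel y (fst p) (snd p)) \<in> borel_measurable (borel \<Otimes>\<^sub>M borel)"
  unfolding leg_kernel_def leg_discr_def by measurable

lemma leg_kernel_nonneg: "0 \<le> leg_kernel y x \<rho>"
  by (simp add: leg_kernel_def)

lemma legendre_eq_kernel:
  assumes b [measurable]: "b \<in> borel_measurable borel" and b0: "\<And>\<rho>. 0 \<le> b \<rho>"
    and x: "-1 < x" "x < 1" and y: "-1 < y" "y < 1"
  shows "legendre b y x = (\<integral>\<^sup>+\<rho>. ennreal (b \<rho> * leg_kernel y x \<rho>) \<partial>lborel)"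
proof -
  define S where "S = sqrt (1 - x\<^sup>2) * sqrt (1 - y\<^sup>2)"
  have xy: "0 < 1 - x\<^sup>2" "0 < 1 - y\<^sup>2" using one_minus_square_pos x y by auto
  then have S: "S > 0" "S\<^sup>2 = (1 - x\<^sup>2) * (1 - y\<^sup>2)" by (auto simp: S_def power_mult_distrib)
  define g where "g \<phi> = x * y - cos \<phi> * S" for \<phi>
  have g: "trans_arg x y (cos \<phi>) = g \<phi>" for \<phi> by (simp add: trans_arg_def g_def S_def)
  have discr: "leg_discr y x \<rho> = S\<^sup>2 - (\<rho> - x * y)\<^sup>2" for \<rho>
    unfolding S(2) leg_discr_def by (simp add: power2_eq_square algebra_simps)
  have discr_g: "leg_discr y x (g \<phi>) = (S * sin \<phi>)\<^sup>2" for \<phi>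
    unfolding discr g_def by (simp add: power_mult_distrib sin_squared_eq) (simp add: algebra_simps)
  define f where "f \<rho> = b \<rho> * leg_kernel y x \<rho>" for \<rho>
  have f [measurable]: "f \<in> borel_measurable borel" unfolding f_def by measurable
  have ends: "g 0 = x * y - S" "g pi = x * y + S" by (simp_all add: g_def)
  have "(\<integral>\<^sup>+\<rho>. ennreal (f \<rho> * indicator {g 0..g pi} \<rho>) \<partial>lborel) = (\<integral>\<^sup>+\<phi>. ennreal (f (g \<phi>) * (S * sin \<phi>) * indicator {0..pi} \<phi>) \<partial>lborel)"
  proof (rule nn_integral_substitution)
    show "set_borel_measurable borel {g 0..g pi} f" unfolding set_borel_measurable_def by measurable
    show "(g has_real_derivative S * sin \<phi>) (at \<phi>)" for \<phi>
      unfolding g_def by (auto intro!: derivative_eq_intros)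
    show "continuous_on {0..pi} (\<lambda>\<phi>. S * sin \<phi>)" by (intro continuous_intros)
    show "0 \<le> S * sin \<phi>" if "\<phi> \<in> {0..pi}" for \<phi>
      using that S sin_ge_zero [of \<phi>] by simp
  qed simp
  also have "\<dots> = legendre b y x"
    unfolding legendre_def
  proof (rule nn_integral_cong_AE)
    have "AE \<phi> in lborel. \<phi> \<noteq> 0 \<and> \<phi> \<noteq> pi"
      using AE_lborel_singleton [of 0] AE_lborel_singleton [of pi] by eventually_elim auto
    then show "AE \<phi> in lborel. ennreal (f (g \<phi>) * (S * sin \<phi>) * indicator {0..pi} \<phi>) = ennreal (b (trans_arg x y (cos \<phi>)) * indicator {0<..<pi} \<phi>)"
    proof eventually_elim
      case (elim \<phi>)
      show ?case
      proof (cases "\<phi> \<in> {0<..<pi}")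
        case True
        then have "0 < S * sin \<phi>" using S sin_gt_zero [of \<phi>] by simp
        moreover have "g \<phi> \<in> {-1<..<1}" using trans_arg_interior(2) [of x y \<phi>] x y True by (simp add: g)
        ultimately have "leg_kernel y x (g \<phi>) = 1 / (S * sin \<phi>)"
          using x by (simp add: leg_kernel_def discr_g)
        moreover have "sin \<phi> \<noteq> 0" "S \<noteq> 0" using S True sin_gt_zero [of \<phi>] by auto
        ultimately show ?thesis using True by (simp add: f_def g)
      qed (use elim in auto)
    qed
  qed
  also have "(\<integral>\<^sup>+\<rho>. ennreal (f \<rho> * indicator {g 0..g pi} \<rho>) \<partial>lborel) = (\<integral>\<^sup>+\<rho>. ennreal (b \<rho> * leg_kernel y x \<rho>) \<partial>lborel)"
  proof (rule nn_integral_cong)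
    fix \<rho>
    have "leg_kernel y x \<rho> = 0" if "\<rho> \<notin> {g 0..g pi}"
    proof -
      have "S \<le> \<bar>\<rho> - x * y\<bar>" using that ends by auto
      then have "S\<^sup>2 \<le> (\<rho> - x * y)\<^sup>2" using power_mono [of S "\<bar>\<rho> - x * y\<bar>" 2] S(1) by simp
      then show ?thesis by (simp add: leg_kernel_def discr)
    qed
    then show "ennreal (f \<rho> * indicator {g 0..g pi} \<rho>) = ennreal (b \<rho> * leg_kernel y x \<rho>)"
      by (auto simp: f_def indicator_def)
  qed
  finally show ?thesis by simp
qed

lemma legendre_measurable [measurable]:
  assumes [measurable]: "b \<in> borel_measurable borel"
  shows "legendre b y \<in> borel_measurable borel"
proof -
  have "(\<lambda>p. ennreal (b (trans_arg (fst p) y (cos (snd p))) * indicator {0<..<pi} (snd p))) \<in> borel_measurable (borel \<Otimes>\<^sub>M lborel)"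
    by measurable
  then show ?thesis unfolding legendre_def [abs_def]
    by (subst measurable_cong [OF refl], intro lborel.borel_measurable_nn_integral) (simp add: case_prod_unfold)
qed

lemma legendre_symmetric:
  assumes a [measurable]: "a \<in> borel_measurable borel" and a0: "\<And>\<rho>. 0 \<le> a \<rho>"
    and b [measurable]: "b \<in> borel_measurable borel" and b0: "\<And>\<rho>. 0 \<le> b \<rho>"
    and y: "-1 < y" "y \<le> 1"
  shows "(\<integral>\<^sup>+x. ennreal (a x * indicator {-1<..<1} x) * legendre b y x \<partial>lborel)
       = (\<integral>\<^sup>+x. ennreal (b x * indicator {-1<..<1} x) * legendre a y x \<partial>lborel)"
proof (cases "y = 1")
  case True
  have "legendre b 1 x = ennreal (b x * pi)" if "\<And>\<rho>. 0 \<le> b \<rho>" for b x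
  proof -
    have "legendre b 1 x = (\<integral>\<^sup>+\<phi>. ennreal (b x) * indicator {0<..<pi} \<phi> \<partial>lborel)"
      unfolding legendre_def by (intro nn_integral_cong) (auto simp: trans_arg_def indicator_def)
    also have "\<dots> = ennreal (b x * pi)" using that by (simp add: nn_integral_cmult ennreal_mult)
    finally show ?thesis .
  qed
  then show ?thesis using a0 b0 unfolding True
    by (intro nn_integral_cong) (auto simp: indicator_def ennreal_mult [symmetric] mult_ac)
next
  case False
  with y have y: "-1 < y" "y < 1" by auto
  have *: "(\<integral>\<^sup>+x. ennreal (a x * indicator {-1<..<1} x) * legendre b y x \<partial>lborel)
      = (\<integral>\<^sup>+x. (\<integral>\<^sup>+\<rho>. ennreal (a x * b \<rho> * leg_kernel y x \<rho>) \<partial>lborel) \<partial>lborel)"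
    if [measurable]: "a \<in> borel_measurable borel" "b \<in> borel_measurable borel" and ab: "\<And>\<rho>. 0 \<le> a \<rho>" "\<And>\<rho>. 0 \<le> b \<rho>" for a b
  proof (rule nn_integral_cong)
    fix x
    show "ennreal (a x * indicator {-1<..<1} x) * legendre b y x = (\<integral>\<^sup>+\<rho>. ennreal (a x * b \<rho> * leg_kernel y x \<rho>) \<partial>lborel)"
    proof (cases "x \<in> {-1<..<1}")
      case True
      then have "legendre b y x = (\<integral>\<^sup>+\<rho>. ennreal (b \<rho> * leg_kernel y x \<rho>) \<partial>lborel)"
        using y ab by (intro legendre_eq_kernel) auto
      then show ?thesis using True ab leg_kernel_nonneg
        by (simp add: nn_integral_cmult [symmetric] ennreal_mult [symmetric] mult.assoc)
    next
      case False
      then have "leg_kernel y x \<rho> = 0" for \<rho> unfolding leg_kernel_def by metis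
      then show ?thesis using False by simp
    qed
  qed
  have "(\<integral>\<^sup>+x. (\<integral>\<^sup>+\<rho>. ennreal (a x * b \<rho> * leg_kernel y x \<rho>) \<partial>lborel) \<partial>lborel)
      = (\<integral>\<^sup>+\<rho>. (\<integral>\<^sup>+x. ennreal (a x * b \<rho> * leg_kernel y x \<rho>) \<partial>lborel) \<partial>lborel)"
    by (rule lborel_pair.Fubini' [symmetric]) (simp add: case_prod_unfold)
  then show ?thesis unfolding * [OF a b a0 b0] * [OF b a b0 a0]
    by (simp add: leg_kernel_sym [of y] mult_ac)
qed

lemma sin_powr_integral:
  assumes s: "0 \<le> s" "s < 1 / 2"
  obtains C where "0 < C" "(\<integral>\<^sup>+\<phi>. ennreal (sin \<phi> powr (- 2 * s) * indicator {0<..<pi} \<phi>) \<partial>lborel) \<le> ennreal C"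
proof -
  define a where "a = - 2 * s"
  have a: "a \<le> 0" "a > -1" using s by (auto simp: a_def)
  define h where "h \<phi> = (\<phi> / 2) powr a * indicator {0..pi} \<phi>" for \<phi> :: real
  have h [measurable]: "h \<in> borel_measurable borel" unfolding h_def by measurable
  obtain c where c: "(\<integral>\<^sup>+\<phi>. ennreal (h \<phi>) \<partial>lborel) = ennreal c" "0 \<le> c"
  proof -
    have "((\<lambda>x. x powr a) has_integral (pi powr (a + 1) / (a + 1))) {0..pi}"
      by (rule has_integral_powr_from_0 [OF a(2)]) simp
    from has_integral_mult_right [OF this, of "(1 / 2) powr a"]
    have I: "((\<lambda>x. (1 / 2) powr a * x powr a) has_integral ((1 / 2) powr a * (pi powr (a + 1) / (a + 1)))) {0..pi}" .
    have "(\<integral>\<^sup>+\<phi>. ennreal ((1 / 2) powr a * \<phi> powr a) * indicator {0..pi} \<phi> \<partial>lborel) = ennreal ((1 / 2) powr a * (pi powr (a + 1) / (a + 1)))"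
      by (rule nn_integral_has_integral_lebesgue' [OF _ I]) simp
    moreover have "ennreal ((1 / 2) powr a * \<phi> powr a) * indicator {0..pi} \<phi> = ennreal (h \<phi>)" for \<phi>
      by (auto simp: h_def indicator_def powr_mult [symmetric])
    ultimately show thesis using that [of "(1 / 2) powr a * (pi powr (a + 1) / (a + 1))"] a by simp
  qed
  have "(\<integral>\<^sup>+\<phi>. ennreal (sin \<phi> powr a * indicator {0<..<pi} \<phi>) \<partial>lborel) \<le> (\<integral>\<^sup>+\<phi>. ennreal (h \<phi>) + ennreal (h (pi - \<phi>)) \<partial>lborel)"
  proof (rule nn_integral_mono)
    fix \<phi> :: real
    show "ennreal (sin \<phi> powr a * indicator {0<..<pi} \<phi>) \<le> ennreal (h \<phi>) + ennreal (h (pi - \<phi>))"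
    proof (cases "\<phi> \<in> {0<..<pi}")
      case True
      have "sin \<phi> powr a \<le> h \<phi> + h (pi - \<phi>)"
      proof (cases "\<phi> \<le> pi / 2")
        case le: True
        have "\<phi> / 2 \<le> sin \<phi>" using sin_ge_half [of \<phi>] True le by auto
        then have "sin \<phi> powr a \<le> (\<phi> / 2) powr a" using True a by (intro powr_mono2') auto
        also have "\<dots> \<le> h \<phi> + h (pi - \<phi>)" using True by (simp add: h_def)
        finally show ?thesis .
      next
        case le: False
        have "(pi - \<phi>) / 2 \<le> sin (pi - \<phi>)" using sin_ge_half [of "pi - \<phi>"] True le by auto
        then have "sin \<phi> powr a \<le> ((pi - \<phi>) / 2) powr a" using True a by (intro powr_mono2') auto
        also have "\<dots> \<le> h \<phi> + h (pi - \<phi>)" using True by (simp add: h_def)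
        finally show ?thesis .
      qed
      then show ?thesis using True by (simp add: h_def ennreal_plus [symmetric] del: ennreal_plus)
    qed simp
  qed
  also have "\<dots> = (\<integral>\<^sup>+\<phi>. ennreal (h \<phi>) \<partial>lborel) + (\<integral>\<^sup>+\<phi>. ennreal (h (pi - \<phi>)) \<partial>lborel)"
    by (rule nn_integral_add) auto
  also have "(\<integral>\<^sup>+\<phi>. ennreal (h (pi - \<phi>)) \<partial>lborel) = (\<integral>\<^sup>+\<phi>. ennreal (h \<phi>) \<partial>lborel)"
    using nn_integral_real_affine [of "\<lambda>\<phi>. ennreal (h \<phi>)" "-1" pi] by simp
  also have "(\<integral>\<^sup>+\<phi>. ennreal (h \<phi>) \<partial>lborel) + (\<integral>\<^sup>+\<phi>. ennreal (h \<phi>) \<partial>lborel) \<le> ennreal (2 * c + 1)"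
    unfolding c(1) using c(2) by (simp add: ennreal_plus [symmetric] del: ennreal_plus)
  finally show thesis using that [of "2 * c + 1"] c(2) by (simp add: a_def)
qed

text \<open>By \<open>trans_gap\<close>, the weight at \<open>R\<close> is at most the weight at \<open>x\<close> times $(\sin\phi)^{-2s}$, which is
  integrable.\<close>

lemma legendre_weight:
  assumes s: "0 \<le> s" "s < 1 / 2"
  obtains C where "0 < C"
    "\<And>x y. -1 < x \<Longrightarrow> x < 1 \<Longrightarrow> -1 \<le> y \<Longrightarrow> y \<le> 1 \<Longrightarrow>
       legendre (\<lambda>R. (1 - R\<^sup>2) powr (- s)) y x \<le> ennreal (C * (1 - x\<^sup>2) powr (- s))"
proof -
  obtain C where C: "0 < C" "(\<integral>\<^sup>+\<phi>. ennreal (sin \<phi> powr (- 2 * s) * indicator {0<..<pi} \<phi>) \<partial>lborel) \<le> ennreal C"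
    using sin_powr_integral [OF s] .
  have "legendre (\<lambda>R. (1 - R\<^sup>2) powr (- s)) y x \<le> ennreal (C * (1 - x\<^sup>2) powr (- s))"
    if x: "-1 < x" "x < 1" and y: "-1 \<le> y" "y \<le> 1" for x y
  proof -
    have x0: "0 < 1 - x\<^sup>2" by (rule one_minus_square_pos [OF x])
    have "legendre (\<lambda>R. (1 - R\<^sup>2) powr (- s)) y x
      \<le> (\<integral>\<^sup>+\<phi>. ennreal ((1 - x\<^sup>2) powr (- s)) * ennreal (sin \<phi> powr (- 2 * s) * indicator {0<..<pi} \<phi>) \<partial>lborel)"
      unfolding legendre_def
    proof (rule nn_integral_mono)
      fix \<phi> :: real
      show "ennreal ((1 - (trans_arg x y (cos \<phi>))\<^sup>2) powr (- s) * indicator {0<..<pi} \<phi>)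
         \<le> ennreal ((1 - x\<^sup>2) powr (- s)) * ennreal (sin \<phi> powr (- 2 * s) * indicator {0<..<pi} \<phi>)"
      proof (cases "\<phi> \<in> {0<..<pi}")
        case True
        then have s0: "0 < sin \<phi>" by (intro sin_gt_zero) auto
        have "(1 - (trans_arg x y (cos \<phi>))\<^sup>2) powr (- s) \<le> ((1 - x\<^sup>2) * (sin \<phi>)\<^sup>2) powr (- s)"
          using x y x0 s s0 by (intro powr_mono2' trans_gap) auto
        also have "\<dots> = (1 - x\<^sup>2) powr (- s) * sin \<phi> powr (- 2 * s)"
        proof -
          have e: "(sin \<phi>)\<^sup>2 = sin \<phi> powr 2" using s0 by (simp add: powr_numeral)
          have "((1 - x\<^sup>2) * (sin \<phi>)\<^sup>2) powr (- s) = (1 - x\<^sup>2) powr (- s) * ((sin \<phi>)\<^sup>2) powr (- s)"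
            by (rule powr_mult)
          also have "((sin \<phi>)\<^sup>2) powr (- s) = sin \<phi> powr (- 2 * s)"
            unfolding e powr_powr by simp
          finally show ?thesis .
        qed
        finally show ?thesis using True by (simp add: ennreal_mult [symmetric] ennreal_leI)
      qed simp
    qed
    also have "\<dots> = ennreal ((1 - x\<^sup>2) powr (- s)) * (\<integral>\<^sup>+\<phi>. ennreal (sin \<phi> powr (- 2 * s) * indicator {0<..<pi} \<phi>) \<partial>lborel)"
      by (rule nn_integral_cmult) simp
    also have "\<dots> \<le> ennreal ((1 - x\<^sup>2) powr (- s)) * ennreal C"
      by (intro mult_left_mono C) simp
    also have "\<dots> = ennreal (C * (1 - x\<^sup>2) powr (- s))"
      using C by (simp add: ennreal_mult mult.commute)
    finally show ?thesis .
  qed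
  with C(1) show thesis using that by blast
qed

text \<open>Young's inequality \<open>u \<le> u powr q * a powr (1 - q) / q + (1 - 1 / q) * a\<close> is integrated; the value of \<open>a\<close>
  is the one for which the two bounds on the right balance.\<close>

lemma weighted_jensen:
  fixes u m :: "'a \<Rightarrow> real"
  assumes q: "1 \<le> q" and u: "\<And>x. 0 \<le> u x" and m: "\<And>x. 0 \<le> m x"
    and [measurable]: "u \<in> borel_measurable M" "m \<in> borel_measurable M"
    and W: "0 < W" "(\<integral>\<^sup>+x. ennreal (m x) \<partial>M) \<le> ennreal W"
    and J: "0 < J" "(\<integral>\<^sup>+x. ennreal (u x powr q * m x) \<partial>M) \<le> ennreal J"
  shows "(\<integral>\<^sup>+x. ennreal (u x * m x) \<partial>M) \<le> ennreal (J powr (1 / q) * W powr (1 - 1 / q))"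
proof -
  define a where "a = (J / W) powr (1 / q)"
  have a: "a > 0" using W J by (simp add: a_def)
  have aq: "a powr q = J / W" using W J q by (simp add: a_def powr_powr)
  define A B where "A = a / (q * a powr q)" and "B = (1 - 1 / q) * a"
  have AB: "0 \<le> A" "0 \<le> B" using a q by (auto simp: A_def B_def)
  have young: "u x \<le> A * u x powr q + B" for x
  proof (cases "u x = 0")
    case False
    define v where "v = u x / a"
    have v: "v > 0" using False u [of x] a by (simp add: v_def)
    have "(v powr q) powr (1 / q) * 1 powr (1 - 1 / q) \<le> 1 / q * v powr q + (1 - 1 / q) * 1"
      using q v by (intro Youngs_inequality_0) auto
    then have "v \<le> 1 / q * v powr q + (1 - 1 / q)" using q v by (simp add: powr_powr)
    then have "a * v \<le> a * (1 / q * v powr q + (1 - 1 / q))" using a by (intro mult_left_mono) auto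
    moreover have "v powr q = u x powr q / a powr q" using u [of x] a by (simp add: v_def powr_divide)
    ultimately show ?thesis using a by (simp add: v_def A_def B_def algebra_simps)
  qed (use AB in simp)
  have "(\<integral>\<^sup>+x. ennreal (u x * m x) \<partial>M) \<le> (\<integral>\<^sup>+x. ennreal A * ennreal (u x powr q * m x) + ennreal B * ennreal (m x) \<partial>M)"
  proof (rule nn_integral_mono)
    fix x
    have "u x * m x \<le> (A * u x powr q + B) * m x" using young m by (intro mult_right_mono)
    also have "\<dots> = A * (u x powr q * m x) + B * m x" by (simp add: algebra_simps)
    finally show "ennreal (u x * m x) \<le> ennreal A * ennreal (u x powr q * m x) + ennreal B * ennreal (m x)"
      using AB m [of x] by (simp add: ennreal_mult [symmetric] ennreal_plus [symmetric] ennreal_leI del: ennreal_plus)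
  qed
  also have "\<dots> = ennreal A * (\<integral>\<^sup>+x. ennreal (u x powr q * m x) \<partial>M) + ennreal B * (\<integral>\<^sup>+x. ennreal (m x) \<partial>M)"
    by (simp add: nn_integral_add nn_integral_cmult)
  also have "\<dots> \<le> ennreal A * ennreal J + ennreal B * ennreal W"
    by (intro add_mono mult_left_mono W J) auto
  also have "\<dots> = ennreal (A * J + B * W)"
    using AB W J by (simp add: ennreal_mult ennreal_plus)
  also have "A * J + B * W = a * W"
    using a W J q by (simp add: A_def B_def aq field_simps)
  also have "a * W = J powr (1 / q) * W powr (1 - 1 / q)"
    using W J by (simp add: a_def powr_divide powr_diff)
  finally show ?thesis .
qed


text \<open>By symmetry the Legendre translation of the indicator of a null set has integral 0. This is why the
  translation is well defined on classes of functions that agree almost everywhere.\<close>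

lemma legendre_null:
  assumes N: "N \<in> null_sets lborel" and y: "-1 < y" "y \<le> 1"
  shows "AE x in lborel. x \<in> {-1<..<1} \<longrightarrow> (AE \<phi> in lborel. \<phi> \<in> {0<..<pi} \<longrightarrow> trans_arg x y (cos \<phi>) \<notin> N)"
proof -
  have [measurable]: "N \<in> sets borel" using N by auto
  define b :: "real \<Rightarrow> real" where "b = indicator N"
  have [measurable]: "b \<in> borel_measurable borel" unfolding b_def by measurable
  have "(\<integral>\<^sup>+x. ennreal (1 * indicator {-1<..<1} x) * legendre b y x \<partial>lborel)
      = (\<integral>\<^sup>+x. ennreal (b x * indicator {-1<..<1} x) * legendre (\<lambda>_. 1) y x \<partial>lborel)"
    using y by (intro legendre_symmetric) (auto simp: b_def)
  also have "\<dots> = 0"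
  proof (subst nn_integral_0_iff_AE)
    have "AE x in lborel. x \<notin> N" using N by (rule AE_not_in)
    then show "AE x in lborel. ennreal (b x * indicator {-1<..<1} x) * legendre (\<lambda>_. 1) y x = 0"
      by eventually_elim (simp add: b_def)
  qed measurable
  finally have "AE x in lborel. ennreal (1 * indicator {-1<..<1} x) * legendre b y x = 0"
    by (subst (asm) nn_integral_0_iff_AE) measurable
  then show ?thesis
  proof eventually_elim
    case (elim x)
    show ?case
    proof
      assume "x \<in> {-1<..<1}"
      then have "legendre b y x = 0" using elim by simp
      then have "AE \<phi> in lborel. ennreal (b (trans_arg x y (cos \<phi>)) * indicator {0<..<pi} \<phi>) = 0"
        unfolding legendre_def by (subst (asm) nn_integral_0_iff_AE) measurable
      then show "AE \<phi> in lborel. \<phi> \<in> {0<..<pi} \<longrightarrow> trans_arg x y (cos \<phi>) \<notin> N"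
        by eventually_elim (auto simp: b_def indicator_def split: if_splits)
    qed
  qed
qed

text \<open>The translation without its normalising factor $\cos^{-4}(t/2)$.\<close>

definition raw_translation :: "real \<Rightarrow> (real \<Rightarrow> real) \<Rightarrow> real \<Rightarrow> real" where
  "raw_translation y f x = 1 / (pi * (1 - x\<^sup>2)) *
     (LINT \<phi>|lebesgue_on {0..pi}. trans_kernel y x (cos \<phi>) (trans_arg x y (cos \<phi>)) * f (trans_arg x y (cos \<phi>)))"

definition trans_integrable :: "real \<Rightarrow> (real \<Rightarrow> real) \<Rightarrow> real \<Rightarrow> bool" where
  "trans_integrable y f x \<longleftrightarrow> integrable (lebesgue_on {0..pi})
     (\<lambda>\<phi>. trans_kernel y x (cos \<phi>) (trans_arg x y (cos \<phi>)) * f (trans_arg x y (cos \<phi>)))"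

lemma gen_translation_raw: "gen_translation t f x = raw_translation (cos t) f x / cos (t / 2) ^ 4"
  by (simp add: gen_translation_def raw_translation_def)

lemma AE_lebesgue_on_interval:
  assumes "AE \<phi> in lborel. \<phi> \<in> {a<..<b} \<longrightarrow> P \<phi>"
  shows "AE \<phi> in lebesgue_on {a..b::real}. P \<phi>"
proof (subst AE_restrict_space_iff)
  have "AE \<phi> in lborel. \<phi> \<noteq> a \<and> \<phi> \<noteq> b"
    using AE_lborel_singleton [of a] AE_lborel_singleton [of b] by eventually_elim auto
  with assms have "AE \<phi> in lborel. \<phi> \<in> {a..b} \<longrightarrow> P \<phi>" by eventually_elim auto
  then show "AE \<phi> in lebesgue. \<phi> \<in> {a..b} \<longrightarrow> P \<phi>" by (simp add: AE_completion_iff)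
qed simp

lemma nn_integral_lebesgue_on_interval:
  "(\<integral>\<^sup>+\<phi>. f \<phi> \<partial>lebesgue_on {a..b::real}) = (\<integral>\<^sup>+\<phi>. f \<phi> * indicator {a<..<b} \<phi> \<partial>lborel)"
proof -
  have "(\<integral>\<^sup>+\<phi>. f \<phi> \<partial>lebesgue_on {a..b}) = (\<integral>\<^sup>+\<phi>. f \<phi> * indicator {a..b} \<phi> \<partial>lborel)"
    by (subst nn_integral_restrict_space) (simp_all add: nn_integral_completion)
  also have "\<dots> = (\<integral>\<^sup>+\<phi>. f \<phi> * indicator {a<..<b} \<phi> \<partial>lborel)"
  proof (rule nn_integral_cong_AE)
    show "AE \<phi> in lborel. f \<phi> * indicator {a..b} \<phi> = f \<phi> * indicator {a<..<b} \<phi>"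
      using AE_lborel_singleton [of a] AE_lborel_singleton [of b] by eventually_elim (auto simp: indicator_def)
  qed
  finally show ?thesis .
qed

lemma lebesgue_on_cong_AE:
  fixes f g :: "real \<Rightarrow> real"
  assumes eq: "AE x in lebesgue_on {a..b}. f x = g x" and g: "g \<in> borel_measurable (lebesgue_on {a..b})"
  shows "f \<in> borel_measurable (lebesgue_on {a..b})"
proof -
  have "AE x in lebesgue. x \<in> {a..b} \<longrightarrow> f x = g x"
    using eq by (subst (asm) AE_restrict_space_iff) auto
  then obtain N where N: "N \<in> null_sets lebesgue" "{x. \<not> (x \<in> {a..b} \<longrightarrow> f x = g x)} \<subseteq> N"
    unfolding eventually_ae_filter by auto
  have "g measurable_on {a..b}" using g by (simp add: measurable_on_iff_borel_measurable)
  moreover have "negligible N" using N(1) by (simp add: negligible_iff_null_sets)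
  ultimately have "f measurable_on {a..b}"
    by (rule measurable_on_spike) (use N(2) in auto)
  then show ?thesis by (simp add: measurable_on_iff_borel_measurable)
qed

lemma raw_translation_cong_interior:
  assumes eq: "\<And>R. R \<in> {-1<..<1} \<Longrightarrow> f R = g R" and x: "x \<in> {-1<..<1}" and y: "-1 \<le> y" "y \<le> 1"
    and g: "(\<lambda>\<phi>. trans_kernel y x (cos \<phi>) (trans_arg x y (cos \<phi>)) * g (trans_arg x y (cos \<phi>))) \<in> borel_measurable (lebesgue_on {0..pi})"
  shows "raw_translation y f x = raw_translation y g x" "trans_integrable y f x = trans_integrable y g x"
proof -
  let ?F = "\<lambda>f \<phi>. trans_kernel y x (cos \<phi>) (trans_arg x y (cos \<phi>)) * f (trans_arg x y (cos \<phi>))"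
  have AE: "AE \<phi> in lebesgue_on {0..pi}. ?F f \<phi> = ?F g \<phi>"
    using eq trans_arg_interior(2) [of x y] x y by (intro AE_lebesgue_on_interval) auto
  have f: "?F f \<in> borel_measurable (lebesgue_on {0..pi})" by (rule lebesgue_on_cong_AE [OF AE g])
  show "raw_translation y f x = raw_translation y g x"
    unfolding raw_translation_def by (simp only: integral_cong_AE [OF f g AE])
  show "trans_integrable y f x = trans_integrable y g x"
    unfolding trans_integrable_def by (rule integrable_cong_AE [OF f g AE])
qed

lemma trans_integrand_measurable:
  assumes [measurable]: "f \<in> borel_measurable borel"
  shows "(\<lambda>\<phi>. trans_kernel y x (cos \<phi>) (trans_arg x y (cos \<phi>)) * f (trans_arg x y (cos \<phi>))) \<in> borel_measurable (lebesgue_on {0..pi})"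
proof -
  have "(\<lambda>\<phi>. trans_kernel y x (cos \<phi>) (trans_arg x y (cos \<phi>)) * f (trans_arg x y (cos \<phi>))) \<in> borel_measurable borel"
    by measurable
  then show ?thesis by (intro measurable_restrict_space1 measurable_completion) simp
qed

lemma raw_translation_cong_AE:
  assumes f: "AE x in lborel. x \<in> {-1<..<1} \<longrightarrow> f x = g x"
    and g: "g \<in> borel_measurable borel" and y: "-1 < y" "y \<le> 1"
  shows "AE x in lborel. x \<in> {-1<..<1} \<longrightarrow> raw_translation y f x = raw_translation y g x \<and> trans_integrable y f x = trans_integrable y g x"
proof -
  obtain N where N: "N \<in> null_sets lborel" "{x. \<not> (x \<in> {-1<..<1} \<longrightarrow> f x = g x)} \<subseteq> N"
    using f unfolding eventually_ae_filter by auto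
  from legendre_null [OF N(1) y] show ?thesis
  proof eventually_elim
    case (elim x)
    show ?case
    proof
      assume x: "x \<in> {-1<..<1}"
      let ?F = "\<lambda>f \<phi>. trans_kernel y x (cos \<phi>) (trans_arg x y (cos \<phi>)) * f (trans_arg x y (cos \<phi>))"
      have "AE \<phi> in lborel. \<phi> \<in> {0<..<pi} \<longrightarrow> trans_arg x y (cos \<phi>) \<notin> N" using elim x by blast
      then have "AE \<phi> in lborel. \<phi> \<in> {0<..<pi} \<longrightarrow> ?F f \<phi> = ?F g \<phi>"
      proof eventually_elim
        case (elim \<phi>)
        show ?case
        proof
          assume "\<phi> \<in> {0<..<pi}"
          then have "trans_arg x y (cos \<phi>) \<in> {-1<..<1}" "trans_arg x y (cos \<phi>) \<notin> N"
            using elim x y trans_arg_interior(2) [of x y \<phi>] by auto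
          then show "?F f \<phi> = ?F g \<phi>" using N(2) by auto
        qed
      qed
      then have AE: "AE \<phi> in lebesgue_on {0..pi}. ?F f \<phi> = ?F g \<phi>" by (rule AE_lebesgue_on_interval)
      note gm = trans_integrand_measurable [OF g, of y x]
      have fm: "?F f \<in> borel_measurable (lebesgue_on {0..pi})" by (rule lebesgue_on_cong_AE [OF AE gm])
      show "raw_translation y f x = raw_translation y g x \<and> trans_integrable y f x = trans_integrable y g x"
        unfolding raw_translation_def trans_integrable_def
        using integral_cong_AE [OF fm gm AE] integrable_cong_AE [OF fm gm AE] by simp
    qed
  qed
qed

lemma raw_translation_legendre:
  assumes f: "f \<in> borel_measurable borel" and x: "x \<in> {-1<..<1}" and y: "-1 \<le> y" "y \<le> 1"
    and L: "legendre (\<lambda>R. \<bar>f R\<bar> * (1 - R\<^sup>2)) y x \<le> ennreal L" and L0: "0 \<le> L"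
  shows "trans_integrable y f x" "\<bar>raw_translation y f x\<bar> \<le> L / (1 - x\<^sup>2)"
proof -
  let ?F = "\<lambda>\<phi>. trans_kernel y x (cos \<phi>) (trans_arg x y (cos \<phi>)) * f (trans_arg x y (cos \<phi>))"
  note fm = trans_integrand_measurable [OF f, of y x]
  have "(\<integral>\<^sup>+\<phi>. ennreal (norm (?F \<phi>)) \<partial>lebesgue_on {0..pi}) = (\<integral>\<^sup>+\<phi>. ennreal (norm (?F \<phi>)) * indicator {0<..<pi} \<phi> \<partial>lborel)"
    by (rule nn_integral_lebesgue_on_interval)
  also have "\<dots> \<le> legendre (\<lambda>R. \<bar>f R\<bar> * (1 - R\<^sup>2)) y x"
    unfolding legendre_def
  proof (rule nn_integral_mono)
    fix \<phi> :: real
    have "norm (?F \<phi>) \<le> (1 - (trans_arg x y (cos \<phi>))\<^sup>2) * \<bar>f (trans_arg x y (cos \<phi>))\<bar>"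
      unfolding real_norm_def abs_mult using x y by (intro mult_right_mono trans_gap(2)) auto
    then show "ennreal (norm (?F \<phi>)) * indicator {0<..<pi} \<phi> \<le> ennreal (\<bar>f (trans_arg x y (cos \<phi>))\<bar> * (1 - (trans_arg x y (cos \<phi>))\<^sup>2) * indicator {0<..<pi} \<phi>)"
      by (auto simp: indicator_def mult.commute intro!: ennreal_leI)
  qed
  also note L
  finally have le: "(\<integral>\<^sup>+\<phi>. ennreal (norm (?F \<phi>)) \<partial>lebesgue_on {0..pi}) \<le> ennreal L" .
  then have int: "integrable (lebesgue_on {0..pi}) ?F"
    using fm by (intro integrableI_bounded) (auto intro: le_less_trans)
  then show "trans_integrable y f x" by (simp add: trans_integrable_def)
  have "ennreal (norm (integral\<^sup>L (lebesgue_on {0..pi}) ?F)) \<le> ennreal L"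
    by (rule order_trans [OF integral_norm_bound_ennreal [OF int] le])
  then have "norm (integral\<^sup>L (lebesgue_on {0..pi}) ?F) \<le> L" using L0 by simp
  moreover have "1 - x\<^sup>2 > 0" using one_minus_square_pos x by simp
  ultimately have "\<bar>raw_translation y f x\<bar> \<le> L / (pi * (1 - x\<^sup>2))"
    unfolding raw_translation_def by (simp add: abs_mult divide_right_mono)
  also have "\<dots> \<le> L / (1 - x\<^sup>2)"
    using L0 \<open>1 - x\<^sup>2 > 0\<close> pi_gt3 by (intro divide_left_mono) (auto simp: mult_le_cancel_right1)
  finally show "\<bar>raw_translation y f x\<bar> \<le> L / (1 - x\<^sup>2)" .
qed

text \<open>Schur's test. With \<open>m = (1 - R\<^sup>2) powr (- s)\<close> as the measure, Jensen's inequality produces the factor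
  \<open>(1 - x\<^sup>2) powr (- s * (q - 1))\<close>. What is left of the weight is \<open>(1 - x\<^sup>2) powr (- s')\<close>, which the adjoint, the
  same Legendre translation, preserves up to a constant.\<close>

lemma raw_translation_power_bound:
  assumes q: "1 \<le> q" and s: "0 \<le> s" "s < 1 / 2" and s': "0 \<le> s'" "s' < 1 / 2"
    and split: "(\<alpha> - 1) * q = s * (q - 1) - s'"
  obtains C where "0 < C"
    "\<And>f y. f \<in> borel_measurable borel \<Longrightarrow> -1 < y \<Longrightarrow> y \<le> 1 \<Longrightarrow>
       (\<integral>\<^sup>+x. ennreal ((\<bar>f x\<bar> * (1 - x\<^sup>2) powr \<alpha>) powr q * indicator {-1<..<1} x) \<partial>lborel) < \<infinity> \<Longrightarrow>
       (AE x in lborel. x \<in> {-1<..<1} \<longrightarrow> trans_integrable y f x) \<and>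
       (\<integral>\<^sup>+x. ennreal ((\<bar>raw_translation y f x\<bar> * (1 - x\<^sup>2) powr \<alpha>) powr q * indicator {-1<..<1} x) \<partial>lborel)
       \<le> ennreal C * (\<integral>\<^sup>+x. ennreal ((\<bar>f x\<bar> * (1 - x\<^sup>2) powr \<alpha>) powr q * indicator {-1<..<1} x) \<partial>lborel)"
proof -
  obtain C1 where C1: "0 < C1" "\<And>x y. -1 < x \<Longrightarrow> x < 1 \<Longrightarrow> -1 \<le> y \<Longrightarrow> y \<le> 1 \<Longrightarrow>
       legendre (\<lambda>R. (1 - R\<^sup>2) powr (- s)) y x \<le> ennreal (C1 * (1 - x\<^sup>2) powr (- s))"
    using legendre_weight [OF s] by metis
  obtain C2 where C2: "0 < C2" "\<And>x y. -1 < x \<Longrightarrow> x < 1 \<Longrightarrow> -1 \<le> y \<Longrightarrow> y \<le> 1 \<Longrightarrow>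
       legendre (\<lambda>R. (1 - R\<^sup>2) powr (- s')) y x \<le> ennreal (C2 * (1 - x\<^sup>2) powr (- s'))"
    using legendre_weight [OF s'] by metis
  define C where "C = C1 powr (q - 1) * C2"
  have C: "C > 0" using C1 C2 by (simp add: C_def)
  have main: "(AE x in lborel. x \<in> {-1<..<1} \<longrightarrow> trans_integrable y f x) \<and>
       (\<integral>\<^sup>+x. ennreal ((\<bar>raw_translation y f x\<bar> * (1 - x\<^sup>2) powr \<alpha>) powr q * indicator {-1<..<1} x) \<partial>lborel)
       \<le> ennreal C * (\<integral>\<^sup>+x. ennreal ((\<bar>f x\<bar> * (1 - x\<^sup>2) powr \<alpha>) powr q * indicator {-1<..<1} x) \<partial>lborel)"
    if f [measurable]: "f \<in> borel_measurable borel" and y: "-1 < y" "y \<le> 1"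
      and fin: "(\<integral>\<^sup>+x. ennreal ((\<bar>f x\<bar> * (1 - x\<^sup>2) powr \<alpha>) powr q * indicator {-1<..<1} x) \<partial>lborel) < \<infinity>" for f y
  proof -
    define w where "w R = 1 - R\<^sup>2" for R :: real
    have w0: "0 < w x" if "x \<in> {-1<..<1}" for x using one_minus_square_pos that by (simp add: w_def)
    have [measurable]: "w \<in> borel_measurable borel" unfolding w_def by measurable
    define u where "u R = \<bar>f R\<bar> * \<bar>w R\<bar> powr (1 + s)" for R
    define G where "G R = u R powr q * w R powr (- s)" for R
    have [measurable]: "u \<in> borel_measurable borel" "G \<in> borel_measurable borel" unfolding u_def G_def by measurable
    have G0: "0 \<le> G R" for R by (simp add: G_def)
    have Gw: "G x * w x powr (- s') = (\<bar>f x\<bar> * w x powr \<alpha>) powr q" if "x \<in> {-1<..<1}" for x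
    proof -
      have "(1 + s) * q + - s + - s' = \<alpha> * q" using split by (simp add: algebra_simps)
      then show ?thesis using w0 [OF that]
        by (simp add: G_def u_def powr_mult powr_powr mult.assoc flip: powr_add)
    qed
    have sym: "(\<integral>\<^sup>+x. ennreal (w x powr (- s') * indicator {-1<..<1} x) * legendre G y x \<partial>lborel)
        \<le> ennreal C2 * (\<integral>\<^sup>+x. ennreal ((\<bar>f x\<bar> * w x powr \<alpha>) powr q * indicator {-1<..<1} x) \<partial>lborel)"
    proof -
      have "(\<integral>\<^sup>+x. ennreal (w x powr (- s') * indicator {-1<..<1} x) * legendre G y x \<partial>lborel)
        = (\<integral>\<^sup>+x. ennreal (G x * indicator {-1<..<1} x) * legendre (\<lambda>x. w x powr (- s')) y x \<partial>lborel)"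
        using y G0 by (intro legendre_symmetric) auto
      also have "\<dots> \<le> (\<integral>\<^sup>+x. ennreal C2 * ennreal ((\<bar>f x\<bar> * w x powr \<alpha>) powr q * indicator {-1<..<1} x) \<partial>lborel)"
      proof (rule nn_integral_mono)
        fix x
        show "ennreal (G x * indicator {-1<..<1} x) * legendre (\<lambda>x. w x powr (- s')) y x \<le> ennreal C2 * ennreal ((\<bar>f x\<bar> * w x powr \<alpha>) powr q * indicator {-1<..<1} x)"
        proof (cases "x \<in> {-1<..<1}")
          case True
          have "ennreal (G x) * legendre (\<lambda>x. w x powr (- s')) y x \<le> ennreal (G x) * ennreal (C2 * w x powr (- s'))"
            unfolding w_def using C2(2) [of x y] True y by (intro mult_left_mono) auto
          also have "\<dots> = ennreal C2 * ennreal ((\<bar>f x\<bar> * w x powr \<alpha>) powr q)"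
            using C2(1) G0 unfolding Gw [OF True, symmetric] by (simp add: ennreal_mult [symmetric] mult_ac)
          finally show ?thesis using True by simp
        qed simp
      qed
      also have "\<dots> = ennreal C2 * (\<integral>\<^sup>+x. ennreal ((\<bar>f x\<bar> * w x powr \<alpha>) powr q * indicator {-1<..<1} x) \<partial>lborel)"
        by (rule nn_integral_cmult) measurable
      finally show ?thesis .
    qed
    also have "\<dots> < \<infinity>" using fin by (simp add: w_def ennreal_mult_less_top)
    finally have "AE x in lborel. ennreal (w x powr (- s') * indicator {-1<..<1} x) * legendre G y x \<noteq> \<infinity>"
      by (intro nn_integral_PInf_AE) (auto simp: less_top)
    then have AEfin: "AE x in lborel. x \<in> {-1<..<1} \<longrightarrow> legendre G y x < \<infinity>"
    proof eventually_elim
      case (elim x)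
      show ?case
      proof
        assume x: "x \<in> {-1<..<1}"
        then have "0 < w x powr (- s')" using w0 [OF x] by simp
        then show "legendre G y x < \<infinity>" using elim x w0 [OF x]
          by (auto simp: ennreal_mult_eq_top_iff less_top)
      qed
    qed
    have key: "trans_integrable y f x \<and> (\<bar>raw_translation y f x\<bar> * w x powr \<alpha>) powr q \<le> C1 powr (q - 1) * w x powr (- s') * J"
      if x: "x \<in> {-1<..<1}" and J: "0 < J" "legendre G y x \<le> ennreal J" for x J
    proof -
      define L where "L = J powr (1 / q) * (C1 * w x powr (- s)) powr (1 - 1 / q)"
      have L0: "0 \<le> L" by (simp add: L_def)
      have "legendre (\<lambda>R. \<bar>f R\<bar> * (1 - R\<^sup>2)) y x
        = (\<integral>\<^sup>+\<phi>. ennreal (u (trans_arg x y (cos \<phi>)) * (w (trans_arg x y (cos \<phi>)) powr (- s) * indicator {0<..<pi} \<phi>)) \<partial>lborel)"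
        unfolding legendre_def
      proof (rule nn_integral_cong)
        fix \<phi> :: real
        have "\<bar>f R\<bar> * (1 - R\<^sup>2) = u R * w R powr (- s)" if "0 < w R" for R
        proof -
          have "w R powr (1 + s) * w R powr (- s) = w R" using that by (simp flip: powr_add)
          then show ?thesis using that by (simp add: u_def w_def mult.assoc)
        qed
        moreover have "0 < w (trans_arg x y (cos \<phi>))" if "\<phi> \<in> {0<..<pi}"
          unfolding w_def using that x y by (intro trans_arg_interior(1)) auto
        ultimately show "ennreal (\<bar>f (trans_arg x y (cos \<phi>))\<bar> * (1 - (trans_arg x y (cos \<phi>))\<^sup>2) * indicator {0<..<pi} \<phi>)
          = ennreal (u (trans_arg x y (cos \<phi>)) * (w (trans_arg x y (cos \<phi>)) powr (- s) * indicator {0<..<pi} \<phi>))"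
          by (cases "\<phi> \<in> {0<..<pi}") auto
      qed
      also have "\<dots> \<le> ennreal L"
        unfolding L_def
      proof (rule weighted_jensen [OF q])
        show "0 < C1 * w x powr (- s)" using C1 w0 [OF x] by simp
        show "(\<integral>\<^sup>+\<phi>. ennreal (w (trans_arg x y (cos \<phi>)) powr (- s) * indicator {0<..<pi} \<phi>) \<partial>lborel) \<le> ennreal (C1 * w x powr (- s))"
          using C1(2) [of x y] x y by (simp add: legendre_def w_def)
        show "(\<integral>\<^sup>+\<phi>. ennreal (u (trans_arg x y (cos \<phi>)) powr q * (w (trans_arg x y (cos \<phi>)) powr (- s) * indicator {0<..<pi} \<phi>)) \<partial>lborel) \<le> ennreal J"
          using J(2) by (simp add: legendre_def G_def mult.assoc)
      qed (use J in \<open>auto simp: u_def\<close>)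
      finally have Lle: "legendre (\<lambda>R. \<bar>f R\<bar> * (1 - R\<^sup>2)) y x \<le> ennreal L" .
      have y': "-1 \<le> y" "y \<le> 1" using y by auto
      note rt = raw_translation_legendre [OF f x y' Lle L0]
      have "\<bar>raw_translation y f x\<bar> * w x powr \<alpha> \<le> L / w x * w x powr \<alpha>"
        using rt(2) by (intro mult_right_mono) (auto simp: w_def)
      also have "\<dots> = L * w x powr (\<alpha> - 1)"
        using w0 [OF x] by (simp add: powr_diff)
      finally have "(\<bar>raw_translation y f x\<bar> * w x powr \<alpha>) powr q \<le> (L * w x powr (\<alpha> - 1)) powr q"
        using q by (intro powr_mono2) auto
      also have "\<dots> = C1 powr (q - 1) * w x powr (- s') * J"
      proof -
        have 1: "(1 - 1 / q) * q = q - 1" using q by (simp add: field_simps)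
        have 2: "- s * (q - 1) + (\<alpha> - 1) * q = - s'" using split by (simp add: algebra_simps)
        have "(L * w x powr (\<alpha> - 1)) powr q = L powr q * w x powr ((\<alpha> - 1) * q)"
          using L0 by (simp add: powr_mult powr_powr)
        also have "L powr q = J * (C1 * w x powr (- s)) powr (q - 1)"
        proof -
          have "(J powr (1 / q) * X powr (1 - 1 / q)) powr q = J powr (1 / q * q) * X powr ((1 - 1 / q) * q)" for X
            by (simp only: powr_mult powr_powr)
          then show ?thesis unfolding L_def 1 using J(1) q by simp
        qed
        also have "(C1 * w x powr (- s)) powr (q - 1) = C1 powr (q - 1) * w x powr (- s * (q - 1))"
          using C1(1) by (simp add: powr_mult powr_powr)
        finally have "(L * w x powr (\<alpha> - 1)) powr q = C1 powr (q - 1) * (w x powr (- s * (q - 1)) * w x powr ((\<alpha> - 1) * q)) * J"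
          by (simp add: mult_ac)
        then show ?thesis unfolding powr_add [symmetric] 2 .
      qed
      finally show ?thesis using rt(1) by blast
    qed
    show ?thesis
    proof
      show "AE x in lborel. x \<in> {-1<..<1} \<longrightarrow> trans_integrable y f x"
        using AEfin
      proof eventually_elim
        case (elim x)
        show ?case
        proof
          assume x: "x \<in> {-1<..<1}"
          define J where "J = enn2real (legendre G y x) + 1"
          have "legendre G y x \<le> ennreal J"
            using elim x by (simp add: J_def ennreal_plus less_top)
          then show "trans_integrable y f x" using key [OF x, of J] by (simp add: J_def add_nonneg_pos)
        qed
      qed
      have "(\<integral>\<^sup>+x. ennreal ((\<bar>raw_translation y f x\<bar> * (1 - x\<^sup>2) powr \<alpha>) powr q * indicator {-1<..<1} x) \<partial>lborel)
        \<le> (\<integral>\<^sup>+x. ennreal (C1 powr (q - 1)) * (ennreal (w x powr (- s') * indicator {-1<..<1} x) * legendre G y x) \<partial>lborel)"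
      proof (rule nn_integral_mono_AE, use AEfin in eventually_elim)
        case (elim x)
        show ?case
        proof (cases "x \<in> {-1<..<1}")
          case x: True
          define I where "I = enn2real (legendre G y x)"
          have I: "legendre G y x = ennreal I" "0 \<le> I" using elim x by (auto simp: I_def less_top)
          have le: "(\<bar>raw_translation y f x\<bar> * w x powr \<alpha>) powr q \<le> C1 powr (q - 1) * w x powr (- s') * I"
          proof (rule field_le_epsilon)
            fix e :: real assume e: "e > 0"
            define B where "B = C1 powr (q - 1) * w x powr (- s')"
            have B: "B > 0" using C1 w0 [OF x] by (simp add: B_def)
            have "(\<bar>raw_translation y f x\<bar> * w x powr \<alpha>) powr q \<le> B * (I + e / B)"
              unfolding B_def using key [OF x, of "I + e / B"] I e B
              by (auto simp: B_def ennreal_leI add_nonneg_pos)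
            also have "\<dots> = B * I + e" using B by (simp add: field_simps)
            finally show "(\<bar>raw_translation y f x\<bar> * w x powr \<alpha>) powr q \<le> C1 powr (q - 1) * w x powr (- s') * I + e"
              by (simp add: B_def)
          qed
          have "ennreal ((\<bar>raw_translation y f x\<bar> * w x powr \<alpha>) powr q) \<le> ennreal (C1 powr (q - 1) * w x powr (- s') * I)"
            by (rule ennreal_leI [OF le])
          then show ?thesis using x I by (simp add: w_def [symmetric] ennreal_mult mult.assoc)
        qed simp
      qed
      also have "\<dots> = ennreal (C1 powr (q - 1)) * (\<integral>\<^sup>+x. ennreal (w x powr (- s') * indicator {-1<..<1} x) * legendre G y x \<partial>lborel)"
        by (rule nn_integral_cmult) measurable
      also have "\<dots> \<le> ennreal (C1 powr (q - 1)) * (ennreal C2 * (\<integral>\<^sup>+x. ennreal ((\<bar>f x\<bar> * w x powr \<alpha>) powr q * indicator {-1<..<1} x) \<partial>lborel))"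
        by (intro mult_left_mono sym) simp
      also have "\<dots> = ennreal C * (\<integral>\<^sup>+x. ennreal ((\<bar>f x\<bar> * w x powr \<alpha>) powr q * indicator {-1<..<1} x) \<partial>lborel)"
        using C1(1) C2(1) by (simp add: C_def ennreal_mult mult.assoc)
      finally show "(\<integral>\<^sup>+x. ennreal ((\<bar>raw_translation y f x\<bar> * (1 - x\<^sup>2) powr \<alpha>) powr q * indicator {-1<..<1} x) \<partial>lborel)
        \<le> ennreal C * (\<integral>\<^sup>+x. ennreal ((\<bar>f x\<bar> * (1 - x\<^sup>2) powr \<alpha>) powr q * indicator {-1<..<1} x) \<partial>lborel)"
        by (simp add: w_def)
    qed
  qed
  from that [OF C main] show thesis .
qed


section \<open>The weighted norms\<close>

definition wpow :: "real \<Rightarrow> real \<Rightarrow> (real \<Rightarrow> real) \<Rightarrow> ennreal" where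
  "wpow q \<alpha> f = (\<integral>\<^sup>+x. ennreal (\<bar>weighted \<alpha> f x\<bar> powr q) \<partial>lebesgue_on {-1..1})"

lemma Lpw_space_finite:
  assumes p: "p \<noteq> \<infinity>"
  shows "f \<in> Lpw_space p \<alpha> \<longleftrightarrow> weighted \<alpha> f \<in> borel_measurable (lebesgue_on {-1..1}) \<and> wpow (enn2real p) \<alpha> f < \<infinity>"
proof -
  have "integrable (lebesgue_on {-1..1}) (\<lambda>x. \<bar>weighted \<alpha> f x\<bar> powr enn2real p) \<longleftrightarrow> wpow (enn2real p) \<alpha> f < \<infinity>"
    if [measurable]: "weighted \<alpha> f \<in> borel_measurable (lebesgue_on {-1..1})"
    unfolding wpow_def by (subst integrable_iff_bounded) simp
  then show ?thesis using p by (auto simp: Lpw_space_def Lp_space_def)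
qed

lemma Lpw_norm_finite:
  assumes p: "p \<noteq> \<infinity>" and f: "f \<in> Lpw_space p \<alpha>"
  shows "Lpw_norm p \<alpha> f = ennreal (enn2real (wpow (enn2real p) \<alpha> f) powr (1 / enn2real p))"
proof -
  have [measurable]: "weighted \<alpha> f \<in> borel_measurable (lebesgue_on {-1..1})" using f p Lpw_space_finite by blast
  have "(LINT x|lebesgue_on {-1..1}. \<bar>weighted \<alpha> f x\<bar> powr enn2real p) = enn2real (wpow (enn2real p) \<alpha> f)"
    unfolding wpow_def by (rule integral_eq_nn_integral) auto
  moreover have "weighted \<alpha> f \<in> Lp_space p" using f by (simp add: Lpw_space_def)
  ultimately show ?thesis using p by (simp add: Lpw_norm_def Lp_norm_def)
qed

lemma Lpw_norm_space: "Lpw_norm p \<alpha> f < \<infinity> \<longleftrightarrow> f \<in> Lpw_space p \<alpha>"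
  by (auto simp: Lpw_norm_def Lp_norm_def Lpw_space_def)

lemma Lpw_norm_le_finite:
  assumes p: "p \<noteq> \<infinity>" "1 \<le> enn2real p" and M: "0 \<le> M"
  shows "Lpw_norm p \<alpha> f \<le> ennreal M \<longleftrightarrow>
    weighted \<alpha> f \<in> borel_measurable (lebesgue_on {-1..1}) \<and> wpow (enn2real p) \<alpha> f \<le> ennreal (M powr enn2real p)"
proof (cases "f \<in> Lpw_space p \<alpha>")
  case True
  define q where "q = enn2real p"
  define I where "I = enn2real (wpow q \<alpha> f)"
  have q: "q \<ge> 1" using p by (simp add: q_def)
  have ms: "weighted \<alpha> f \<in> borel_measurable (lebesgue_on {-1..1})" and I: "wpow q \<alpha> f = ennreal I" "0 \<le> I"
    using True Lpw_space_finite [OF p(1)] by (auto simp: I_def q_def less_top)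
  have "I powr (1 / q) \<le> M \<longleftrightarrow> I \<le> M powr q"
  proof
    assume "I powr (1 / q) \<le> M"
    then have "(I powr (1 / q)) powr q \<le> M powr q" using q by (intro powr_mono2) auto
    then show "I \<le> M powr q" using I q by (simp add: powr_powr)
  next
    assume "I \<le> M powr q"
    then have "I powr (1 / q) \<le> (M powr q) powr (1 / q)" using I q by (intro powr_mono2) auto
    then show "I powr (1 / q) \<le> M" using M q by (simp add: powr_powr)
  qed
  then show ?thesis
    using ms I M unfolding Lpw_norm_finite [OF p(1) True] q_def [symmetric] I_def [symmetric]
    by (simp add: ennreal_le_iff)
next
  case False
  then have "Lpw_norm p \<alpha> f = \<infinity>" by (simp add: Lpw_norm_def Lp_norm_def Lpw_space_def)
  moreover have "\<not> (weighted \<alpha> f \<in> borel_measurable (lebesgue_on {-1..1}) \<and> wpow (enn2real p) \<alpha> f < \<infinity>)"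
    using False Lpw_space_finite [OF p(1)] by blast
  ultimately show ?thesis by (auto simp: top_unique intro: le_less_trans)
qed

lemma weighted_ends: "weighted \<alpha> f 1 = 0" "weighted \<alpha> f (- 1) = 0"
  by (simp_all add: weighted_def)

lemma Lpw_norm_le_inf:
  assumes M: "0 \<le> M"
  shows "Lpw_norm \<infinity> \<alpha> f \<le> ennreal M \<longleftrightarrow>
    continuous_on {-1..1} (weighted \<alpha> f) \<and> (\<forall>x\<in>{-1..1}. \<bar>weighted \<alpha> f x\<bar> \<le> M)"
proof (cases "continuous_on {-1..1} (weighted \<alpha> f)")
  case True
  have "compact ((\<lambda>x. \<bar>weighted \<alpha> f x\<bar>) ` {-1..1})"
    using True by (intro compact_continuous_image continuous_on_rabs) auto
  then have bdd: "bdd_above ((\<lambda>x. \<bar>weighted \<alpha> f x\<bar>) ` {-1..1})"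
    by (intro bounded_imp_bdd_above compact_imp_bounded)
  have "Lpw_norm \<infinity> \<alpha> f = ennreal (SUP x\<in>{-1..1}. \<bar>weighted \<alpha> f x\<bar>)"
    using True by (simp add: Lpw_norm_def Lp_norm_def Lp_space_def)
  moreover have "(SUP x\<in>{-1..1}. \<bar>weighted \<alpha> f x\<bar>) \<le> M \<longleftrightarrow> (\<forall>x\<in>{-1..1}. \<bar>weighted \<alpha> f x\<bar> \<le> M)"
    using bdd by (subst cSUP_le_iff) auto
  ultimately show ?thesis using True M by (simp add: ennreal_le_iff)
next
  case False
  then show ?thesis by (simp add: Lpw_norm_def Lp_norm_def Lp_space_def top_unique)
qed

lemma convex_powr_bound:
  fixes a b u v q :: real
  assumes q: "1 \<le> q" and ab: "0 < a" "0 < b"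
  shows "\<bar>u + v\<bar> powr q \<le> (a + b) powr q * (a / (a + b) * (\<bar>u\<bar> powr q / a powr q) + b / (a + b) * (\<bar>v\<bar> powr q / b powr q))"
proof -
  define X Y where "X = \<bar>u\<bar> / a" and "Y = \<bar>v\<bar> / b"
  have XY: "0 \<le> X" "0 \<le> Y" using ab by (auto simp: X_def Y_def)
  define s t where "s = a / (a + b)" and "t = b / (a + b)"
  have st: "0 \<le> s" "0 \<le> t" "s + t = 1" "s \<le> 1" "t \<le> 1"
    using ab by (auto simp: s_def t_def add_divide_distrib [symmetric])
  have le: "r powr q \<le> r" if "0 \<le> r" "r \<le> 1" for r :: real
  proof (cases "r = 0")
    case False
    then have "r powr q \<le> r powr 1" using that q by (intro powr_mono') auto
    then show ?thesis using that by simp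
  qed simp
  have conv: "(s * X + t * Y) powr q \<le> s * X powr q + t * Y powr q"
  proof (cases "X = 0 \<or> Y = 0")
    case True
    then show ?thesis
    proof
      assume "X = 0"
      then have "(s * X + t * Y) powr q = t powr q * Y powr q" by (simp add: powr_mult)
      also have "\<dots> \<le> t * Y powr q" using le [of t] st by (intro mult_right_mono) auto
      finally show ?thesis using st by (simp add: \<open>X = 0\<close>)
    next
      assume "Y = 0"
      then have "(s * X + t * Y) powr q = s powr q * X powr q" by (simp add: powr_mult)
      also have "\<dots> \<le> s * X powr q" using le [of s] st by (intro mult_right_mono) auto
      finally show ?thesis using st by (simp add: \<open>Y = 0\<close>)
    qed
  next
    case False
    then show ?thesis
      using convex_onD [OF powr_convex [OF q], of t X Y] st XY
      by (simp add: eq_diff_eq [THEN iffD2, OF st(3)])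
  qed
  have "\<bar>u + v\<bar> \<le> (a + b) * (s * X + t * Y)"
    using ab by (simp add: X_def Y_def s_def t_def distrib_left)
  then have "\<bar>u + v\<bar> powr q \<le> ((a + b) * (s * X + t * Y)) powr q" using q by (intro powr_mono2) auto
  also have "\<dots> = (a + b) powr q * (s * X + t * Y) powr q" by (rule powr_mult)
  also have "\<dots> \<le> (a + b) powr q * (s * X powr q + t * Y powr q)" by (intro mult_left_mono conv) auto
  finally show ?thesis using ab by (simp add: X_def Y_def s_def t_def powr_divide)
qed

lemma weighted_add: "weighted \<alpha> (\<lambda>x. f x + g x) = (\<lambda>x. weighted \<alpha> f x + weighted \<alpha> g x)"
  by (auto simp: weighted_def distrib_right)

lemma weighted_scale: "weighted \<alpha> (\<lambda>x. s * f x) = (\<lambda>x. s * weighted \<alpha> f x)"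
  by (auto simp: weighted_def)

text \<open>For finite \<open>p\<close> the triangle inequality is the convexity of the power, applied to the convex combination
  with weights \<open>a / (a + b)\<close> and \<open>b / (a + b)\<close>, where \<open>a\<close> and \<open>b\<close> are strict upper bounds of the two norms.\<close>

lemma Lpw_norm_triangle:
  assumes p: "1 \<le> p"
  shows "Lpw_norm p \<alpha> (\<lambda>x. f x + g x) \<le> Lpw_norm p \<alpha> f + Lpw_norm p \<alpha> g"
proof (cases "f \<in> Lpw_space p \<alpha> \<and> g \<in> Lpw_space p \<alpha>")
  case False
  then have "Lpw_norm p \<alpha> f + Lpw_norm p \<alpha> g = \<infinity>"
    by (auto simp: Lpw_norm_def Lp_norm_def Lpw_space_def)
  then show ?thesis by (simp only: infinity_ennreal_def top_greatest)
next
  case True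
  define A B where "A = enn2real (Lpw_norm p \<alpha> f)" and "B = enn2real (Lpw_norm p \<alpha> g)"
  have AB: "Lpw_norm p \<alpha> f = ennreal A" "Lpw_norm p \<alpha> g = ennreal B" "0 \<le> A" "0 \<le> B"
    using True Lpw_norm_space [of p \<alpha>] by (auto simp: A_def B_def less_top)
  show ?thesis
  proof (cases "p = \<infinity>")
    case inf: True
    have "continuous_on {-1..1} (weighted \<alpha> f) \<and> (\<forall>x\<in>{-1..1}. \<bar>weighted \<alpha> f x\<bar> \<le> A)"
      "continuous_on {-1..1} (weighted \<alpha> g) \<and> (\<forall>x\<in>{-1..1}. \<bar>weighted \<alpha> g x\<bar> \<le> B)"
      using AB Lpw_norm_le_inf [of A \<alpha> f] Lpw_norm_le_inf [of B \<alpha> g] unfolding inf by auto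
    then have "Lpw_norm \<infinity> \<alpha> (\<lambda>x. f x + g x) \<le> ennreal (A + B)"
      using AB unfolding Lpw_norm_le_inf [OF add_nonneg_nonneg [OF AB(3,4)]] weighted_add
      by (auto intro!: continuous_intros abs_triangle_ineq [THEN order_trans] add_mono)
    then have "Lpw_norm p \<alpha> (\<lambda>x. f x + g x) \<le> ennreal A + ennreal B" unfolding inf using AB(3,4) by simp
    then show ?thesis unfolding AB(1,2) .
  next
    case fin: False
    define q where "q = enn2real p"
    have q: "1 \<le> q" using p fin unfolding q_def
      by (metis enn2real_1 enn2real_mono ennreal_less_top infinity_ennreal_def less_top)
    have "Lpw_norm p \<alpha> (\<lambda>x. f x + g x) \<le> ennreal (A + B) + ennreal e" if e: "e > 0" for e
    proof -
      define a b where "a = A + e / 2" and "b = B + e / 2"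
      have ab: "0 < a" "0 < b" using AB e by (auto simp: a_def b_def)
      have "Lpw_norm p \<alpha> f \<le> ennreal a" "Lpw_norm p \<alpha> g \<le> ennreal b"
        unfolding AB a_def b_def using e by (auto intro!: ennreal_leI)
      then have [measurable]: "weighted \<alpha> f \<in> borel_measurable (lebesgue_on {-1..1})" "weighted \<alpha> g \<in> borel_measurable (lebesgue_on {-1..1})"
        and le: "wpow q \<alpha> f \<le> ennreal (a powr q)" "wpow q \<alpha> g \<le> ennreal (b powr q)"
        using Lpw_norm_le_finite [OF fin q [unfolded q_def]] ab by (auto simp: q_def)
      define c d where "c = (a + b) powr q * (a / (a + b)) / a powr q" and "d = (a + b) powr q * (b / (a + b)) / b powr q"
      have cd: "0 \<le> c" "0 \<le> d" using ab by (auto simp: c_def d_def)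
      have "wpow q \<alpha> (\<lambda>x. f x + g x) \<le> (\<integral>\<^sup>+x. ennreal c * ennreal (\<bar>weighted \<alpha> f x\<bar> powr q) + ennreal d * ennreal (\<bar>weighted \<alpha> g x\<bar> powr q) \<partial>lebesgue_on {-1..1})"
        unfolding wpow_def weighted_add
      proof (rule nn_integral_mono)
        fix x
        have "\<bar>weighted \<alpha> f x + weighted \<alpha> g x\<bar> powr q \<le> c * \<bar>weighted \<alpha> f x\<bar> powr q + d * \<bar>weighted \<alpha> g x\<bar> powr q"
          using convex_powr_bound [OF q ab, of "weighted \<alpha> f x" "weighted \<alpha> g x"] by (simp add: c_def d_def distrib_left)
        then show "ennreal (\<bar>weighted \<alpha> f x + weighted \<alpha> g x\<bar> powr q) \<le> ennreal c * ennreal (\<bar>weighted \<alpha> f x\<bar> powr q) + ennreal d * ennreal (\<bar>weighted \<alpha> g x\<bar> powr q)"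
          using cd by (simp add: ennreal_mult [symmetric] ennreal_plus [symmetric] ennreal_leI del: ennreal_plus)
      qed
      also have "\<dots> = ennreal c * wpow q \<alpha> f + ennreal d * wpow q \<alpha> g"
        unfolding wpow_def by (simp add: nn_integral_add nn_integral_cmult)
      also have "\<dots> \<le> ennreal c * ennreal (a powr q) + ennreal d * ennreal (b powr q)"
        by (intro add_mono mult_left_mono le) auto
      also have "\<dots> = ennreal (c * a powr q + d * b powr q)"
        using cd by (simp add: ennreal_mult ennreal_plus)
      also have "c * a powr q + d * b powr q = (a + b) powr q * (a / (a + b) + b / (a + b))"
        using ab by (simp add: c_def d_def distrib_left)
      also have "\<dots> = (a + b) powr q" using ab by (simp add: add_divide_distrib [symmetric])
      finally have "Lpw_norm p \<alpha> (\<lambda>x. f x + g x) \<le> ennreal (a + b)"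
        using ab Lpw_norm_le_finite [OF fin q [unfolded q_def], of "a + b"] by (auto simp: q_def weighted_add)
      also have "a + b = (A + B) + e" by (simp add: a_def b_def)
      finally show ?thesis using AB e by simp
    qed
    then have "Lpw_norm p \<alpha> (\<lambda>x. f x + g x) \<le> ennreal (A + B)"
      by (rule ennreal_le_epsilon)
    then show ?thesis unfolding AB(1,2) using AB(3,4) by simp
  qed
qed

lemma Lpw_norm_scale:
  assumes p: "1 \<le> p" and that: "f \<in> Lpw_space p \<alpha>"
  shows "Lpw_norm p \<alpha> (\<lambda>x. s * f x) = ennreal \<bar>s\<bar> * Lpw_norm p \<alpha> f"
proof -
  have le: "Lpw_norm p \<alpha> (\<lambda>x. s * f x) \<le> ennreal \<bar>s\<bar> * Lpw_norm p \<alpha> f" if f: "f \<in> Lpw_space p \<alpha>" for s f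
  proof -
    define A where "A = enn2real (Lpw_norm p \<alpha> f)"
    have A: "Lpw_norm p \<alpha> f = ennreal A" "0 \<le> A"
      using f Lpw_norm_space [of p \<alpha>] by (auto simp: A_def less_top)
    have "Lpw_norm p \<alpha> (\<lambda>x. s * f x) \<le> ennreal (\<bar>s\<bar> * A)"
    proof (cases "p = \<infinity>")
      case inf: True
      have "continuous_on {-1..1} (weighted \<alpha> f) \<and> (\<forall>x\<in>{-1..1}. \<bar>weighted \<alpha> f x\<bar> \<le> A)"
        using A Lpw_norm_le_inf [of A \<alpha> f] unfolding inf by auto
      then show ?thesis
        using A unfolding inf by (subst Lpw_norm_le_inf) (auto simp: weighted_scale abs_mult intro!: continuous_intros mult_left_mono)
    next
      case fin: False
      define q where "q = enn2real p"
      have q: "1 \<le> q" using p fin unfolding q_def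
        by (metis enn2real_1 enn2real_mono ennreal_less_top infinity_ennreal_def less_top)
      have [measurable]: "weighted \<alpha> f \<in> borel_measurable (lebesgue_on {-1..1})" and le: "wpow q \<alpha> f \<le> ennreal (A powr q)"
        using A Lpw_norm_le_finite [OF fin q [unfolded q_def], of A \<alpha> f] by (auto simp: q_def)
      have "wpow q \<alpha> (\<lambda>x. s * f x) = ennreal (\<bar>s\<bar> powr q) * wpow q \<alpha> f"
        unfolding wpow_def weighted_scale abs_mult powr_mult
        by (simp add: ennreal_mult nn_integral_cmult)
      also have "\<dots> \<le> ennreal (\<bar>s\<bar> powr q) * ennreal (A powr q)" by (intro mult_left_mono le) auto
      also have "\<dots> = ennreal ((\<bar>s\<bar> * A) powr q)" by (simp add: ennreal_mult powr_mult)
      finally show ?thesis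
        using A by (subst Lpw_norm_le_finite [OF fin q [unfolded q_def]]) (auto simp: q_def weighted_scale)
    qed
    then show ?thesis unfolding A using A by (simp add: ennreal_mult)
  qed
  show ?thesis
  proof (cases "s = 0")
    case True
    then show ?thesis using le [OF that, of 0] by simp
  next
    case False
    have "(\<lambda>x. s * f x) \<in> Lpw_space p \<alpha>"
      using le [OF that, of s] that Lpw_norm_space [of p \<alpha>]
      by (metis ennreal_less_top ennreal_mult_less_top infinity_ennreal_def le_less_trans)
    from le [OF this, of "1 / s"] have "Lpw_norm p \<alpha> f \<le> ennreal (1 / \<bar>s\<bar>) * Lpw_norm p \<alpha> (\<lambda>x. s * f x)"
      using False by simp
    then have "ennreal \<bar>s\<bar> * Lpw_norm p \<alpha> f \<le> ennreal \<bar>s\<bar> * (ennreal (1 / \<bar>s\<bar>) * Lpw_norm p \<alpha> (\<lambda>x. s * f x))"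
      by (intro mult_left_mono) auto
    also have "\<dots> = Lpw_norm p \<alpha> (\<lambda>x. s * f x)"
      using False by (simp add: mult.assoc [symmetric] ennreal_mult [symmetric])
    finally show ?thesis using le [OF that, of s] by (intro antisym)
  qed
qed

text \<open>Equality that the weighted norm cannot detect. For the uniform norm the weight removes the endpoints,
  where the translation divides by 0.\<close>

definition same :: "ennreal \<Rightarrow> (real \<Rightarrow> real) \<Rightarrow> (real \<Rightarrow> real) \<Rightarrow> bool" where
  "same p f g \<longleftrightarrow> (if p = \<infinity> then \<forall>x\<in>{-1<..<1}. f x = g x else AE x in lborel. x \<in> {-1<..<1} \<longrightarrow> f x = g x)"

lemma sameI: "(\<And>x. x \<in> {-1<..<1} \<Longrightarrow> f x = g x) \<Longrightarrow> same p f g"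
  by (simp add: same_def)

lemma same_sym: "same p f g \<Longrightarrow> same p g f"
  by (auto simp: same_def split: if_splits elim!: eventually_mono)

lemma same_trans: "same p f g \<Longrightarrow> same p g h \<Longrightarrow> same p f h"
  by (auto simp: same_def split: if_splits elim: eventually_elim2)

lemma same_diff: "same p f g \<Longrightarrow> same p f' g' \<Longrightarrow> same p (\<lambda>x. f x - f' x) (\<lambda>x. g x - g' x)"
  by (auto simp: same_def split: if_splits elim: eventually_elim2)

lemma same_cmult: "same p f g \<Longrightarrow> same p (\<lambda>x. c * f x) (\<lambda>x. c * g x)"
  by (auto simp: same_def split: if_splits elim!: eventually_mono)

lemma Lpw_norm_same:
  assumes p: "1 \<le> p" and fg: "same p f g"
  shows "Lpw_norm p \<alpha> f = Lpw_norm p \<alpha> g"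
proof -
  have "Lpw_norm p \<alpha> g \<le> Lpw_norm p \<alpha> f" if fg: "same p f g" for f g
  proof (cases "f \<in> Lpw_space p \<alpha>")
    case f: True
    define A where "A = enn2real (Lpw_norm p \<alpha> f)"
    have A: "Lpw_norm p \<alpha> f = ennreal A" "0 \<le> A"
      using f Lpw_norm_space [of p \<alpha>] by (auto simp: A_def less_top)
    show ?thesis
    proof (cases "p = \<infinity>")
      case inf: True
      have eq: "weighted \<alpha> g x = weighted \<alpha> f x" if "x \<in> {-1..1}" for x
      proof (cases "x = 1 \<or> x = -1")
        case False
        then show ?thesis using fg that inf by (simp add: same_def weighted_def)
      qed (auto simp: weighted_ends)
      have "continuous_on {-1..1} (weighted \<alpha> f) \<and> (\<forall>x\<in>{-1..1}. \<bar>weighted \<alpha> f x\<bar> \<le> A)"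
        using A Lpw_norm_le_inf [of A \<alpha> f] unfolding inf by auto
      then have "continuous_on {-1..1} (weighted \<alpha> g) \<and> (\<forall>x\<in>{-1..1}. \<bar>weighted \<alpha> g x\<bar> \<le> A)"
        using eq continuous_on_cong [of "{-1..1}" "{-1..1}" "weighted \<alpha> g" "weighted \<alpha> f"] by auto
      then have "Lpw_norm p \<alpha> g \<le> ennreal A" unfolding inf Lpw_norm_le_inf [OF A(2)] .
      then show ?thesis unfolding A(1) .
    next
      case fin: False
      define q where "q = enn2real p"
      have q: "1 \<le> q" using p fin unfolding q_def
        by (metis enn2real_1 enn2real_mono ennreal_less_top infinity_ennreal_def less_top)
      have f: "weighted \<alpha> f \<in> borel_measurable (lebesgue_on {-1..1})" and le: "wpow q \<alpha> f \<le> ennreal (A powr q)"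
        using A Lpw_norm_le_finite [OF fin q [unfolded q_def], of A \<alpha> f] by (auto simp: q_def)
      have "AE x in lborel. x \<in> {-1<..<1} \<longrightarrow> weighted \<alpha> g x = weighted \<alpha> f x"
        using fg fin unfolding same_def by (auto simp: weighted_def elim!: eventually_mono)
      then have AE: "AE x in lebesgue_on {-1..1}. weighted \<alpha> g x = weighted \<alpha> f x"
        by (rule AE_lebesgue_on_interval)
      have "wpow q \<alpha> g = wpow q \<alpha> f"
        unfolding wpow_def by (rule nn_integral_cong_AE) (use AE in eventually_elim, simp)
      then show ?thesis
        unfolding A using A(2) le lebesgue_on_cong_AE [OF AE f]
        by (subst Lpw_norm_le_finite [OF fin q [unfolded q_def]]) (auto simp: q_def)
    qed
  next
    case False
    then show ?thesis by (simp add: Lpw_norm_def Lp_norm_def Lpw_space_def)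
  qed
  from this [OF fg] this [OF same_sym [OF fg]] show ?thesis by (rule antisym [rotated])
qed


section \<open>Density of the polynomials\<close>

lemma enn2real_ge_1: "1 \<le> p \<Longrightarrow> p \<noteq> \<infinity> \<Longrightarrow> 1 \<le> enn2real p"
  by (metis enn2real_1 enn2real_mono infinity_ennreal_def less_top)

lemma weight_continuous: "0 < \<alpha> \<Longrightarrow> continuous_on {-1..1} (\<lambda>x. (1 - x\<^sup>2) powr \<alpha> :: real)"
  by (intro continuous_on_powr' continuous_intros) (auto simp: abs_square_le_1 abs_le_iff)

lemma weight_le_1: "0 < \<alpha> \<Longrightarrow> x \<in> {-1..1} \<Longrightarrow> (1 - x\<^sup>2) powr \<alpha> \<le> (1 :: real)"
  by (rule powr_le1) (auto simp: abs_square_le_1 abs_le_iff)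

lemma poly_in_Lpw_space:
  assumes p: "1 \<le> p" and \<alpha>: "0 < \<alpha>"
  shows "poly P \<in> Lpw_space p \<alpha>"
proof -
  have c: "continuous_on {-1..1} (weighted \<alpha> (poly P))"
    unfolding weighted_def using \<alpha> by (intro continuous_intros weight_continuous)
  show ?thesis
  proof (cases "p = \<infinity>")
    case False
    have q: "1 \<le> enn2real p" by (rule enn2real_ge_1 [OF p False])
    have "integrable (lebesgue_on {-1..1}) (\<lambda>x. \<bar>weighted \<alpha> (poly P) x\<bar> powr enn2real p)"
      using c q by (intro continuous_imp_integrable_real continuous_on_powr' continuous_intros) auto
    moreover have "weighted \<alpha> (poly P) \<in> borel_measurable (lebesgue_on {-1..1})"
      using continuous_imp_integrable_real [OF c] by simp
    ultimately show ?thesis using False by (simp add: Lpw_space_def Lp_space_def)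
  qed (use c in \<open>simp add: Lpw_space_def Lp_space_def\<close>)
qed

text \<open>For the uniform norm, \<open>f\<close> is cut off where its weighted value is small; what remains divided
  by the weight is continuous up to the endpoints.\<close>

lemma poly_dense_inf:
  assumes \<alpha>: "0 < \<alpha>" and F: "continuous_on {-1..1} F" and ends: "F 1 = 0" "F (- 1) = 0" and e: "e > (0 :: real)"
  obtains P where "\<And>x. x \<in> {-1..1} \<Longrightarrow> \<bar>F x - poly P x * (1 - x\<^sup>2) powr \<alpha>\<bar> \<le> e"
proof -
  define w where "w x = (1 - x\<^sup>2) powr \<alpha>" for x :: real
  have wc: "continuous_on {-1..1} w" unfolding w_def [abs_def] by (rule weight_continuous [OF \<alpha>])
  define S where "S = {x \<in> {-1..1}. e / 2 \<le> \<bar>F x\<bar>}"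
  have "compact S"
  proof -
    have "closed ({-1..1} \<inter> (\<lambda>x. \<bar>F x\<bar>) -` {e / 2..})"
      using F by (intro continuous_closed_preimage continuous_on_rabs) auto
    moreover have "S = {-1..1} \<inter> (\<lambda>x. \<bar>F x\<bar>) -` {e / 2..}" by (auto simp: S_def)
    ultimately show ?thesis by (simp add: compact_eq_bounded_closed bounded_Int)
  qed
  have "\<exists>c>0. \<forall>x\<in>S. c \<le> w x"
  proof (cases "S = {}")
    case False
    obtain x where x: "x \<in> S" "\<And>y. y \<in> S \<Longrightarrow> w x \<le> w y"
      using continuous_attains_inf [OF \<open>compact S\<close> False continuous_on_subset [OF wc]] S_def by blast
    have "x \<noteq> 1" "x \<noteq> - 1" using x(1) ends e by (auto simp: S_def)
    then have "0 < 1 - x\<^sup>2" using x(1) by (intro one_minus_square_pos) (auto simp: S_def)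
    then have "0 < w x" by (simp add: w_def)
    with x show ?thesis by blast
  qed (auto intro: exI [of _ 1])
  then obtain c where c: "c > 0" "\<And>x. x \<in> S \<Longrightarrow> c \<le> w x" by blast
  define G where "G x = (max (F x - e / 2) 0 + min (F x + e / 2) 0)" for x
  define h where "h x = G x / max (w x) c" for x
  have "continuous_on {-1..1} h"
    unfolding h_def [abs_def] G_def using F wc c(1) by (intro continuous_intros) (auto simp: max_def)
  then obtain g where g: "real_polynomial_function g" "\<And>x. x \<in> {-1..1} \<Longrightarrow> \<bar>h x - g x\<bar> < e / 2"
    using Stone_Weierstrass_real_polynomial_function [of "{-1..1}" h "e / 2"] e by auto
  obtain a n where an: "g = (\<lambda>x. \<Sum>i\<le>n. a i * x ^ i)" using real_polynomial_function_imp_sum [OF g(1)] by blast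
  define P where "P = (\<Sum>i\<le>n. monom (a i) i)"
  have P: "poly P x = g x" for x by (simp add: P_def an poly_sum poly_monom)
  have "\<bar>F x - poly P x * w x\<bar> \<le> e" if x: "x \<in> {-1..1}" for x
  proof -
    have w: "0 \<le> w x" "w x \<le> 1" using weight_le_1 [OF \<alpha> x] by (auto simp: w_def)
    have "\<bar>F x - G x\<bar> \<le> e / 2" using e by (auto simp: G_def max_def min_def)
    moreover have "G x = h x * w x"
    proof (cases "x \<in> S")
      case True
      then have "max (w x) c = w x" "w x > 0" using c less_le_trans [OF c(1) c(2)] by auto
      then show ?thesis by (simp add: h_def)
    next
      case False
      then have "G x = 0" using x by (auto simp: S_def G_def max_def min_def abs_if split: if_splits)
      then show ?thesis by (simp add: h_def)
    qed
    moreover have "\<bar>h x * w x - poly P x * w x\<bar> \<le> e / 2"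
    proof -
      have "\<bar>h x * w x - poly P x * w x\<bar> = \<bar>h x - g x\<bar> * w x"
        using w by (simp add: P left_diff_distrib [symmetric] abs_mult)
      also have "\<dots> \<le> e / 2 * 1" using g(2) [OF x] w e by (intro mult_mono) auto
      finally show ?thesis by simp
    qed
    ultimately show ?thesis by linarith
  qed
  then show thesis unfolding w_def by (rule that)
qed

lemma powr_dominated:
  fixes H :: "nat \<Rightarrow> real \<Rightarrow> real"
  assumes q: "1 \<le> q" and H: "\<And>n. H n \<in> borel_measurable (lebesgue_on {-1..1})"
    and D: "D \<in> borel_measurable (lebesgue_on {-1..1})" "(\<integral>\<^sup>+x. ennreal (D x powr q) \<partial>lebesgue_on {-1..1}) < \<infinity>"
    and le: "\<And>n x. x \<in> {-1..1} \<Longrightarrow> \<bar>H n x\<bar> \<le> D x"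
    and lim: "AE x in lebesgue_on {-1..1}. (\<lambda>n. H n x) \<longlonglongrightarrow> 0"
    and e: "e > (0 :: real)"
  obtains n where "(\<integral>\<^sup>+x. ennreal (\<bar>H n x\<bar> powr q) \<partial>lebesgue_on {-1..1}) \<le> ennreal e"
proof -
  have "(\<lambda>n. \<integral>\<^sup>+x. ennreal (\<bar>H n x\<bar> powr q) \<partial>lebesgue_on {-1..1}) \<longlonglongrightarrow> (\<integral>\<^sup>+x. 0 \<partial>lebesgue_on {-1..1::real})"
  proof (rule nn_integral_dominated_convergence)
    show "AE x in lebesgue_on {-1..1}. ennreal (\<bar>H n x\<bar> powr q) \<le> ennreal (D x powr q)" for n
      using le q by (intro AE_I2 ennreal_leI powr_mono2) auto
    show "AE x in lebesgue_on {-1..1}. (\<lambda>n. ennreal (\<bar>H n x\<bar> powr q)) \<longlonglongrightarrow> 0"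
      using lim
    proof eventually_elim
      case (elim x)
      have "(\<lambda>n. \<bar>H n x\<bar> powr q) \<longlonglongrightarrow> 0 powr q"
        using q elim by (intro tendsto_powr' tendsto_rabs_zero tendsto_const) auto
      then have "(\<lambda>n. ennreal (\<bar>H n x\<bar> powr q)) \<longlonglongrightarrow> ennreal (0 powr q)"
        by (intro tendsto_ennrealI)
      then show ?case by simp
    qed
  qed (use H D in auto)
  then have "(\<lambda>n. \<integral>\<^sup>+x. ennreal (\<bar>H n x\<bar> powr q) \<partial>lebesgue_on {-1..1}) \<longlonglongrightarrow> 0" by simp
  then have "\<forall>\<^sub>F n in sequentially. (\<integral>\<^sup>+x. ennreal (\<bar>H n x\<bar> powr q) \<partial>lebesgue_on {-1..1}) < ennreal e"
    using e by (intro order_tendstoD) auto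
  then obtain n where "(\<integral>\<^sup>+x. ennreal (\<bar>H n x\<bar> powr q) \<partial>lebesgue_on {-1..1}) < ennreal e"
    by (auto simp: eventually_sequentially)
  then show thesis using that by (auto intro: less_imp_le)
qed

text \<open>For finite \<open>p\<close>, a weighted function is truncated in size, replaced by a continuous function that
  vanishes at the endpoints, and then treated as in the uniform case.\<close>

lemma poly_dense:
  assumes p: "1 \<le> p" and \<alpha>: "0 < \<alpha>" and f: "f \<in> Lpw_space p \<alpha>" and e: "e > (0 :: real)"
  obtains P where "Lpw_norm p \<alpha> (\<lambda>x. f x - poly P x) \<le> ennreal e"
proof (cases "p = \<infinity>")
  case inf: True
  have "continuous_on {-1..1} (weighted \<alpha> f)" using f inf by (simp add: Lpw_space_def Lp_space_def)
  from poly_dense_inf [OF \<alpha> this weighted_ends e] obtain P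
    where P: "\<And>x. x \<in> {-1..1} \<Longrightarrow> \<bar>weighted \<alpha> f x - poly P x * (1 - x\<^sup>2) powr \<alpha>\<bar> \<le> e" by blast
  have "weighted \<alpha> (\<lambda>x. f x - poly P x) = (\<lambda>x. weighted \<alpha> f x - poly P x * (1 - x\<^sup>2) powr \<alpha>)"
    by (auto simp: weighted_def left_diff_distrib)
  then have "Lpw_norm \<infinity> \<alpha> (\<lambda>x. f x - poly P x) \<le> ennreal e"
    using P e \<open>continuous_on {-1..1} (weighted \<alpha> f)\<close> weight_continuous [OF \<alpha>]
    by (subst Lpw_norm_le_inf) (auto intro!: continuous_intros)
  then show thesis using that unfolding inf by blast
next
  case fin: False
  define q where "q = enn2real p"
  have q: "1 \<le> q" unfolding q_def by (rule enn2real_ge_1 [OF p fin])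
  define F where "F = weighted \<alpha> f"
  have F [measurable]: "F \<in> borel_measurable (lebesgue_on {-1..1})" and Ffin: "(\<integral>\<^sup>+x. ennreal (\<bar>F x\<bar> powr q) \<partial>lebesgue_on {-1..1}) < \<infinity>"
    using f Lpw_space_finite [OF fin] by (auto simp: F_def wpow_def q_def)
  define cl where "cl M x = max (- M) (min M x)" for M x :: real
  define \<epsilon> where "\<epsilon> = (e / 3) powr q"
  have \<epsilon>: "\<epsilon> > 0" using e by (simp add: \<epsilon>_def)
  have small: "Lpw_norm p \<alpha> h \<le> ennreal (e / 3)"
    if "weighted \<alpha> h \<in> borel_measurable (lebesgue_on {-1..1})"
      "(\<integral>\<^sup>+x. ennreal (\<bar>weighted \<alpha> h x\<bar> powr q) \<partial>lebesgue_on {-1..1}) \<le> ennreal \<epsilon>" for h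
    using that e q Lpw_norm_le_finite [OF fin, of "e / 3" \<alpha> h] by (simp add: q_def wpow_def \<epsilon>_def)
  obtain M where M: "(\<integral>\<^sup>+x. ennreal (\<bar>F x - cl (real M) (F x)\<bar> powr q) \<partial>lebesgue_on {-1..1}) \<le> ennreal \<epsilon>"
  proof (rule powr_dominated [OF q, of "\<lambda>M x. F x - cl (real M) (F x)" "\<lambda>x. \<bar>F x\<bar>"])
    show "(\<lambda>x. F x - cl (real M) (F x)) \<in> borel_measurable (lebesgue_on {-1..1})" for M
      unfolding cl_def by measurable
    show "AE x in lebesgue_on {-1..1}. (\<lambda>M. F x - cl (real M) (F x)) \<longlonglongrightarrow> 0"
    proof (rule AE_I2)
      fix x
      obtain K where K: "\<bar>F x\<bar> \<le> real K" using real_arch_simple by blast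
      have "\<forall>\<^sub>F M in sequentially. F x - cl (real M) (F x) = 0"
      proof (rule eventually_sequentiallyI [of K])
        fix M assume "K \<le> M"
        then have "\<bar>F x\<bar> \<le> real M" using K by linarith
        then show "F x - cl (real M) (F x) = 0" by (auto simp: cl_def max_def min_def)
      qed
      then show "(\<lambda>M. F x - cl (real M) (F x)) \<longlonglongrightarrow> 0" by (rule tendsto_eventually)
    qed
  qed (use Ffin \<epsilon> in \<open>auto simp: cl_def\<close>)
  define F' where "F' x = cl (real M) (F x)" for x
  have F' [measurable]: "F' \<in> borel_measurable (lebesgue_on {-1..1})" unfolding F'_def cl_def by measurable
  obtain N g where N: "negligible N" and gc: "\<And>n. continuous_on UNIV (g n)"
    and gl: "\<And>x. x \<notin> N \<Longrightarrow> (\<lambda>n. g n x) \<longlonglongrightarrow> (if x \<in> {-1..1} then F x else 0)"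
  proof -
    have "F measurable_on {-1..1}" using F by (simp add: measurable_on_iff_borel_measurable)
    then show thesis using that unfolding measurable_on_def by blast
  qed
  define H where "H n x = cl (real M) (g n x) * min 1 (real n * (1 - x\<^sup>2))" for n x
  have Hc: "continuous_on S (H n)" for n S
    unfolding H_def cl_def by (intro continuous_intros continuous_on_subset [OF gc]) auto
  have Hm [measurable]: "H n \<in> borel_measurable (lebesgue_on {-1..1})" for n
    using continuous_imp_integrable_real [OF Hc, of "-1" 1 n] by simp
  obtain n where n: "(\<integral>\<^sup>+x. ennreal (\<bar>F' x - H n x\<bar> powr q) \<partial>lebesgue_on {-1..1}) \<le> ennreal \<epsilon>"
  proof (rule powr_dominated [OF q, of "\<lambda>n x. F' x - H n x" "\<lambda>x. 2 * real M"])
    show "\<bar>F' x - H n x\<bar> \<le> 2 * real M" if "x \<in> {-1..1}" for n x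
    proof -
      have "x\<^sup>2 \<le> 1" using that by (simp add: abs_square_le_1 abs_le_iff)
      then have "0 \<le> real n * (1 - x\<^sup>2)" by simp
      then have "\<bar>min 1 (real n * (1 - x\<^sup>2))\<bar> \<le> 1" by (simp add: min_def)
      moreover have "\<bar>cl (real M) (g n x)\<bar> \<le> real M" by (auto simp: cl_def max_def min_def)
      ultimately have "\<bar>H n x\<bar> \<le> real M * 1" unfolding H_def abs_mult by (intro mult_mono) auto
      moreover have "\<bar>F' x\<bar> \<le> real M" by (auto simp: F'_def cl_def max_def min_def)
      ultimately show ?thesis by linarith
    qed
    have "AE x in lebesgue_on {-1..1}. x \<notin> N \<and> x \<noteq> 1 \<and> x \<noteq> - 1"
    proof (subst AE_restrict_space_iff)
      have "negligible (N \<union> {1, -1})" using N by (simp add: negligible_Un)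
      then have "N \<union> {1, -1} \<in> null_sets lebesgue" by (simp add: negligible_iff_null_sets)
      from AE_not_in [OF this] show "AE x in lebesgue. x \<in> {-1..1} \<longrightarrow> x \<notin> N \<and> x \<noteq> 1 \<and> x \<noteq> - 1"
        by eventually_elim auto
    qed simp
    moreover have "AE x in lebesgue_on {-1..1::real}. x \<in> {-1..1}"
      by (rule AE_I2) simp
    ultimately show "AE x in lebesgue_on {-1..1}. (\<lambda>n. F' x - H n x) \<longlonglongrightarrow> 0"
    proof eventually_elim
      case (elim x)
      then have w: "0 < 1 - x\<^sup>2" by (intro one_minus_square_pos) auto
      obtain K where K: "1 / (1 - x\<^sup>2) \<le> real K" using real_arch_simple by blast
      have "\<forall>\<^sub>F n in sequentially. min 1 (real n * (1 - x\<^sup>2)) = 1"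
      proof (rule eventually_sequentiallyI [of K])
        fix n assume "K \<le> n"
        then have "1 / (1 - x\<^sup>2) \<le> real n" using K by linarith
        then have "1 \<le> real n * (1 - x\<^sup>2)" using w by (simp add: field_simps)
        then show "min 1 (real n * (1 - x\<^sup>2)) = 1" by simp
      qed
      then have "(\<lambda>n. min 1 (real n * (1 - x\<^sup>2))) \<longlonglongrightarrow> 1" by (rule tendsto_eventually)
      moreover have "(\<lambda>n. cl (real M) (g n x)) \<longlonglongrightarrow> cl (real M) (F x)"
        unfolding cl_def using gl [of x] elim by (intro tendsto_intros) auto
      ultimately have "(\<lambda>n. H n x) \<longlonglongrightarrow> F' x * 1"
        unfolding H_def F'_def by (intro tendsto_mult)
      then show ?case using tendsto_diff [OF tendsto_const [of "F' x"]] by fastforce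
    qed
  qed (use \<epsilon> in \<open>auto intro!: integrable_const simp: emeasure_restrict_space ennreal_mult_less_top\<close>)
  have "e / 9 > 0" using e by simp
  from poly_dense_inf [OF \<alpha> Hc [of "{-1..1}" n] _ _ this] obtain P
    where P: "\<And>x. x \<in> {-1..1} \<Longrightarrow> \<bar>H n x - poly P x * (1 - x\<^sup>2) powr \<alpha>\<bar> \<le> e / 9"
    by (auto simp: H_def)
  define W where "W x = poly P x * (1 - x\<^sup>2) powr \<alpha>" for x
  have "continuous_on {-1..1} W" unfolding W_def by (intro continuous_intros weight_continuous [OF \<alpha>])
  then have W [measurable]: "W \<in> borel_measurable (lebesgue_on {-1..1})"
    using continuous_imp_integrable_real by blast
  have HW: "(\<integral>\<^sup>+x. ennreal (\<bar>H n x - W x\<bar> powr q) \<partial>lebesgue_on {-1..1}) \<le> ennreal \<epsilon>"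
  proof -
    have "(\<integral>\<^sup>+x. ennreal (\<bar>H n x - W x\<bar> powr q) \<partial>lebesgue_on {-1..1}) \<le> (\<integral>\<^sup>+x. ennreal ((e / 9) powr q) \<partial>lebesgue_on {-1..1::real})"
      using P q by (intro nn_integral_mono ennreal_leI powr_mono2) (auto simp: W_def)
    also have "\<dots> = ennreal ((e / 9) powr q) * 2" by (simp add: emeasure_restrict_space)
    also have "\<dots> = ennreal ((e / 9) powr q * 2)" by (simp add: ennreal_mult)
    also have "\<dots> \<le> ennreal \<epsilon>"
    proof (rule ennreal_leI)
      have "2 \<le> (3 :: real) powr 1" by simp
      also have "\<dots> \<le> 3 powr q" using q by (intro powr_mono) auto
      finally have "(e / 9) powr q * 2 \<le> (e / 9) powr q * 3 powr q" by (intro mult_left_mono) auto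
      also have "\<dots> = \<epsilon>" by (simp add: \<epsilon>_def flip: powr_mult)
      finally show "(e / 9) powr q * 2 \<le> \<epsilon>" .
    qed
    finally show ?thesis .
  qed
  \<comment> \<open>Back from the weighted values \<open>F\<close>, \<open>F'\<close>, \<open>H n\<close> to functions carrying the weight.\<close>
  define d where "d G x = G x / (1 - x\<^sup>2) powr \<alpha>" for G :: "real \<Rightarrow> real" and x
  have wd: "AE x in lebesgue_on {-1..1}. weighted \<alpha> (d G) x = G x" for G
  proof (rule AE_lebesgue_on_interval, rule AE_I2)
    fix x :: real
    show "x \<in> {-1<..<1} \<longrightarrow> weighted \<alpha> (d G) x = G x"
      using one_minus_square_pos [of x] by (auto simp: weighted_def d_def)
  qed
  have small_d: "Lpw_norm p \<alpha> (d G) \<le> ennreal (e / 3)"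
    if G: "G \<in> borel_measurable (lebesgue_on {-1..1})" "(\<integral>\<^sup>+x. ennreal (\<bar>G x\<bar> powr q) \<partial>lebesgue_on {-1..1}) \<le> ennreal \<epsilon>" for G
  proof (rule small)
    show "weighted \<alpha> (d G) \<in> borel_measurable (lebesgue_on {-1..1})"
      by (rule lebesgue_on_cong_AE [OF wd G(1)])
    have "(\<integral>\<^sup>+x. ennreal (\<bar>weighted \<alpha> (d G) x\<bar> powr q) \<partial>lebesgue_on {-1..1}) = (\<integral>\<^sup>+x. ennreal (\<bar>G x\<bar> powr q) \<partial>lebesgue_on {-1..1})"
      by (rule nn_integral_cong_AE) (use wd [of G] in eventually_elim, simp)
    with G(2) show "(\<integral>\<^sup>+x. ennreal (\<bar>weighted \<alpha> (d G) x\<bar> powr q) \<partial>lebesgue_on {-1..1}) \<le> ennreal \<epsilon>" by simp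
  qed
  have "Lpw_norm p \<alpha> (\<lambda>x. f x - poly P x) = Lpw_norm p \<alpha> (\<lambda>x. d (\<lambda>x. F x - F' x) x + (d (\<lambda>x. F' x - H n x) x + d (\<lambda>x. H n x - W x) x))"
  proof (intro Lpw_norm_same p sameI)
    fix x :: real assume "x \<in> {-1<..<1}"
    then have "(1 - x\<^sup>2) powr \<alpha> \<noteq> 0" using one_minus_square_pos [of x] by auto
    then show "f x - poly P x = d (\<lambda>x. F x - F' x) x + (d (\<lambda>x. F' x - H n x) x + d (\<lambda>x. H n x - W x) x)"
      by (simp add: d_def W_def F_def weighted_def field_simps)
  qed
  also have "\<dots> \<le> ennreal (e / 3) + (ennreal (e / 3) + ennreal (e / 3))"
  proof -
    have "Lpw_norm p \<alpha> (d (\<lambda>x. F x - F' x)) \<le> ennreal (e / 3)"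
      by (rule small_d, measurable) (use M in \<open>simp add: F'_def\<close>)
    moreover have "Lpw_norm p \<alpha> (d (\<lambda>x. F' x - H n x)) \<le> ennreal (e / 3)"
      by (rule small_d [OF _ n]) measurable
    moreover have "Lpw_norm p \<alpha> (d (\<lambda>x. H n x - W x)) \<le> ennreal (e / 3)"
      by (rule small_d [OF _ HW]) measurable
    ultimately show ?thesis
      by (intro order_trans [OF Lpw_norm_triangle [OF p]] add_mono)
  qed
  also have "\<dots> = ennreal e" using e by (simp flip: ennreal_plus)
  finally show thesis by (rule that)
qed


section \<open>The translation on the weighted spaces\<close>

lemma raw_translation_add:
  assumes "trans_integrable y f x" "trans_integrable y g x"
  shows "raw_translation y (\<lambda>x. f x + g x) x = raw_translation y f x + raw_translation y g x"
    "trans_integrable y (\<lambda>x. f x + g x) x"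
  using assms unfolding trans_integrable_def raw_translation_def
  by (simp_all add: distrib_left)

lemma raw_translation_cmult:
  assumes "trans_integrable y f x"
  shows "raw_translation y (\<lambda>x. s * f x) x = s * raw_translation y f x"
    "trans_integrable y (\<lambda>x. s * f x) x"
  using assms unfolding trans_integrable_def raw_translation_def
  by (simp_all add: mult.left_commute [of _ s])

lemma trans_integrable_poly: "trans_integrable y (poly P) x"
  unfolding trans_integrable_def trans_kernel_def trans_arg_def
  by (intro continuous_imp_integrable_real continuous_intros)

definition eigen_sum :: "nat \<Rightarrow> (nat \<Rightarrow> real) \<Rightarrow> real poly" where
  "eigen_sum m c = (\<Sum>k\<le>m. smult (c k) (eigen_poly k))"

lemma eigen_sum_exists:
  assumes "degree P < n" "n \<le> Suc m"
  obtains c where "P = eigen_sum m c" "\<And>k. n \<le> k \<Longrightarrow> c k = 0"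
proof -
  have "degree P \<le> n - 1" using assms by simp
  from triangular_basis [of eigen_poly, OF eigen_poly_degree this]
  obtain a where a: "P = (\<Sum>i\<le>n - 1. smult (a i) (eigen_poly i))" by blast
  define c where "c k = (if k < n then a k else 0)" for k
  have "P = (\<Sum>i\<le>n - 1. smult (c i) (eigen_poly i))"
    unfolding a using assms by (intro sum.cong refl) (auto simp: c_def)
  also have "\<dots> = eigen_sum m c"
    unfolding eigen_sum_def using assms by (intro sum.mono_neutral_left) (auto simp: c_def)
  finally show thesis using that by (simp add: c_def)
qed

lemma degree_eigen_sum:
  assumes "\<And>k. n \<le> k \<Longrightarrow> c k = 0" "1 \<le> n"
  shows "degree (eigen_sum m c) \<le> n - 1"
  unfolding eigen_sum_def
proof (intro degree_sum_le)
  fix k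
  show "degree (smult (c k) (eigen_poly k)) \<le> n - 1"
  proof (cases "n \<le> k")
    case False
    then show ?thesis using eigen_poly_degree [of k] degree_smult_le [of "c k" "eigen_poly k"] by linarith
  qed (simp add: assms)
qed simp

lemma raw_translation_eigen_sum:
  assumes y: "-1 < y" "y \<le> 1" and x: "x \<in> {-1<..<1}"
  shows "raw_translation y (poly (eigen_sum m c)) x = ((1 + y) / 2)\<^sup>2 * poly (eigen_sum m (\<lambda>k. jac k y * c k)) x"
proof -
  define t where "t = arccos y"
  have t: "\<bar>t\<bar> < pi" "cos t = y"
    using y arccos_lbound [of y] arccos_ubound [of y] arccos_less_arccos [of "-1" y] by (auto simp: t_def)
  have c2: "(cos (t / 2))\<^sup>2 = (1 + y) / 2" using cos_double_cos [of "t / 2"] t(2) by simp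
  have c0: "cos (t / 2) \<noteq> 0" using c2 y by auto
  have e: "raw_translation y (poly (eigen_poly k)) x = ((1 + y) / 2)\<^sup>2 * (jac k y * poly (eigen_poly k) x)" for k
  proof -
    have "raw_translation y (poly (eigen_poly k)) x = cos (t / 2) ^ 4 * gen_translation t (poly (eigen_poly k)) x"
      using c0 by (simp add: gen_translation_raw t(2))
    also have "\<dots> = cos (t / 2) ^ 4 * (jac k y * poly (eigen_poly k) x)"
      using gen_translation_eigen [OF t(1), of x k] x by (simp add: t(2))
    also have "cos (t / 2) ^ 4 = ((cos (t / 2))\<^sup>2)\<^sup>2" by (simp flip: power_mult)
    finally show ?thesis by (simp only: c2)
  qed
  show ?thesis
  proof (induction m)
    case 0
    show ?case using raw_translation_cmult(1) [OF trans_integrable_poly, of y "c 0" "eigen_poly 0" x] e [of 0]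
      by (simp add: eigen_sum_def)
  next
    case (Suc m)
    have s: "poly (eigen_sum (Suc m) c) = (\<lambda>x. poly (eigen_sum m c) x + poly (smult (c (Suc m)) (eigen_poly (Suc m))) x)" for c
      by (auto simp: eigen_sum_def)
    have "raw_translation y (poly (eigen_sum (Suc m) c)) x
      = raw_translation y (poly (eigen_sum m c)) x + raw_translation y (poly (smult (c (Suc m)) (eigen_poly (Suc m)))) x"
      unfolding s by (rule raw_translation_add) (rule trans_integrable_poly)+
    also have "raw_translation y (poly (smult (c (Suc m)) (eigen_poly (Suc m)))) x = c (Suc m) * raw_translation y (poly (eigen_poly (Suc m))) x"
      using raw_translation_cmult(1) [OF trans_integrable_poly, of y "c (Suc m)" "eigen_poly (Suc m)" x]
      by (simp add: poly_smult [abs_def])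
    finally show ?case unfolding Suc e s by (simp add: algebra_simps)
  qed
qed

lemma raw_translation_measurable:
  assumes [measurable]: "g \<in> borel_measurable borel"
  shows "raw_translation y g \<in> borel_measurable borel"
proof -
  define F where "F = (\<lambda>p. indicator {0..pi} (snd p) * (trans_kernel y (fst p) (cos (snd p)) (trans_arg (fst p) y (cos (snd p))) * g (trans_arg (fst p) y (cos (snd p)))))"
  have [measurable]: "F \<in> borel_measurable (borel \<Otimes>\<^sub>M borel)" unfolding F_def by measurable
  have "raw_translation y g x = 1 / (pi * (1 - x\<^sup>2)) * (LINT \<phi>|lborel. F (x, \<phi>))" for x
  proof -
    have "(\<lambda>\<phi>. F (x, \<phi>)) \<in> borel_measurable lborel" by measurable
    then have "(LINT \<phi>|lborel. F (x, \<phi>)) = (LINT \<phi>|lebesgue. F (x, \<phi>))" by (simp add: integral_completion)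
    also have "\<dots> = (LINT \<phi>|lebesgue_on {0..pi}. trans_kernel y x (cos \<phi>) (trans_arg x y (cos \<phi>)) * g (trans_arg x y (cos \<phi>)))"
      by (subst integral_restrict_space) (simp_all add: F_def)
    finally show ?thesis by (simp add: raw_translation_def)
  qed
  moreover have "(\<lambda>x. 1 / (pi * (1 - x\<^sup>2)) * (LINT \<phi>|lborel. F (x, \<phi>))) \<in> borel_measurable borel"
  proof -
    have "(\<lambda>x. LINT \<phi>|lborel. F (x, \<phi>)) \<in> borel_measurable borel"
      by (rule lborel.borel_measurable_lebesgue_integral) (simp add: case_prod_unfold)
    then show ?thesis by measurable
  qed
  ultimately show ?thesis by (simp add: fun_eq_iff [symmetric] cong: measurable_cong)
qed

definition trans_defined :: "ennreal \<Rightarrow> real \<Rightarrow> (real \<Rightarrow> real) \<Rightarrow> bool" where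
  "trans_defined p y f \<longleftrightarrow> (if p = \<infinity> then \<forall>x\<in>{-1<..<1}. trans_integrable y f x
     else AE x in lborel. x \<in> {-1<..<1} \<longrightarrow> trans_integrable y f x)"

lemma borel_version:
  assumes p: "p \<noteq> \<infinity>" and f: "f \<in> Lpw_space p \<alpha>"
  obtains g where "g \<in> borel_measurable borel" "same p f g"
proof -
  have "weighted \<alpha> f \<in> borel_measurable (lebesgue_on {-1..1})" using f Lpw_space_finite [OF p] by blast
  then have "(\<lambda>x. if x \<in> {-1..1} then weighted \<alpha> f x else 0) \<in> borel_measurable lebesgue"
    by (rule borel_measurable_if_I) simp
  from completion_ex_borel_measurable_real [OF this]
  obtain h where h: "h \<in> borel_measurable lborel" "AE x in lborel. (if x \<in> {-1..1} then weighted \<alpha> f x else 0) = h x" by blast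
  define g where "g x = h x / (1 - x\<^sup>2) powr \<alpha>" for x
  have "g \<in> borel_measurable borel" using h(1) unfolding g_def by measurable
  moreover have "same p f g"
    unfolding same_def using p
  proof (simp, use h(2) in eventually_elim)
    case (elim x)
    show ?case
    proof
      assume x: "- 1 < x \<and> x < 1"
      then have "(1 - x\<^sup>2) powr \<alpha> \<noteq> 0" using one_minus_square_pos [of x] by auto
      moreover have "h x = f x * (1 - x\<^sup>2) powr \<alpha>" using elim x by (simp add: weighted_def)
      ultimately show "f x = g x" by (simp add: g_def)
    qed
  qed
  ultimately show thesis by (rule that)
qed

lemma wpow_interior:
  "wpow q \<alpha> f = (\<integral>\<^sup>+x. ennreal ((\<bar>f x\<bar> * (1 - x\<^sup>2) powr \<alpha>) powr q * indicator {-1<..<1} x) \<partial>lborel)"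
  unfolding wpow_def nn_integral_lebesgue_on_interval
  by (intro nn_integral_cong) (auto simp: weighted_def abs_mult indicator_def)

lemma translation_bounded_finite:
  assumes p: "p \<noteq> \<infinity>" "1 \<le> p" and s: "0 \<le> s" "s < 1 / 2" and s': "0 \<le> s'" "s' < 1 / 2"
    and split: "(\<alpha> - 1) * enn2real p = s * (enn2real p - 1) - s'"
  obtains C where "1 \<le> C"
    "\<And>f y. f \<in> Lpw_space p \<alpha> \<Longrightarrow> -1 < y \<Longrightarrow> y \<le> 1 \<Longrightarrow>
       trans_defined p y f \<and> Lpw_norm p \<alpha> (raw_translation y f) \<le> ennreal C * Lpw_norm p \<alpha> f"
proof -
  define q where "q = enn2real p"
  have q: "1 \<le> q" unfolding q_def by (rule enn2real_ge_1 [OF p(2,1)])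
  obtain C0 where C0: "0 < C0" and bound: "\<And>f y. f \<in> borel_measurable borel \<Longrightarrow> -1 < y \<Longrightarrow> y \<le> 1 \<Longrightarrow> wpow q \<alpha> f < \<infinity> \<Longrightarrow>
       (AE x in lborel. x \<in> {-1<..<1} \<longrightarrow> trans_integrable y f x) \<and> wpow q \<alpha> (raw_translation y f) \<le> ennreal C0 * wpow q \<alpha> f"
    by (rule raw_translation_power_bound [OF q s s' split [folded q_def], folded wpow_interior]) (rule that; assumption)
  define C where "C = max 1 (C0 powr (1 / q))"
  have C: "1 \<le> C" "C0 \<le> C powr q"
  proof -
    have "C0 = (C0 powr (1 / q)) powr q" using C0 q by (simp add: powr_powr)
    also have "\<dots> \<le> C powr q" using q by (intro powr_mono2) (auto simp: C_def)
    finally show "C0 \<le> C powr q" .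
  qed (simp add: C_def)
  have "trans_defined p y f \<and> Lpw_norm p \<alpha> (raw_translation y f) \<le> ennreal C * Lpw_norm p \<alpha> f"
    if f: "f \<in> Lpw_space p \<alpha>" and y: "-1 < y" "y \<le> 1" for f y
  proof -
    obtain g where g: "g \<in> borel_measurable borel" "same p f g" using borel_version [OF p(1) f] .
    define A where "A = enn2real (Lpw_norm p \<alpha> f)"
    have A: "Lpw_norm p \<alpha> f = ennreal A" "0 \<le> A"
      using f Lpw_norm_space [of p \<alpha>] by (auto simp: A_def less_top)
    have "Lpw_norm p \<alpha> g = ennreal A" using Lpw_norm_same [OF p(2) g(2)] A by simp
    then have gle: "wpow q \<alpha> g \<le> ennreal (A powr q)"
      using A Lpw_norm_le_finite [OF p(1) q [unfolded q_def], of A \<alpha> g] by (simp add: q_def)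
    then have "wpow q \<alpha> g < \<infinity>" by (auto intro: le_less_trans)
    note b = bound [OF g(1) y this]
    have AE: "AE x in lborel. x \<in> {-1<..<1} \<longrightarrow> raw_translation y f x = raw_translation y g x \<and> trans_integrable y f x = trans_integrable y g x"
      using g(2) p(1) by (intro raw_translation_cong_AE g y) (simp add: same_def)
    then have "same p (raw_translation y f) (raw_translation y g)"
      unfolding same_def using p(1) by (auto elim: eventually_mono)
    then have "Lpw_norm p \<alpha> (raw_translation y f) = Lpw_norm p \<alpha> (raw_translation y g)" by (rule Lpw_norm_same [OF p(2)])
    also have "\<dots> \<le> ennreal (C * A)"
    proof (subst Lpw_norm_le_finite [OF p(1) q [unfolded q_def]])
      have "weighted \<alpha> (raw_translation y g) \<in> borel_measurable borel"
        unfolding weighted_def [abs_def] using raw_translation_measurable [OF g(1), of y] by measurable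
      then have 1: "weighted \<alpha> (raw_translation y g) \<in> borel_measurable (lebesgue_on {-1..1})"
        by (intro measurable_restrict_space1 measurable_completion) simp
      have "wpow q \<alpha> (raw_translation y g) \<le> ennreal C0 * wpow q \<alpha> g" using b by blast
      also have "\<dots> \<le> ennreal (C powr q) * ennreal (A powr q)"
        by (intro mult_mono ennreal_leI C gle) auto
      also have "\<dots> = ennreal ((C * A) powr q)" by (simp add: ennreal_mult powr_mult)
      finally show "weighted \<alpha> (raw_translation y g) \<in> borel_measurable (lebesgue_on {-1..1}) \<and> wpow (enn2real p) \<alpha> (raw_translation y g) \<le> ennreal ((C * A) powr enn2real p)"
        using 1 by (simp add: q_def)
    qed (use A C in simp)
    also have "\<dots> = ennreal C * Lpw_norm p \<alpha> f" using A C by (simp add: ennreal_mult)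
    finally have "Lpw_norm p \<alpha> (raw_translation y f) \<le> ennreal C * Lpw_norm p \<alpha> f" .
    moreover have "AE x in lborel. x \<in> {-1<..<1} \<longrightarrow> trans_integrable y f x"
      using AE conjunct1 [OF b] by eventually_elim auto
    ultimately show ?thesis using p(1) by (simp add: trans_defined_def)
  qed
  then show thesis by (rule that [OF C(1)])
qed

text \<open>The bound is the pointwise one for the power \<open>\<alpha> - 1\<close> of the weight. Continuity of the translated
  function is not visible from the integral; it follows because polynomials are translated to
  polynomials and the weighted error is uniformly small.\<close>

lemma translation_bounded_inf:
  assumes \<alpha>: "1 \<le> \<alpha>" "\<alpha> < 3 / 2"
  obtains C where "1 \<le> C"
    "\<And>f y. f \<in> Lpw_space \<infinity> \<alpha> \<Longrightarrow> -1 < y \<Longrightarrow> y \<le> 1 \<Longrightarrow>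
       trans_defined \<infinity> y f \<and> Lpw_norm \<infinity> \<alpha> (raw_translation y f) \<le> ennreal C * Lpw_norm \<infinity> \<alpha> f"
proof -
  have s: "0 \<le> \<alpha> - 1" "\<alpha> - 1 < 1 / 2" using \<alpha> by auto
  obtain C0 where C0: "0 < C0" and leg: "\<And>x y. -1 < x \<Longrightarrow> x < 1 \<Longrightarrow> -1 \<le> y \<Longrightarrow> y \<le> 1 \<Longrightarrow>
       legendre (\<lambda>R. (1 - R\<^sup>2) powr (- (\<alpha> - 1))) y x \<le> ennreal (C0 * (1 - x\<^sup>2) powr (- (\<alpha> - 1)))"
    by (rule legendre_weight [OF s]) (rule that; assumption)
  define C where "C = max 1 C0"
  have C: "1 \<le> C" "C0 \<le> C" by (auto simp: C_def)
  have sup: "trans_integrable y f x \<and> \<bar>weighted \<alpha> (raw_translation y f) x\<bar> \<le> C * A"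
    if f: "continuous_on {-1..1} (weighted \<alpha> f)" and A: "\<And>x. x \<in> {-1..1} \<Longrightarrow> \<bar>weighted \<alpha> f x\<bar> \<le> A"
      and y: "-1 < y" "y \<le> 1" and x: "x \<in> {-1<..<1}" for f y A x
  proof -
    have A0: "0 \<le> A" using A [of 0] by force
    define g where "g x = indicator {-1<..<1} x * f x" for x
    have g [measurable]: "g \<in> borel_measurable borel"
    proof -
      have "continuous_on {-1<..<1} (\<lambda>x. weighted \<alpha> f x / (1 - x\<^sup>2) powr \<alpha>)"
        using f one_minus_square_pos by (intro continuous_intros continuous_on_subset [OF f]) force+
      moreover have "weighted \<alpha> f x / (1 - x\<^sup>2) powr \<alpha> = f x" if "x \<in> {-1<..<1}" for x
        using one_minus_square_pos [of x] that by (auto simp: weighted_def)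
      ultimately have "continuous_on {-1<..<1} f" by (rule continuous_on_eq)
      from borel_measurable_continuous_on_indicator [OF _ this] show ?thesis unfolding g_def [abs_def] by simp
    qed
    have y': "-1 \<le> y" "y \<le> 1" using y by auto
    have gA: "\<bar>g R\<bar> * (1 - R\<^sup>2) \<le> A * (1 - R\<^sup>2) powr (- (\<alpha> - 1))" if R: "R \<in> {-1<..<1}" for R
    proof -
      have R0: "0 < 1 - R\<^sup>2" using one_minus_square_pos R by simp
      have "1 - R\<^sup>2 = (1 - R\<^sup>2) powr \<alpha> * (1 - R\<^sup>2) powr (- (\<alpha> - 1))" using R0 by (simp flip: powr_add)
      then have "\<bar>g R\<bar> * (1 - R\<^sup>2) = (\<bar>f R\<bar> * (1 - R\<^sup>2) powr \<alpha>) * (1 - R\<^sup>2) powr (- (\<alpha> - 1))"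
        using R by (simp add: g_def)
      also have "\<bar>f R\<bar> * (1 - R\<^sup>2) powr \<alpha> = \<bar>weighted \<alpha> f R\<bar>" by (simp add: weighted_def abs_mult)
      also have "\<bar>weighted \<alpha> f R\<bar> * (1 - R\<^sup>2) powr (- (\<alpha> - 1)) \<le> A * (1 - R\<^sup>2) powr (- (\<alpha> - 1))"
        using A [of R] R by (intro mult_right_mono) auto
      finally show ?thesis .
    qed
    have "legendre (\<lambda>R. \<bar>g R\<bar> * (1 - R\<^sup>2)) y x \<le> (\<integral>\<^sup>+\<phi>. ennreal A * ennreal ((1 - (trans_arg x y (cos \<phi>))\<^sup>2) powr (- (\<alpha> - 1)) * indicator {0<..<pi} \<phi>) \<partial>lborel)"
      unfolding legendre_def
    proof (rule nn_integral_mono)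
      fix \<phi> :: real
      show "ennreal (\<bar>g (trans_arg x y (cos \<phi>))\<bar> * (1 - (trans_arg x y (cos \<phi>))\<^sup>2) * indicator {0<..<pi} \<phi>)
        \<le> ennreal A * ennreal ((1 - (trans_arg x y (cos \<phi>))\<^sup>2) powr (- (\<alpha> - 1)) * indicator {0<..<pi} \<phi>)"
      proof (cases "\<phi> \<in> {0<..<pi}")
        case True
        then have "trans_arg x y (cos \<phi>) \<in> {-1<..<1}" using x y trans_arg_interior(2) [of x y \<phi>] by auto
        from gA [OF this] show ?thesis using True A0 by (simp add: ennreal_mult [symmetric] ennreal_leI)
      qed simp
    qed
    also have "\<dots> = ennreal A * legendre (\<lambda>R. (1 - R\<^sup>2) powr (- (\<alpha> - 1))) y x"
      unfolding legendre_def by (rule nn_integral_cmult) measurable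
    also have "\<dots> \<le> ennreal A * ennreal (C0 * (1 - x\<^sup>2) powr (- (\<alpha> - 1)))"
      using x y by (intro mult_left_mono leg) auto
    also have "\<dots> = ennreal (A * (C0 * (1 - x\<^sup>2) powr (- (\<alpha> - 1))))" using A0 C0 by (simp add: ennreal_mult)
    finally have "legendre (\<lambda>R. \<bar>g R\<bar> * (1 - R\<^sup>2)) y x \<le> ennreal (A * (C0 * (1 - x\<^sup>2) powr (- (\<alpha> - 1))))" .
    from raw_translation_legendre [OF g x y' this]
    have g1: "trans_integrable y g x" "\<bar>raw_translation y g x\<bar> \<le> A * (C0 * (1 - x\<^sup>2) powr (- (\<alpha> - 1))) / (1 - x\<^sup>2)"
      using A0 C0 by auto
    have fg: "raw_translation y f x = raw_translation y g x" "trans_integrable y f x = trans_integrable y g x"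
      by (rule raw_translation_cong_interior [OF _ x y' trans_integrand_measurable [OF g]], simp add: g_def)+
    have x0: "0 < 1 - x\<^sup>2" using one_minus_square_pos x by simp
    have "\<bar>weighted \<alpha> (raw_translation y f) x\<bar> \<le> A * (C0 * (1 - x\<^sup>2) powr (- (\<alpha> - 1))) / (1 - x\<^sup>2) * (1 - x\<^sup>2) powr \<alpha>"
      unfolding weighted_def fg(1) abs_mult abs_of_nonneg [OF powr_ge_zero] by (intro mult_right_mono g1) auto
    also have "\<dots> = A * C0 * ((1 - x\<^sup>2) powr (- (\<alpha> - 1)) * (1 - x\<^sup>2) powr \<alpha> / (1 - x\<^sup>2))" by simp
    also have "(1 - x\<^sup>2) powr (- (\<alpha> - 1)) * (1 - x\<^sup>2) powr \<alpha> = 1 - x\<^sup>2" using x0 by (simp flip: powr_add)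
    also have "A * C0 * ((1 - x\<^sup>2) / (1 - x\<^sup>2)) = C0 * A" using x0 by simp
    also have "\<dots> \<le> C * A" using C A0 by (intro mult_right_mono) auto
    finally show ?thesis using g1 fg by simp
  qed
  have "trans_defined \<infinity> y f \<and> Lpw_norm \<infinity> \<alpha> (raw_translation y f) \<le> ennreal C * Lpw_norm \<infinity> \<alpha> f"
    if f: "f \<in> Lpw_space \<infinity> \<alpha>" and y: "-1 < y" "y \<le> 1" for f y
  proof -
    define A where "A = enn2real (Lpw_norm \<infinity> \<alpha> f)"
    have A: "Lpw_norm \<infinity> \<alpha> f = ennreal A" "0 \<le> A"
      using f Lpw_norm_space [of \<infinity> \<alpha>] by (auto simp: A_def less_top)
    have fc: "continuous_on {-1..1} (weighted \<alpha> f)" and fA: "\<And>x. x \<in> {-1..1} \<Longrightarrow> \<bar>weighted \<alpha> f x\<bar> \<le> A"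
      using Lpw_norm_le_inf [OF A(2), of \<alpha> f] A(1) by auto
    note sf = sup [OF fc fA y]
    have le: "\<bar>weighted \<alpha> (raw_translation y f) x\<bar> \<le> C * A" if "x \<in> {-1..1}" for x
    proof (cases "x = 1 \<or> x = -1")
      case False
      then show ?thesis using sf that by auto
    qed (use A C in \<open>auto simp: weighted_ends\<close>)
    have cont: "continuous_on {-1..1} (weighted \<alpha> (raw_translation y f))"
    proof -
      have "\<exists>Q. \<forall>x\<in>{-1..1}. \<bar>weighted \<alpha> (raw_translation y f) x - weighted \<alpha> (poly Q) x\<bar> \<le> C * e" if e: "e > 0" for e
      proof -
        obtain P where P: "Lpw_norm \<infinity> \<alpha> (\<lambda>x. f x - poly P x) \<le> ennreal e"
          using poly_dense [OF _ _ f e] \<alpha> by auto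
        have pc: "continuous_on {-1..1} (weighted \<alpha> (\<lambda>x. f x - poly P x))" and pe: "\<And>x. x \<in> {-1..1} \<Longrightarrow> \<bar>weighted \<alpha> (\<lambda>x. f x - poly P x) x\<bar> \<le> e"
          using P e Lpw_norm_le_inf [of e \<alpha> "\<lambda>x. f x - poly P x"] by auto
        obtain c where c: "P = eigen_sum (degree P) c" using eigen_sum_exists [of P "Suc (degree P)" "degree P"] by auto
        define Q where "Q = smult (((1 + y) / 2)\<^sup>2) (eigen_sum (degree P) (\<lambda>k. jac k y * c k))"
        have "\<bar>weighted \<alpha> (raw_translation y f) x - weighted \<alpha> (poly Q) x\<bar> \<le> C * e" if x: "x \<in> {-1..1}" for x
        proof (cases "x = 1 \<or> x = -1")
          case False
          then have x': "x \<in> {-1<..<1}" using x by auto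
          note sp = sup [OF pc pe y x']
          have "raw_translation y f x = raw_translation y (\<lambda>x. (f x - poly P x) + poly P x) x" by simp
          also have "\<dots> = raw_translation y (\<lambda>x. f x - poly P x) x + raw_translation y (poly P) x"
            using sp trans_integrable_poly by (intro raw_translation_add) auto
          also have "raw_translation y (poly P) x = poly Q x"
            unfolding Q_def by (subst c, subst raw_translation_eigen_sum [OF y x']) simp
          finally have "weighted \<alpha> (raw_translation y f) x - weighted \<alpha> (poly Q) x = weighted \<alpha> (raw_translation y (\<lambda>x. f x - poly P x)) x"
            by (simp add: weighted_def algebra_simps)
          then show ?thesis using sp by simp
        qed (use C e in \<open>auto simp: weighted_ends\<close>)
        then show ?thesis by blast
      qed
      note ex = this
      define \<epsilon> where "\<epsilon> n = 1 / (C * real (Suc n))" for n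
      have "\<forall>n. \<exists>Q. \<forall>x\<in>{-1..1}. \<bar>weighted \<alpha> (raw_translation y f) x - weighted \<alpha> (poly Q) x\<bar> \<le> inverse (real (Suc n))"
      proof
        fix n
        have "\<epsilon> n > 0" "C * \<epsilon> n = inverse (real (Suc n))" using C by (auto simp: \<epsilon>_def inverse_eq_divide)
        then show "\<exists>Q. \<forall>x\<in>{-1..1}. \<bar>weighted \<alpha> (raw_translation y f) x - weighted \<alpha> (poly Q) x\<bar> \<le> inverse (real (Suc n))"
          using ex by metis
      qed
      then obtain Q where Q: "\<And>n x. x \<in> {-1..1} \<Longrightarrow> \<bar>weighted \<alpha> (raw_translation y f) x - weighted \<alpha> (poly (Q n)) x\<bar> \<le> inverse (real (Suc n))"
        by metis
      show ?thesis
      proof (rule uniform_limit_theorem [where F = sequentially])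
        show "\<forall>\<^sub>F n in sequentially. continuous_on {-1..1} (weighted \<alpha> (poly (Q n)))"
          unfolding weighted_def using \<alpha> by (intro always_eventually allI continuous_intros weight_continuous) auto
        show "uniform_limit {-1..1} (\<lambda>n. weighted \<alpha> (poly (Q n))) (weighted \<alpha> (raw_translation y f)) sequentially"
        proof (rule uniform_limitI)
          fix e :: real assume "e > 0"
          then obtain n0 where n0: "inverse (real (Suc n0)) < e" using reals_Archimedean by blast
          show "\<forall>\<^sub>F n in sequentially. \<forall>x\<in>{-1..1}. dist (weighted \<alpha> (poly (Q n)) x) (weighted \<alpha> (raw_translation y f) x) < e"
          proof (rule eventually_sequentiallyI [of n0], intro ballI)
            fix n x assume "n0 \<le> n" "x \<in> {-1..1 :: real}"
            have "inverse (real (Suc n)) \<le> inverse (real (Suc n0))" using \<open>n0 \<le> n\<close> by (intro le_imp_inverse_le) auto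
            then show "dist (weighted \<alpha> (poly (Q n)) x) (weighted \<alpha> (raw_translation y f) x) < e"
              using Q [OF \<open>x \<in> {-1..1}\<close>, of n] n0 unfolding dist_real_def by linarith
          qed
        qed
      qed simp
    qed
    have "Lpw_norm \<infinity> \<alpha> (raw_translation y f) \<le> ennreal (C * A)"
      using cont le A C by (subst Lpw_norm_le_inf) auto
    also have "\<dots> = ennreal C * Lpw_norm \<infinity> \<alpha> f" using A C by (simp add: ennreal_mult)
    finally show ?thesis using sf by (simp add: trans_defined_def)
  qed
  then show thesis by (rule that [OF C(1)])
qed


section \<open>Generalised differences on the weighted spaces\<close>

locale bounded_transl =
  fixes p :: ennreal and \<alpha> C :: real
  assumes p: "1 \<le> p" and \<alpha>: "0 < \<alpha>" and C: "1 \<le> C"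
    and bounded: "\<lbrakk>f \<in> Lpw_space p \<alpha>; -1 < y; y \<le> 1\<rbrakk> \<Longrightarrow>
       trans_defined p y f \<and> Lpw_norm p \<alpha> (raw_translation y f) \<le> ennreal C * Lpw_norm p \<alpha> f"
begin

abbreviation nrm :: "(real \<Rightarrow> real) \<Rightarrow> ennreal" where "nrm \<equiv> Lpw_norm p \<alpha>"
abbreviation sp :: "(real \<Rightarrow> real) set" where "sp \<equiv> Lpw_space p \<alpha>"

lemma sp_add: "f \<in> sp \<Longrightarrow> g \<in> sp \<Longrightarrow> (\<lambda>x. f x + g x) \<in> sp"
  using Lpw_norm_triangle [OF p, of \<alpha> f g] Lpw_norm_space [of p \<alpha>]
  by (metis ennreal_add_less_top infinity_ennreal_def le_less_trans)

lemma sp_cmult: "f \<in> sp \<Longrightarrow> (\<lambda>x. s * f x) \<in> sp"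
  using Lpw_norm_scale [OF p, of f \<alpha> s] Lpw_norm_space [of p \<alpha>]
  by (metis ennreal_less_top ennreal_mult_less_top infinity_ennreal_def)

lemma nrm_minus: "f \<in> sp \<Longrightarrow> nrm (\<lambda>x. - f x) = nrm f"
  using Lpw_norm_scale [OF p, of f \<alpha> "- 1"] by simp

lemma sp_diff: "f \<in> sp \<Longrightarrow> g \<in> sp \<Longrightarrow> (\<lambda>x. f x - g x) \<in> sp"
  using sp_add [of f "\<lambda>x. (- 1) * g x"] sp_cmult [of g "- 1"] by simp

lemma nrm_diff: "g \<in> sp \<Longrightarrow> nrm (\<lambda>x. f x - g x) \<le> nrm f + nrm g"
  using Lpw_norm_triangle [OF p, of \<alpha> f "\<lambda>x. - g x"] nrm_minus [of g] by simp

lemma poly_sp: "poly P \<in> sp"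
  by (rule poly_in_Lpw_space [OF p \<alpha>])

lemma raw_same:
  assumes "same p f g" "f \<in> sp" "g \<in> sp" and y: "-1 < y" "y \<le> 1"
  shows "same p (raw_translation y f) (raw_translation y g)"
proof (cases "p = \<infinity>")
  case True
  show ?thesis
  proof (rule sameI)
    fix x :: real assume x: "x \<in> {-1<..<1}"
    have "trans_integrable y g x" using bounded [OF assms(3) y] x True by (simp add: trans_defined_def)
    then show "raw_translation y f x = raw_translation y g x"
      using assms(1) True x y
      by (intro raw_translation_cong_interior(1)) (auto simp: same_def trans_integrable_def)
  qed
next
  case False
  obtain h where h: "h \<in> borel_measurable borel" "same p g h" using borel_version [OF False assms(3)] .
  have fh: "same p f h" using assms(1) h(2) by (rule same_trans)
  have "AE x in lborel. x \<in> {-1<..<1} \<longrightarrow> raw_translation y u x = raw_translation y h x \<and> trans_integrable y u x = trans_integrable y h x"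
    if "same p u h" for u
    using that False by (intro raw_translation_cong_AE h y) (simp add: same_def)
  from this [OF fh] this [OF h(2)] show ?thesis
    unfolding same_def using False by (auto elim: eventually_elim2)
qed

lemma raw_add:
  assumes f: "f \<in> sp" and g: "g \<in> sp" and y: "-1 < y" "y \<le> 1"
  shows "same p (raw_translation y (\<lambda>x. f x + g x)) (\<lambda>x. raw_translation y f x + raw_translation y g x)"
  using conjunct1 [OF bounded [OF f y]] conjunct1 [OF bounded [OF g y]]
  unfolding trans_defined_def same_def
  by (auto simp: raw_translation_add split: if_splits elim: eventually_elim2)

lemma cos_range: "\<bar>t\<bar> \<le> 1 \<Longrightarrow> -1 < cos t \<and> cos t \<le> 1 \<and> 1 / 4 \<le> cos (t / 2) ^ 4" for t :: real
proof -
  assume t: "\<bar>t\<bar> \<le> 1"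
  have c: "0 < cos t" using t pi_gt3 by (intro cos_gt_zero_pi) (auto simp: abs_le_iff)
  have "(1 / 2)\<^sup>2 \<le> ((cos (t / 2))\<^sup>2)\<^sup>2"
    using cos_double_cos [of "t / 2"] c by (intro power_mono) auto
  then show ?thesis using c by (simp add: power_divide flip: power_mult)
qed

text \<open>The steps are at most 1, where \<open>cos (t / 2) ^ 4\<close> is at least 1 / 4.\<close>

lemma gen_diff1_bound:
  assumes f: "f \<in> sp" and t: "\<bar>t\<bar> \<le> 1"
  shows "gen_diff1 t f \<in> sp" "nrm (gen_diff1 t f) \<le> ennreal (4 * C + 1) * nrm f"
proof -
  note y = cos_range [OF t]
  have r: "nrm (raw_translation (cos t) f) \<le> ennreal C * nrm f" using bounded [OF f] y by blast
  have nf: "nrm f < \<infinity>" using f Lpw_norm_space [of p \<alpha>] by blast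
  then have rs: "raw_translation (cos t) f \<in> sp" using r Lpw_norm_space [of p \<alpha>]
    by (metis ennreal_less_top ennreal_mult_less_top infinity_ennreal_def le_less_trans)
  define s where "s = 1 / cos (t / 2) ^ 4"
  have "0 < cos (t / 2) ^ 4" using y by linarith
  then have s: "\<bar>s\<bar> \<le> 4" using y by (simp add: s_def pos_divide_le_eq)
  have eq: "gen_diff1 t f = (\<lambda>x. s * raw_translation (cos t) f x - f x)"
    by (auto simp: gen_diff1_def gen_translation_raw s_def)
  show "gen_diff1 t f \<in> sp" unfolding eq by (intro sp_diff sp_cmult rs f)
  have "nrm (gen_diff1 t f) \<le> ennreal \<bar>s\<bar> * nrm (raw_translation (cos t) f) + nrm f"
    unfolding eq using nrm_diff [OF f] Lpw_norm_scale [OF p rs] by metis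
  also have "\<dots> \<le> ennreal 4 * (ennreal C * nrm f) + nrm f"
    using s r by (intro add_mono mult_mono ennreal_leI) auto
  also have "\<dots> = ennreal (4 * C + 1) * nrm f"
    using C by (simp add: ennreal_mult ennreal_plus distrib_right mult.assoc)
  finally show "nrm (gen_diff1 t f) \<le> ennreal (4 * C + 1) * nrm f" .
qed

lemma gen_diff1_same:
  assumes "same p f g" "f \<in> sp" "g \<in> sp" "\<bar>t\<bar> \<le> 1"
  shows "same p (gen_diff1 t f) (gen_diff1 t g)"
proof -
  have "same p (raw_translation (cos t) f) (raw_translation (cos t) g)"
    using assms cos_range [of t] by (intro raw_same) auto
  from same_diff [OF same_cmult [OF this, of "1 / cos (t / 2) ^ 4"] assms(1)]
  show ?thesis by (simp add: gen_diff1_def [abs_def] gen_translation_raw)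
qed

lemma gen_diff1_add:
  assumes "f \<in> sp" "g \<in> sp" "\<bar>t\<bar> \<le> 1"
  shows "same p (gen_diff1 t (\<lambda>x. f x + g x)) (\<lambda>x. gen_diff1 t f x + gen_diff1 t g x)"
proof -
  have "same p (raw_translation (cos t) (\<lambda>x. f x + g x)) (\<lambda>x. raw_translation (cos t) f x + raw_translation (cos t) g x)"
    using assms cos_range [of t] by (intro raw_add) auto
  moreover have "same p (\<lambda>x. f x + g x) (\<lambda>x. f x + g x)" by (rule sameI) simp
  ultimately have "same p (\<lambda>x. 1 / cos (t / 2) ^ 4 * raw_translation (cos t) (\<lambda>x. f x + g x) x - (f x + g x))
     (\<lambda>x. 1 / cos (t / 2) ^ 4 * (raw_translation (cos t) f x + raw_translation (cos t) g x) - (f x + g x))"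
    by (intro same_diff same_cmult)
  then show ?thesis
    by (simp add: gen_diff1_def [abs_def] gen_translation_raw add_divide_distrib algebra_simps)
qed

lemma gen_diff_bound:
  assumes f: "f \<in> sp" and t: "\<And>j. j \<in> {1..r} \<Longrightarrow> \<bar>t j\<bar> \<le> 1"
  shows "gen_diff r t f \<in> sp \<and> nrm (gen_diff r t f) \<le> ennreal ((4 * C + 1) ^ r) * nrm f"
  using t
proof (induction r)
  case 0
  then show ?case using f by simp
next
  case (Suc r)
  then have IH: "gen_diff r t f \<in> sp" "nrm (gen_diff r t f) \<le> ennreal ((4 * C + 1) ^ r) * nrm f" by auto
  have ts: "\<bar>t (Suc r)\<bar> \<le> 1" using Suc.prems by auto
  note d = gen_diff1_bound [OF IH(1) ts]
  have "nrm (gen_diff (Suc r) t f) \<le> ennreal (4 * C + 1) * (ennreal ((4 * C + 1) ^ r) * nrm f)"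
    using order_trans [OF d(2) mult_left_mono [OF IH(2)]] by simp
  also have "\<dots> = ennreal ((4 * C + 1) ^ Suc r) * nrm f"
    using C by (simp add: ennreal_mult mult.assoc)
  finally show ?case using d(1) by simp
qed

lemma gen_diff_add:
  assumes f: "f \<in> sp" and g: "g \<in> sp" and t: "\<And>j. j \<in> {1..r} \<Longrightarrow> \<bar>t j\<bar> \<le> 1"
  shows "same p (gen_diff r t (\<lambda>x. f x + g x)) (\<lambda>x. gen_diff r t f x + gen_diff r t g x)"
  using t
proof (induction r)
  case 0
  show ?case by (rule sameI) simp
next
  case (Suc r)
  have tr: "\<And>j. j \<in> {1..r} \<Longrightarrow> \<bar>t j\<bar> \<le> 1" and ts: "\<bar>t (Suc r)\<bar> \<le> 1" using Suc.prems by auto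
  have fs: "gen_diff r t f \<in> sp" "gen_diff r t g \<in> sp" "gen_diff r t (\<lambda>x. f x + g x) \<in> sp"
    using gen_diff_bound [OF f tr] gen_diff_bound [OF g tr] gen_diff_bound [OF sp_add [OF f g] tr] by simp_all
  have "same p (gen_diff1 (t (Suc r)) (gen_diff r t (\<lambda>x. f x + g x))) (gen_diff1 (t (Suc r)) (\<lambda>x. gen_diff r t f x + gen_diff r t g x))"
    using fs sp_add ts Suc.IH [OF tr] by (intro gen_diff1_same) auto
  then show ?case using gen_diff1_add [OF fs(1,2) ts] by (auto intro: same_trans)
qed

lemma gen_diff_triangle:
  assumes f: "f \<in> sp" and g: "g \<in> sp" and t: "\<And>j. j \<in> {1..r} \<Longrightarrow> \<bar>t j\<bar> \<le> 1"
  shows "nrm (gen_diff r t f) \<le> nrm (gen_diff r t g) + nrm (gen_diff r t (\<lambda>x. f x - g x))"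
proof -
  have "nrm (gen_diff r t (\<lambda>x. g x + (f x - g x))) = nrm (\<lambda>x. gen_diff r t g x + gen_diff r t (\<lambda>x. f x - g x) x)"
    by (intro Lpw_norm_same [OF p] gen_diff_add g sp_diff f t)
  also have "\<dots> \<le> nrm (gen_diff r t g) + nrm (gen_diff r t (\<lambda>x. f x - g x))" by (rule Lpw_norm_triangle [OF p])
  finally show ?thesis by simp
qed

lemma gen_diff_eigen_sum:
  assumes "\<And>j. j \<in> {1..r} \<Longrightarrow> \<bar>t j\<bar> \<le> 1"
  shows "x \<in> {-1<..<1} \<Longrightarrow> gen_diff r t (poly (eigen_sum m c)) x = poly (eigen_sum m (\<lambda>k. (\<Prod>j=1..r. jac k (cos (t j)) - 1) * c k)) x"
  using assms
proof (induction r arbitrary: x)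
  case 0
  then show ?case by simp
next
  case (Suc r)
  define y where "y = cos (t (Suc r))"
  have y: "-1 < y" "y \<le> 1" "1 / 4 \<le> cos (t (Suc r) / 2) ^ 4"
    using cos_range [of "t (Suc r)"] Suc.prems(2) by (auto simp: y_def)
  define d where "d k = (\<Prod>j=1..r. jac k (cos (t j)) - 1) * c k" for k
  have IH: "gen_diff r t (poly (eigen_sum m c)) x = poly (eigen_sum m d) x" if "x \<in> {-1<..<1}" for x
    unfolding d_def using Suc.prems(2) that by (intro Suc.IH) auto
  have "raw_translation y (gen_diff r t (poly (eigen_sum m c))) x = raw_translation y (poly (eigen_sum m d)) x"
    using Suc.prems(1) y trans_integrable_poly [of y "eigen_sum m d" x]
    by (intro raw_translation_cong_interior(1) IH) (auto simp: trans_integrable_def)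
  also have "\<dots> = ((1 + y) / 2)\<^sup>2 * poly (eigen_sum m (\<lambda>k. jac k y * d k)) x"
    by (rule raw_translation_eigen_sum [OF y(1,2) Suc.prems(1)])
  finally have *: "raw_translation y (gen_diff r t (poly (eigen_sum m c))) x = ((1 + y) / 2)\<^sup>2 * poly (eigen_sum m (\<lambda>k. jac k y * d k)) x" .
  have "(1 + y) / 2 = (cos (t (Suc r) / 2))\<^sup>2" using cos_double_cos [of "t (Suc r) / 2"] by (simp add: y_def)
  then have c4: "((1 + y) / 2)\<^sup>2 = cos (t (Suc r) / 2) ^ 4" by (simp flip: power_mult)
  have "gen_translation (t (Suc r)) (gen_diff r t (poly (eigen_sum m c))) x = poly (eigen_sum m (\<lambda>k. jac k y * d k)) x"
    using y(3) unfolding gen_translation_raw y_def [symmetric] * c4 by (cases "cos (t (Suc r) / 2) = 0") simp_all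
  then have "gen_diff (Suc r) t (poly (eigen_sum m c)) x = poly (eigen_sum m (\<lambda>k. jac k y * d k)) x - poly (eigen_sum m d) x"
    using IH [OF Suc.prems(1)] by (simp add: gen_diff1_def)
  also have "\<dots> = poly (eigen_sum m (\<lambda>k. (jac k y - 1) * d k)) x"
    by (simp add: eigen_sum_def poly_sum sum_subtractf [symmetric] algebra_simps)
  also have "(\<lambda>k. (jac k y - 1) * d k) = (\<lambda>k. (\<Prod>j=1..Suc r. jac k (cos (t j)) - 1) * c k)"
    by (simp add: d_def y_def mult_ac)
  finally show ?case .
qed

definition coeff_norm :: "nat \<Rightarrow> (nat \<Rightarrow> real) \<Rightarrow> real" where
  "coeff_norm m c = enn2real (nrm (poly (eigen_sum m c)))"

lemma nrm_eigen_sum: "nrm (poly (eigen_sum m c)) = ennreal (coeff_norm m c)"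
  using poly_sp [of "eigen_sum m c"] Lpw_norm_space [of p \<alpha>] by (simp add: coeff_norm_def less_top)

lemma coeff_norm_nonneg: "0 \<le> coeff_norm m c"
  by (simp add: coeff_norm_def)

text \<open>The link to the estimates for multipliers. The constant \<open>C\<close> of the weighted space is kept; only \<open>K\<close>
  depends on \<open>m\<close>.\<close>

lemma coeff_norm_transl_seq:
  obtains K where "transl_seq (coeff_norm m) m K C"
proof -
  have tri: "coeff_norm m (\<lambda>k. c k + d k) \<le> coeff_norm m c + coeff_norm m d" for c d
  proof -
    have "poly (eigen_sum m (\<lambda>k. c k + d k)) = (\<lambda>x. poly (eigen_sum m c) x + poly (eigen_sum m d) x)"
      by (auto simp: eigen_sum_def poly_sum sum.distrib [symmetric] distrib_right)
    then have "ennreal (coeff_norm m (\<lambda>k. c k + d k)) \<le> ennreal (coeff_norm m c + coeff_norm m d)"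
      using Lpw_norm_triangle [OF p, of \<alpha> "poly (eigen_sum m c)" "poly (eigen_sum m d)"] coeff_norm_nonneg
      unfolding nrm_eigen_sum [symmetric] by (simp add: nrm_eigen_sum)
    then show ?thesis by (subst (asm) ennreal_le_iff) (intro add_nonneg_nonneg coeff_norm_nonneg)
  qed
  have scale: "coeff_norm m (\<lambda>k. s * c k) = \<bar>s\<bar> * coeff_norm m c" for s c
  proof -
    have "poly (eigen_sum m (\<lambda>k. s * c k)) = (\<lambda>x. s * poly (eigen_sum m c) x)"
      by (auto simp: eigen_sum_def poly_sum sum_distrib_left mult.assoc)
    then show ?thesis using Lpw_norm_scale [OF p poly_sp, of s "eigen_sum m c"]
      by (simp add: coeff_norm_def enn2real_mult)
  qed
  define e where "e k = coeff_norm m (\<lambda>i. if i = k then 1 else 0)" for k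
  define K where "K = (\<Sum>k\<le>m. e k)"
  have bound: "coeff_norm m c \<le> K * (\<Sum>k\<le>m. \<bar>c k\<bar>)" for c
  proof -
    have sum: "coeff_norm m (\<lambda>i. \<Sum>k\<in>A. c k * (if i = k then 1 else 0)) \<le> (\<Sum>k\<in>A. \<bar>c k\<bar> * e k)" if "finite A" for A
      using that
    proof (induction A rule: finite_induct)
      case empty
      show ?case using scale [of 0 "\<lambda>_. 0"] by simp
    next
      case (insert k A)
      have "coeff_norm m (\<lambda>i. \<Sum>k\<in>insert k A. c k * (if i = k then 1 else 0)) =
        coeff_norm m (\<lambda>i. c k * (if i = k then 1 else 0) + (\<Sum>k\<in>A. c k * (if i = k then 1 else 0)))"
        using insert by simp
      also have "\<dots> \<le> coeff_norm m (\<lambda>i. c k * (if i = k then 1 else 0)) + coeff_norm m (\<lambda>i. \<Sum>k\<in>A. c k * (if i = k then 1 else 0))"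
        by (rule tri)
      also have "\<dots> \<le> \<bar>c k\<bar> * e k + (\<Sum>k\<in>A. \<bar>c k\<bar> * e k)" using insert.IH scale by (simp add: e_def)
      finally show ?case using insert by simp
    qed
    have "eigen_sum m c = eigen_sum m (\<lambda>i. \<Sum>k\<le>m. c k * (if i = k then 1 else 0))"
      unfolding eigen_sum_def by (intro sum.cong refl) (simp add: if_distrib cong: if_cong)
    then have "coeff_norm m c \<le> (\<Sum>k\<le>m. \<bar>c k\<bar> * e k)" using sum [of "{..m}"] by (simp add: coeff_norm_def)
    also have "\<dots> \<le> (\<Sum>k\<le>m. \<bar>c k\<bar> * K)"
      unfolding K_def using coeff_norm_nonneg by (intro sum_mono mult_left_mono member_le_sum) (auto simp: e_def)
    finally show ?thesis by (simp add: sum_distrib_left mult.commute)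
  qed
  have transl: "coeff_norm m (\<lambda>k. ((1 + y) / 2)\<^sup>2 * jac k y * c k) \<le> C * coeff_norm m c" if y: "-1 < y" "y \<le> 1" for y c
  proof -
    have "same p (raw_translation y (poly (eigen_sum m c))) (poly (eigen_sum m (\<lambda>k. ((1 + y) / 2)\<^sup>2 * jac k y * c k)))"
    proof (rule sameI)
      fix x :: real assume "x \<in> {-1<..<1}"
      then show "raw_translation y (poly (eigen_sum m c)) x = poly (eigen_sum m (\<lambda>k. ((1 + y) / 2)\<^sup>2 * jac k y * c k)) x"
        by (subst raw_translation_eigen_sum [OF y]) (simp_all add: eigen_sum_def poly_sum sum_distrib_left mult.assoc)
    qed
    from Lpw_norm_same [OF p this, of \<alpha>]
    have "ennreal (coeff_norm m (\<lambda>k. ((1 + y) / 2)\<^sup>2 * jac k y * c k)) \<le> ennreal C * ennreal (coeff_norm m c)"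
      using conjunct2 [OF bounded [OF poly_sp y, of "eigen_sum m c"]] by (simp only: nrm_eigen_sum)
    also have "\<dots> = ennreal (C * coeff_norm m c)" using C coeff_norm_nonneg by (simp add: ennreal_mult)
    finally show ?thesis using C coeff_norm_nonneg [of m c] by (simp add: ennreal_le_iff)
  qed
  have "transl_seq (coeff_norm m) m K C"
    by unfold_locales (use tri scale bound C transl in auto)
  then show thesis by (rule that)
qed

end


section \<open>The direct and the inverse inequality\<close>

context bounded_transl
begin

lemma gen_diff_eigen_norm:
  assumes "\<And>j. j \<in> {1..r} \<Longrightarrow> \<bar>t j\<bar> \<le> 1"
  shows "nrm (gen_diff r t (poly (eigen_sum m c))) = ennreal (coeff_norm m (\<lambda>k. (\<Prod>j=1..r. 1 - jac k (cos (t j))) * c k))"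
proof -
  have "same p (gen_diff r t (poly (eigen_sum m c))) (poly (eigen_sum m (\<lambda>k. (\<Prod>j=1..r. jac k (cos (t j)) - 1) * c k)))"
    by (rule sameI) (rule gen_diff_eigen_sum [OF assms])
  from Lpw_norm_same [OF p this, of \<alpha>]
  have "nrm (gen_diff r t (poly (eigen_sum m c))) = ennreal (coeff_norm m (\<lambda>k. (\<Prod>j=1..r. jac k (cos (t j)) - 1) * c k))"
    by (simp only: nrm_eigen_sum)
  also have "(\<lambda>k. (\<Prod>j=1..r. jac k (cos (t j)) - 1) * c k) = (\<lambda>k. (- 1) ^ r * ((\<Prod>j=1..r. 1 - jac k (cos (t j))) * c k))"
  proof
    fix k
    have "(\<Prod>j=1..r. jac k (cos (t j)) - 1) = (\<Prod>j=1..r. (- 1) * (1 - jac k (cos (t j))))" by simp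
    also have "\<dots> = (- 1) ^ r * (\<Prod>j=1..r. 1 - jac k (cos (t j)))" by (subst prod.distrib) simp
    finally show "(\<Prod>j=1..r. jac k (cos (t j)) - 1) * c k = (- 1) ^ r * ((\<Prod>j=1..r. 1 - jac k (cos (t j))) * c k)" by simp
  qed
  also have "coeff_norm m \<dots> = coeff_norm m (\<lambda>k. (\<Prod>j=1..r. 1 - jac k (cos (t j))) * c k)"
  proof -
    obtain K where "transl_seq (coeff_norm m) m K C" by (rule coeff_norm_transl_seq)
    then interpret transl_seq "coeff_norm m" m K C .
    show ?thesis unfolding N_scale by (simp add: power_abs)
  qed
  finally show ?thesis .
qed

lemma best_approx_finite:
  assumes "f \<in> sp"
  shows "best_approx p \<alpha> n f < \<infinity>"
proof -
  have "best_approx p \<alpha> n f \<le> nrm (\<lambda>x. f x - poly 0 x)"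
    unfolding best_approx_def by (rule INF_lower) simp
  also have "\<dots> < \<infinity>" using assms Lpw_norm_space [of p \<alpha>] by simp
  finally show ?thesis .
qed

lemma best_approx_mono: "n \<le> n' \<Longrightarrow> best_approx p \<alpha> n' f \<le> best_approx p \<alpha> n f"
  unfolding best_approx_def by (rule INF_superset_mono) auto

lemma near_best:
  assumes f: "f \<in> sp" and e: "e > (0 :: real)"
  obtains P where "degree P \<le> n - 1" "nrm (\<lambda>x. f x - poly P x) \<le> best_approx p \<alpha> n f + ennreal e"
proof -
  have "best_approx p \<alpha> n f < best_approx p \<alpha> n f + ennreal e"
    using best_approx_finite [OF f, of n] e by (cases "best_approx p \<alpha> n f") (auto simp: ennreal_less_iff simp flip: ennreal_plus)
  then have "\<exists>P. degree P \<le> n - 1 \<and> nrm (\<lambda>x. f x - poly P x) < best_approx p \<alpha> n f + ennreal e"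
    by (subst (asm) best_approx_def) (simp add: INF_less_iff)
  then show thesis using that less_imp_le by blast
qed

lemma gen_diff_le_modulus:
  assumes "\<And>j. j \<in> {1..r} \<Longrightarrow> \<bar>t j\<bar> \<le> \<delta>"
  shows "nrm (gen_diff r t f) \<le> gen_modulus r p \<alpha> f \<delta>"
  unfolding gen_modulus_def by (rule SUP_upper) (use assms in auto)

lemma modulus_finite:
  assumes f: "f \<in> sp" and \<delta>: "\<delta> \<le> 1"
  shows "gen_modulus r p \<alpha> f \<delta> < \<infinity>"
proof -
  have "gen_modulus r p \<alpha> f \<delta> \<le> ennreal ((4 * C + 1) ^ r) * nrm f"
    unfolding gen_modulus_def
  proof (rule SUP_least)
    fix t assume "t \<in> {t. \<forall>j\<in>{1..r}. \<bar>t j\<bar> \<le> \<delta>}"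
    then show "nrm (gen_diff r t f) \<le> ennreal ((4 * C + 1) ^ r) * nrm f"
      using \<delta> by (intro conjunct2 [OF gen_diff_bound] f) (auto intro: order_trans)
  qed
  also have "\<dots> < \<infinity>" using f Lpw_norm_space [of p \<alpha>] by (simp add: ennreal_mult_less_top)
  finally show ?thesis .
qed

text \<open>The direct inequality. Both sides are continuous in \<open>f\<close>, so that it suffices to have it for
  polynomials, with a constant that does not depend on their degree.\<close>

lemma jackson:
  obtains D where "0 < D" "\<And>f n. f \<in> sp \<Longrightarrow> 1 \<le> n \<Longrightarrow> best_approx p \<alpha> n f \<le> ennreal D * gen_modulus r p \<alpha> f (1 / real n)"
proof -
  define D where "D = \<bar>transl_seq.direct_const C r\<bar> + 1"
  have D: "D > 0" by (simp add: D_def add_nonneg_pos)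
  define S where "S = (4 * C + 1) ^ r"
  have S: "S \<ge> 0" using C by (simp add: S_def)
  have "best_approx p \<alpha> n f \<le> ennreal D * gen_modulus r p \<alpha> f (1 / real n)" if f: "f \<in> sp" and n: "1 \<le> n" for f n
  proof -
    define \<omega> where "\<omega> = enn2real (gen_modulus r p \<alpha> f (1 / real n))"
    have n1: "1 / real n \<le> 1" using n by simp
    have \<omega>: "gen_modulus r p \<alpha> f (1 / real n) = ennreal \<omega>" "0 \<le> \<omega>"
      using modulus_finite [OF f n1, of r] by (auto simp: \<omega>_def less_top)
    have "best_approx p \<alpha> n f \<le> ennreal (D * \<omega>) + ennreal e" if e: "e > 0" for e
    proof -
      define \<epsilon> where "\<epsilon> = e / (1 + D * S)"
      have "0 \<le> D * S" using D S by simp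
      then have "\<epsilon> > 0" "\<epsilon> * (1 + D * S) = e" using e by (simp_all add: \<epsilon>_def add_pos_nonneg)
      then have \<epsilon>: "\<epsilon> > 0" "\<epsilon> + D * (S * \<epsilon>) = e" by (simp_all add: algebra_simps)
      have "\<exists>P. nrm (\<lambda>x. f x - poly P x) \<le> ennreal \<epsilon>"
      proof (rule poly_dense [where p = p and \<alpha> = \<alpha> and f = f and e = \<epsilon>])
        fix P assume "nrm (\<lambda>x. f x - poly P x) \<le> ennreal \<epsilon>"
        then show ?thesis by (rule exI)
      qed (rule p \<alpha> f \<epsilon>(1))+
      then obtain P where P: "nrm (\<lambda>x. f x - poly P x) \<le> ennreal \<epsilon>" ..
      define m where "m = degree P"
      obtain c where c: "P = eigen_sum m c"
        by (rule eigen_sum_exists [of P "Suc m" m]) (simp add: m_def, simp, rule that)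
      obtain K where "transl_seq (coeff_norm m) m K C" by (rule coeff_norm_transl_seq)
      then interpret transl_seq "coeff_norm m" m K C .
      define M where "M = \<omega> + S * \<epsilon>"
      have M0: "M \<ge> 0" using \<omega> S \<epsilon> by (simp add: M_def)
      have M: "coeff_norm m (\<lambda>k. (\<Prod>j=1..r. 1 - jac k (ys j)) * c k) \<le> M"
        if ys: "\<And>j. j \<in> {1..r} \<Longrightarrow> ys j \<in> {cos (1 / real n)..1}" for ys
      proof -
        define t where "t j = arccos (ys j)" for j
        have t: "\<bar>t j\<bar> \<le> 1 / real n" "cos (t j) = ys j" if "j \<in> {1..r}" for j
        proof -
          have y: "cos (1 / real n) \<le> ys j" "ys j \<le> 1" using ys [OF that] by auto
          then have y': "-1 \<le> ys j" using cos_ge_minus_one [of "1 / real n"] by linarith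
          have "arccos (ys j) \<le> arccos (cos (1 / real n))" using y by (intro arccos_le_arccos) auto
          also have "\<dots> = 1 / real n" using n1 pi_gt3 by (intro arccos_cos) auto
          finally show "\<bar>t j\<bar> \<le> 1 / real n" using arccos_lbound [of "ys j"] y y' by (simp add: t_def)
          show "cos (t j) = ys j" using y y' by (simp add: t_def cos_arccos)
        qed
        then have t1: "\<bar>t j\<bar> \<le> 1" if "j \<in> {1..r}" for j using n1 that by (meson order_trans)
        have "nrm (gen_diff r t (poly P)) = ennreal (coeff_norm m (\<lambda>k. (\<Prod>j=1..r. 1 - jac k (cos (t j))) * c k))"
          unfolding c by (rule gen_diff_eigen_norm) (rule t1)
        also have "(\<lambda>k. (\<Prod>j=1..r. 1 - jac k (cos (t j))) * c k) = (\<lambda>k. (\<Prod>j=1..r. 1 - jac k (ys j)) * c k)"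
          by (intro ext arg_cong2 [where f = "(*)"] prod.cong refl) (simp only: t(2))
        finally have "ennreal (coeff_norm m (\<lambda>k. (\<Prod>j=1..r. 1 - jac k (ys j)) * c k)) = nrm (gen_diff r t (poly P))" ..
        also have "\<dots> \<le> nrm (gen_diff r t f) + nrm (gen_diff r t (\<lambda>x. poly P x - f x))"
          by (rule gen_diff_triangle [OF poly_sp f t1])
        also have "\<dots> \<le> ennreal \<omega> + ennreal S * ennreal \<epsilon>"
        proof (rule add_mono)
          show "nrm (gen_diff r t f) \<le> ennreal \<omega>" unfolding \<omega>(1) [symmetric] by (rule gen_diff_le_modulus [OF t(1)])
          have "nrm (\<lambda>x. poly P x - f x) = nrm (\<lambda>x. f x - poly P x)"
            using nrm_minus [OF sp_diff [OF f poly_sp, of P]] by simp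
          then have "ennreal S * nrm (\<lambda>x. poly P x - f x) \<le> ennreal S * ennreal \<epsilon>" using P by (intro mult_left_mono) auto
          moreover have "nrm (gen_diff r t (\<lambda>x. poly P x - f x)) \<le> ennreal S * nrm (\<lambda>x. poly P x - f x)"
            unfolding S_def by (rule conjunct2 [OF gen_diff_bound]) (rule sp_diff [OF poly_sp f], rule t1)
          ultimately show "nrm (gen_diff r t (\<lambda>x. poly P x - f x)) \<le> ennreal S * ennreal \<epsilon>" by (rule order_trans [rotated])
        qed
        also have "\<dots> = ennreal M" using \<omega> S \<epsilon> by (simp add: M_def ennreal_mult ennreal_plus)
        finally show ?thesis using M0 by (simp add: ennreal_le_iff)
      qed
      obtain d where d: "\<And>k. n \<le> k \<Longrightarrow> d k = 0" "coeff_norm m (\<lambda>k. c k - d k) \<le> direct_const r * M"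
        using direct_estimate [OF n M] by blast
      have "coeff_norm m (\<lambda>k. c k - d k) \<le> D * M"
        by (rule order_trans [OF d(2)]) (use M0 in \<open>auto simp: D_def intro!: mult_right_mono\<close>)
      moreover have "(\<lambda>x. poly P x - poly (eigen_sum m d) x) = poly (eigen_sum m (\<lambda>k. c k - d k))"
        by (auto simp: c eigen_sum_def poly_sum sum_subtractf [symmetric] left_diff_distrib)
      ultimately have PQ: "nrm (\<lambda>x. poly P x - poly (eigen_sum m d) x) \<le> ennreal (D * M)"
        by (simp only: nrm_eigen_sum ennreal_leI)
      have "best_approx p \<alpha> n f \<le> nrm (\<lambda>x. f x - poly (eigen_sum m d) x)"
        unfolding best_approx_def using degree_eigen_sum [OF d(1) n] by (intro INF_lower) auto
      also have "(\<lambda>x. f x - poly (eigen_sum m d) x) = (\<lambda>x. (f x - poly P x) + (poly P x - poly (eigen_sum m d) x))" by auto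
      also have "nrm \<dots> \<le> ennreal \<epsilon> + ennreal (D * M)"
        by (rule order_trans [OF Lpw_norm_triangle [OF p] add_mono [OF P PQ]])
      also have "\<dots> = ennreal (\<epsilon> + D * M)" using D M0 \<epsilon>(1) by (intro ennreal_plus [symmetric]) auto
      also have "\<epsilon> + D * M = D * \<omega> + (\<epsilon> + D * (S * \<epsilon>))" by (simp add: M_def algebra_simps)
      also have "\<dots> = ennreal (D * \<omega>) + ennreal e"
        unfolding \<epsilon>(2) using D \<omega> e by (intro ennreal_plus) auto
      finally show ?thesis .
    qed
    then have "best_approx p \<alpha> n f \<le> ennreal (D * \<omega>)" by (rule ennreal_le_epsilon)
    then show ?thesis unfolding \<omega>(1) using D \<omega>(2) by (simp add: ennreal_mult)
  qed
  then show thesis by (rule that [OF D])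
qed

definition step_const :: real where "step_const = 520 * C\<^sup>2"

text \<open>Each difference costs $1 - \cos t \le 1/(2n^2)$ by \<open>difference_bound\<close> and gains \<open>m'\<^sup>2\<close> by \<open>bernstein\<close>.\<close>

lemma gen_diff_poly_bound:
  assumes n: "1 \<le> n" and t: "\<And>j. j \<in> {1..r} \<Longrightarrow> \<bar>t j\<bar> \<le> 1 / real n"
    and m': "1 \<le> m'" and P: "degree P < m'"
  shows "nrm (gen_diff r t (poly P)) \<le> ennreal ((step_const * (real m')\<^sup>2 / (real n)\<^sup>2) ^ r) * nrm (poly P)"
proof -
  have n1: "1 / real n \<le> 1" using n by simp
  then have t1: "\<bar>t j\<bar> \<le> 1" if "j \<in> {1..r}" for j using t that by (meson order_trans)
  obtain c where c: "P = eigen_sum m' c" "\<And>k. m' \<le> k \<Longrightarrow> c k = 0"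
    by (rule eigen_sum_exists [OF P, of m']) auto
  obtain K where "transl_seq (coeff_norm m') m' K C" by (rule coeff_norm_transl_seq)
  then interpret transl_seq "coeff_norm m'" m' K C .
  define B where "B = step_const * (real m')\<^sup>2 / (real n)\<^sup>2"
  have B0: "0 \<le> B" by (simp add: B_def step_const_def)
  have step: "coeff_norm m' (\<lambda>k. (1 - jac k (cos u)) * d k) \<le> B * coeff_norm m' d"
    if u: "\<bar>u\<bar> \<le> 1 / real n" and d: "\<And>k. m' \<le> k \<Longrightarrow> d k = 0" for u d
  proof -
    have u1: "\<bar>u\<bar> \<le> 1" using u n1 by linarith
    have c0: "0 < cos u" using u1 pi_gt3 by (intro cos_gt_zero_pi) (auto simp: abs_le_iff)
    have "u\<^sup>2 \<le> (1 / real n)\<^sup>2" using power_mono [OF u, of 2] by simp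
    then have "1 - cos u \<le> 1 / (2 * (real n)\<^sup>2)" using one_minus_cos_le [of u] by (simp add: power_divide)
    moreover have "1 \<le> (1 + cos u) ^ 4" using c0 by (intro one_le_power) auto
    ultimately have "8 * C * (1 - cos u) / (1 + cos u) ^ 4 \<le> 8 * C * (1 / (2 * (real n)\<^sup>2)) / 1"
      using C by (intro frac_le mult_left_mono) auto
    then have "8 * C * (1 - cos u) / (1 + cos u) ^ 4 \<le> 4 * C / (real n)\<^sup>2" by simp
    from mult_right_mono [OF this N_nonneg]
    have "coeff_norm m' (\<lambda>k. (1 - jac k (cos u)) * d k) \<le> 4 * C / (real n)\<^sup>2 * coeff_norm m' (\<lambda>k. kap k * d k)"
      by (rule order_trans [rotated]) (use c0 in \<open>intro difference_bound, auto\<close>)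
    also have "\<dots> \<le> 4 * C / (real n)\<^sup>2 * (130 * C * (real m')\<^sup>2 * coeff_norm m' d)"
      using C by (intro mult_left_mono bernstein [OF m' d]) auto
    also have "\<dots> = B * coeff_norm m' d" by (simp add: B_def step_const_def power2_eq_square)
    finally show ?thesis .
  qed
  have "coeff_norm m' (\<lambda>k. (\<Prod>j=1..i. 1 - jac k (cos (t j))) * c k) \<le> B ^ i * coeff_norm m' c" if "i \<le> r" for i
    using that
  proof (induction i)
    case (Suc i)
    have "coeff_norm m' (\<lambda>k. (\<Prod>j=1..Suc i. 1 - jac k (cos (t j))) * c k)
      = coeff_norm m' (\<lambda>k. (1 - jac k (cos (t (Suc i)))) * ((\<Prod>j=1..i. 1 - jac k (cos (t j))) * c k))"
      by (simp add: mult_ac)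
    also have "\<dots> \<le> B * coeff_norm m' (\<lambda>k. (\<Prod>j=1..i. 1 - jac k (cos (t j))) * c k)"
      using Suc.prems c(2) t by (intro step) auto
    also have "\<dots> \<le> B * (B ^ i * coeff_norm m' c)" using Suc B0 by (intro mult_left_mono) auto
    finally show ?case by simp
  qed simp
  note le = this [of r, OF order_refl]
  have "nrm (gen_diff r t (poly P)) = ennreal (coeff_norm m' (\<lambda>k. (\<Prod>j=1..r. 1 - jac k (cos (t j))) * c k))"
    unfolding c(1) by (rule gen_diff_eigen_norm) (rule t1)
  also have "\<dots> \<le> ennreal (B ^ r * coeff_norm m' c)" by (rule ennreal_leI [OF le])
  also have "\<dots> = ennreal (B ^ r) * nrm (poly P)"
    unfolding c(1) nrm_eigen_sum using B0 coeff_norm_nonneg by (simp add: ennreal_mult)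
  finally show ?thesis by (simp add: B_def)
qed

text \<open>On the block between $2^s$ and $2^{s+1}$ the sum on the right has $2^s$ terms, each at least
  $2^{s(2r-1)}$ times the last value of \<open>E\<close>.\<close>

lemma dyadic_sum:
  fixes E :: "nat \<Rightarrow> real"
  assumes mono: "\<And>n n'. n \<le> n' \<Longrightarrow> E n' \<le> E n" and E0: "\<And>n. 0 \<le> E n" and r: "1 \<le> r"
  shows "(\<Sum>j\<le>s. 4 ^ (r * j) * E (2 ^ j)) \<le> 4 ^ r * (\<Sum>\<nu>=1..2 ^ s. real \<nu> ^ (2 * r - 1) * E \<nu>)"
proof (induction s)
  case 0
  have "1 * E 1 \<le> 4 ^ r * E 1" using E0 by (intro mult_right_mono one_le_power) auto
  then show ?case by simp
next
  case (Suc s)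
  have block: "4 ^ (r * s) * E (2 ^ Suc s) \<le> (\<Sum>\<nu>=2 ^ s + 1..2 ^ Suc s. real \<nu> ^ (2 * r - 1) * E \<nu>)"
  proof -
    have "4 ^ (r * s) = (2 :: real) ^ s * (2 ^ s) ^ (2 * r - 1)"
    proof -
      have "(4 :: real) ^ (r * s) = (2 ^ 2) ^ (r * s)" by simp
      also have "\<dots> = (2 ^ s) ^ (2 * r)" by (simp only: power_mult [symmetric] mult_ac)
      also have "2 * r = Suc (2 * r - 1)" using r by simp
      finally show ?thesis by simp
    qed
    then have "4 ^ (r * s) * E (2 ^ Suc s) = (\<Sum>\<nu>=2 ^ s + 1..2 ^ Suc s :: nat. (2 ^ s) ^ (2 * r - 1) * E (2 ^ Suc s) :: real)"
      by simp
    also have "\<dots> \<le> (\<Sum>\<nu>=2 ^ s + 1..2 ^ Suc s. real \<nu> ^ (2 * r - 1) * E \<nu>)"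
    proof (intro sum_mono mult_mono power_mono mono E0)
      fix \<nu> :: nat assume "\<nu> \<in> {2 ^ s + 1..2 ^ Suc s}"
      then have "2 ^ s \<le> \<nu>" and le: "\<nu> \<le> 2 ^ Suc s" by simp_all
      then have "real (2 ^ s) \<le> real \<nu>" by (simp only: of_nat_le_iff)
      then show "2 ^ s \<le> real \<nu>" by simp
      show "\<nu> \<le> 2 ^ Suc s" by (rule le)
    qed auto
    finally show ?thesis .
  qed
  have split: "{1..2 ^ Suc s} = {1..2 ^ s} \<union> {2 ^ s + 1..2 ^ Suc s :: nat}" by auto
  have "(\<Sum>j\<le>Suc s. 4 ^ (r * j) * E (2 ^ j)) = (\<Sum>j\<le>s. 4 ^ (r * j) * E (2 ^ j)) + 4 ^ r * (4 ^ (r * s) * E (2 ^ Suc s))"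
    by (simp add: power_add)
  also have "\<dots> \<le> 4 ^ r * (\<Sum>\<nu>=1..2 ^ s. real \<nu> ^ (2 * r - 1) * E \<nu>) + 4 ^ r * (\<Sum>\<nu>=2 ^ s + 1..2 ^ Suc s. real \<nu> ^ (2 * r - 1) * E \<nu>)"
    by (intro add_mono mult_left_mono block Suc) auto
  also have "\<dots> = 4 ^ r * (\<Sum>\<nu>=1..2 ^ Suc s. real \<nu> ^ (2 * r - 1) * E \<nu>)"
    unfolding split by (subst sum.union_disjoint) (auto simp: distrib_left)
  finally show ?case .
qed

text \<open>The near-best polynomials \<open>Q j\<close> for the degrees below $2^j$ are compared step by step. The first one is
  a constant, which every difference annihilates since \<open>jac 0\<close> is 1.\<close>

lemma telescoped_bound:
  assumes f: "f \<in> sp" and n: "1 \<le> n" and r: "1 \<le> r"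
    and t: "\<And>j. j \<in> {1..r} \<Longrightarrow> \<bar>t j\<bar> \<le> 1 / real n" and e: "e > 0"
  defines "E \<equiv> \<lambda>n. enn2real (best_approx p \<alpha> n f)" and "S \<equiv> (4 * C + 1) ^ r"
  shows "nrm (gen_diff r t f) \<le> ennreal (S * (E (2 ^ s) + e) + (\<Sum>j<s. (step_const * 4 ^ Suc j / (real n)\<^sup>2) ^ r * (2 * E (2 ^ j) + 2 * e)))"
proof -
  have E: "best_approx p \<alpha> n f = ennreal (E n)" "0 \<le> E n" for n
    using best_approx_finite [OF f, of n] by (auto simp: E_def less_top)
  have Emono: "E n' \<le> E n" if "n \<le> n'" for n n'
    using best_approx_mono [OF that, of f] unfolding E(1) by (simp add: ennreal_le_iff E(2))
  have n1: "1 / real n \<le> 1" using n by simp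
  then have t1: "\<bar>t j\<bar> \<le> 1" if "j \<in> {1..r}" for j using t that by (meson order_trans)
  have S: "S \<ge> 0" using C by (simp add: S_def)
  have "\<exists>P. degree P \<le> 2 ^ j - 1 \<and> nrm (\<lambda>x. f x - poly P x) \<le> ennreal (E (2 ^ j) + e)" for j
  proof -
    obtain P where "degree P \<le> 2 ^ j - 1" "nrm (\<lambda>x. f x - poly P x) \<le> best_approx p \<alpha> (2 ^ j) f + ennreal e"
      by (rule near_best [OF f e])
    then show ?thesis using E e by (auto simp: ennreal_plus)
  qed
  then obtain Q where Q: "\<And>j. degree (Q j) \<le> 2 ^ j - 1" "\<And>j. nrm (\<lambda>x. f x - poly (Q j) x) \<le> ennreal (E (2 ^ j) + e)"
    by metis
  define T where "T s = (\<Sum>j<s. (step_const * 4 ^ Suc j / (real n)\<^sup>2) ^ r * (2 * E (2 ^ j) + 2 * e))" for s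
  have T0: "0 \<le> T s" for s unfolding T_def using E e by (intro sum_nonneg mult_nonneg_nonneg) (auto simp: step_const_def)
  have "nrm (gen_diff r t (poly (Q s))) \<le> ennreal (T s)" for s
  proof (induction s)
    case 0
    have "degree (Q 0) < 1" using Q(1) [of 0] by simp
    obtain c where c: "Q 0 = eigen_sum 0 c" "\<And>k. 1 \<le> k \<Longrightarrow> c k = 0"
      by (rule eigen_sum_exists [OF \<open>degree (Q 0) < 1\<close>, of 0]) auto
    have z: "(\<Prod>j=1..r. 1 - jac k (cos (t j))) * c k = 0" for k
    proof (cases "k = 0")
      case True
      have "(\<Prod>j=1..r. 1 - jac k (cos (t j))) = 0" unfolding True using r by (intro prod_zero) (auto intro: bexI [of _ 1])
      then show ?thesis by simp
    qed (use c in auto)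
    have "nrm (gen_diff r t (poly (Q 0))) = ennreal (coeff_norm 0 (\<lambda>k. (\<Prod>j=1..r. 1 - jac k (cos (t j))) * c k))"
      unfolding c(1) by (rule gen_diff_eigen_norm) (rule t1)
    then have "nrm (gen_diff r t (poly (Q 0))) = ennreal (coeff_norm 0 (\<lambda>k. 0))"
      unfolding z .
    also have "coeff_norm 0 (\<lambda>k. 0) = 0"
    proof -
      obtain K where "transl_seq (coeff_norm 0) 0 K C" by (rule coeff_norm_transl_seq)
      then interpret transl_seq "coeff_norm 0" 0 K C .
      show ?thesis by simp
    qed
    finally show ?case by (simp add: T_def)
  next
    case (Suc s)
    define D where "D = Q (Suc s) - Q s"
    have D: "degree D < 2 ^ Suc s"
    proof -
      have "degree (Q s) \<le> 2 ^ Suc s - 1" using Q(1) [of s] by (rule order_trans) (intro diff_le_mono power_increasing, auto)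
      then have "degree D \<le> 2 ^ Suc s - 1" unfolding D_def using Q(1) [of "Suc s"] by (intro degree_diff_le)
      moreover have "0 < (2 :: nat) ^ Suc s" by simp
      ultimately show ?thesis by linarith
    qed
    have "nrm (poly D) \<le> ennreal (2 * E (2 ^ s) + 2 * e)"
    proof -
      have "poly D = (\<lambda>x. (f x - poly (Q s) x) - (f x - poly (Q (Suc s)) x))" by (simp add: D_def fun_eq_iff)
      then have "nrm (poly D) = nrm (\<lambda>x. (f x - poly (Q s) x) - (f x - poly (Q (Suc s)) x))" by simp
      also have "\<dots> \<le> ennreal (E (2 ^ s) + e) + ennreal (E (2 ^ Suc s) + e)"
        by (rule order_trans [OF nrm_diff [OF sp_diff [OF f poly_sp]] add_mono [OF Q(2) Q(2)]])
      also have "\<dots> = ennreal (E (2 ^ s) + E (2 ^ Suc s) + 2 * e)" using E e by (simp flip: ennreal_plus)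
      also have "\<dots> \<le> ennreal (2 * E (2 ^ s) + 2 * e)" using Emono [of "2 ^ s" "2 ^ Suc s"] by (intro ennreal_leI) simp
      finally show ?thesis .
    qed
    then have "nrm (gen_diff r t (poly D)) \<le> ennreal ((step_const * (real (2 ^ Suc s))\<^sup>2 / (real n)\<^sup>2) ^ r) * ennreal (2 * E (2 ^ s) + 2 * e)"
      by (intro order_trans [OF gen_diff_poly_bound [OF n t _ D] mult_left_mono]) auto
    also have "(real (2 ^ Suc s))\<^sup>2 = 4 ^ Suc s" by (simp add: power2_eq_square flip: power_mult_distrib)
    also have "ennreal ((step_const * 4 ^ Suc s / (real n)\<^sup>2) ^ r) * ennreal (2 * E (2 ^ s) + 2 * e)
       = ennreal ((step_const * 4 ^ Suc s / (real n)\<^sup>2) ^ r * (2 * E (2 ^ s) + 2 * e))"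
      using E e by (intro ennreal_mult [symmetric]) (auto simp: step_const_def)
    finally have d: "nrm (gen_diff r t (poly D)) \<le> ennreal ((step_const * 4 ^ Suc s / (real n)\<^sup>2) ^ r * (2 * E (2 ^ s) + 2 * e))" .
    have "nrm (gen_diff r t (poly (Q (Suc s)))) \<le> nrm (gen_diff r t (poly (Q s))) + nrm (gen_diff r t (\<lambda>x. poly (Q (Suc s)) x - poly (Q s) x))"
      by (rule gen_diff_triangle [OF poly_sp poly_sp t1])
    also have "(\<lambda>x. poly (Q (Suc s)) x - poly (Q s) x) = poly D" by (simp add: D_def fun_eq_iff)
    also have "nrm (gen_diff r t (poly (Q s))) + nrm (gen_diff r t (poly D)) \<le> ennreal (T s) + ennreal ((step_const * 4 ^ Suc s / (real n)\<^sup>2) ^ r * (2 * E (2 ^ s) + 2 * e))"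
      by (intro add_mono Suc d)
    also have "\<dots> = ennreal (T (Suc s))"
      using T0 E e by (subst ennreal_plus [symmetric]) (auto simp: T_def step_const_def)
    finally show ?case .
  qed
  note TQ = this
  have "nrm (gen_diff r t f) \<le> nrm (gen_diff r t (poly (Q s))) + nrm (gen_diff r t (\<lambda>x. f x - poly (Q s) x))"
    by (rule gen_diff_triangle [OF f poly_sp t1])
  also have "\<dots> \<le> ennreal (T s) + ennreal S * ennreal (E (2 ^ s) + e)"
  proof (rule add_mono [OF TQ])
    show "nrm (gen_diff r t (\<lambda>x. f x - poly (Q s) x)) \<le> ennreal S * ennreal (E (2 ^ s) + e)"
    proof (rule order_trans)
      show "nrm (gen_diff r t (\<lambda>x. f x - poly (Q s) x)) \<le> ennreal S * nrm (\<lambda>x. f x - poly (Q s) x)"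
        unfolding S_def by (rule conjunct2 [OF gen_diff_bound]) (rule sp_diff [OF f poly_sp], rule t1)
      show "ennreal S * nrm (\<lambda>x. f x - poly (Q s) x) \<le> ennreal S * ennreal (E (2 ^ s) + e)"
        by (intro mult_left_mono Q(2)) auto
    qed
  qed
  also have "\<dots> = ennreal (S * (E (2 ^ s) + e) + T s)"
    using T0 S E e by (simp add: ennreal_mult ennreal_plus add.commute)
  finally show ?thesis by (simp add: T_def)
qed

text \<open>For $2^s \le n < 2^{s+1}$ the last term of the telescoped bound, the error of \<open>Q s\<close>, is absorbed
  into the dyadic sum because $1 \le 4^{r(s+1)} n^{-2r}$.\<close>

lemma inverse_inequality:
  assumes r: "1 \<le> r"
  obtains D where "0 < D" "\<And>f n. f \<in> sp \<Longrightarrow> 1 \<le> n \<Longrightarrow> gen_modulus r p \<alpha> f (1 / real n)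
     \<le> ennreal (D * (1 / real n ^ (2 * r))) * (\<Sum>\<nu>=1..n. ennreal (real \<nu> ^ (2 * r - 1)) * best_approx p \<alpha> \<nu> f)"
proof -
  define S where "S = (4 * C + 1) ^ r"
  define B where "B = step_const ^ r"
  define D where "D = (S * 4 ^ r + 2 * B * 4 ^ r) * 4 ^ r"
  have SB: "0 < S" "0 \<le> B" using C by (simp_all add: S_def B_def step_const_def)
  have D: "D > 0" using SB by (simp add: D_def add_pos_nonneg)
  have "gen_modulus r p \<alpha> f (1 / real n)
     \<le> ennreal (D * (1 / real n ^ (2 * r))) * (\<Sum>\<nu>=1..n. ennreal (real \<nu> ^ (2 * r - 1)) * best_approx p \<alpha> \<nu> f)"
    if f: "f \<in> sp" and n: "1 \<le> n" for f n
  proof -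
    define E where "E n = enn2real (best_approx p \<alpha> n f)" for n
    have E: "best_approx p \<alpha> n f = ennreal (E n)" "0 \<le> E n" for n
      using best_approx_finite [OF f, of n] by (auto simp: E_def less_top)
    have Emono: "E n' \<le> E n" if "n \<le> n'" for n n'
      using best_approx_mono [OF that, of f] unfolding E(1) by (simp add: ennreal_le_iff E(2))
    obtain s where s: "2 ^ s \<le> n" "n < 2 ^ Suc s"
      using ex_power_ivl1 [of 2 n] n by auto
    define X where "X = S * E (2 ^ s) + (\<Sum>j<s. (step_const * 4 ^ Suc j / (real n)\<^sup>2) ^ r * (2 * E (2 ^ j)))"
    define Y where "Y = S + (\<Sum>j<s. (step_const * 4 ^ Suc j / (real n)\<^sup>2) ^ r * 2)"
    have X0: "0 \<le> X" unfolding X_def using SB E by (intro add_nonneg_nonneg sum_nonneg mult_nonneg_nonneg) (auto simp: step_const_def)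
    have Y0: "0 < Y" unfolding Y_def using SB by (intro add_pos_nonneg sum_nonneg mult_nonneg_nonneg) (auto simp: step_const_def)
    have "gen_modulus r p \<alpha> f (1 / real n) \<le> ennreal X"
      unfolding gen_modulus_def
    proof (rule SUP_least)
      fix t assume "t \<in> {t. \<forall>j\<in>{1..r}. \<bar>t j\<bar> \<le> 1 / real n}"
      then have t: "\<And>j. j \<in> {1..r} \<Longrightarrow> \<bar>t j\<bar> \<le> 1 / real n" by auto
      have "nrm (gen_diff r t f) \<le> ennreal X + ennreal e" if e: "e > 0" for e
      proof -
        have "e / Y > 0" using e Y0 by simp
        then have "nrm (gen_diff r t f) \<le> ennreal (S * (E (2 ^ s) + e / Y) + (\<Sum>j<s. (step_const * 4 ^ Suc j / (real n)\<^sup>2) ^ r * (2 * E (2 ^ j) + 2 * (e / Y))))"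
          unfolding S_def E_def by (intro telescoped_bound f n r t)
        also have "S * (E (2 ^ s) + e / Y) + (\<Sum>j<s. (step_const * 4 ^ Suc j / (real n)\<^sup>2) ^ r * (2 * E (2 ^ j) + 2 * (e / Y))) = X + Y * (e / Y)"
          unfolding X_def Y_def by (simp only: distrib_left distrib_right sum.distrib sum_distrib_right mult_ac)
        also have "X + Y * (e / Y) = X + e" using Y0 by simp
        finally show ?thesis using X0 e by simp
      qed
      then show "nrm (gen_diff r t f) \<le> ennreal X" by (rule ennreal_le_epsilon)
    qed
    also have "X \<le> D * (1 / real n ^ (2 * r)) * (\<Sum>\<nu>=1..n. real \<nu> ^ (2 * r - 1) * E \<nu>)"
    proof -
      define h where "h = 1 / real n ^ (2 * r)"
      have h: "0 \<le> h" by (simp add: h_def)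
      have "1 \<le> 4 ^ r * 4 ^ (r * s) * h"
      proof -
        have "real n \<le> real (2 ^ Suc s)" using s by linarith
        then have "real n ^ (2 * r) \<le> real (2 ^ Suc s) ^ (2 * r)" by (intro power_mono) auto
        also have "\<dots> = ((2 :: real) ^ 2) ^ (r * Suc s)" by (simp only: of_nat_power of_nat_numeral power_mult [symmetric] mult_ac)
        also have "\<dots> = 4 ^ r * 4 ^ (r * s)" by (simp add: power_add)
        finally show ?thesis using n by (simp add: h_def field_simps)
      qed
      then have 1: "S * E (2 ^ s) * 1 \<le> S * E (2 ^ s) * (4 ^ r * 4 ^ (r * s) * h)"
        using SB E by (intro mult_left_mono) auto
      have 2: "(step_const * 4 ^ Suc j / (real n)\<^sup>2) ^ r = B * 4 ^ r * h * 4 ^ (r * j)" for j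
      proof -
        have "(step_const * 4 ^ Suc j / (real n)\<^sup>2) ^ r = step_const ^ r * (4 ^ Suc j) ^ r * (1 / ((real n)\<^sup>2) ^ r)"
          by (simp add: power_mult_distrib power_divide)
        also have "(4 ^ Suc j :: real) ^ r = 4 ^ r * 4 ^ (r * j)" by (simp add: power_mult_distrib mult.commute flip: power_mult)
        also have "((real n)\<^sup>2) ^ r = real n ^ (2 * r)" by (simp add: power_mult)
        finally show ?thesis by (simp add: B_def h_def mult_ac)
      qed
      define \<Sigma> where "\<Sigma> = (\<Sum>j\<le>s. 4 ^ (r * j) * E (2 ^ j))"
      have 3: "4 ^ (r * s) * E (2 ^ s) \<le> \<Sigma>"
        unfolding \<Sigma>_def using E by (intro member_le_sum) auto
      have 4: "(\<Sum>j<s. 4 ^ (r * j) * E (2 ^ j)) \<le> \<Sigma>"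
        unfolding \<Sigma>_def using E by (intro sum_mono2) auto
      have "X \<le> (S * 4 ^ r * h) * (4 ^ (r * s) * E (2 ^ s)) + (2 * B * 4 ^ r * h) * (\<Sum>j<s. 4 ^ (r * j) * E (2 ^ j))"
        using 1 unfolding X_def 2 by (simp add: sum_distrib_left mult_ac)
      also have "\<dots> \<le> (S * 4 ^ r * h) * \<Sigma> + (2 * B * 4 ^ r * h) * \<Sigma>"
        using SB h by (intro add_mono mult_left_mono 3 4) auto
      also have "\<dots> = (S * 4 ^ r + 2 * B * 4 ^ r) * h * \<Sigma>" by (simp add: algebra_simps)
      also have "\<dots> \<le> (S * 4 ^ r + 2 * B * 4 ^ r) * h * (4 ^ r * (\<Sum>\<nu>=1..2 ^ s. real \<nu> ^ (2 * r - 1) * E \<nu>))"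
        unfolding \<Sigma>_def using SB h by (intro mult_left_mono dyadic_sum Emono E(2) r) auto
      also have "\<dots> \<le> (S * 4 ^ r + 2 * B * 4 ^ r) * h * (4 ^ r * (\<Sum>\<nu>=1..n. real \<nu> ^ (2 * r - 1) * E \<nu>))"
        using SB h s E by (intro mult_left_mono sum_mono2) auto
      finally show ?thesis by (simp add: D_def h_def)
    qed
    then have "ennreal X \<le> ennreal (D * (1 / real n ^ (2 * r)) * (\<Sum>\<nu>=1..n. real \<nu> ^ (2 * r - 1) * E \<nu>))"
      by (rule ennreal_leI)
    also have "\<dots> = ennreal (D * (1 / real n ^ (2 * r))) * (\<Sum>\<nu>=1..n. ennreal (real \<nu> ^ (2 * r - 1)) * best_approx p \<alpha> \<nu> f)"
    proof -
      have "(\<Sum>\<nu>=1..n. ennreal (real \<nu> ^ (2 * r - 1)) * best_approx p \<alpha> \<nu> f) = ennreal (\<Sum>\<nu>=1..n. real \<nu> ^ (2 * r - 1) * E \<nu>)"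
        unfolding E(1) using E(2) by (subst sum_ennreal [symmetric]) (auto simp: ennreal_mult)
      then show ?thesis using D E(2) by (simp only:) (intro ennreal_mult mult_nonneg_nonneg sum_nonneg, auto)
    qed
    finally show ?thesis .
  qed
  then show thesis by (rule that [OF D])
qed

end

text \<open>For finite \<open>p\<close>, the condition on \<open>\<alpha>\<close> says that $(\alpha-1)p$ lies between $-1/2$ and $(p-1)/2$, with 0
  admitted for $p = 1$. Then one of \<open>s\<close> and \<open>s'\<close> can be taken to be 0 in Schur's test, according to the
  sign of \<open>\<alpha> - 1\<close>.\<close>

lemma bounded_transl_exists:
  fixes p :: ennreal and \<alpha> :: real
  assumes p: "1 \<le> p"
    and 1: "p = 1 \<Longrightarrow> 1/2 < \<alpha> \<and> \<alpha> \<le> 1"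
    and 2: "1 < p \<Longrightarrow> p < \<infinity> \<Longrightarrow>
           1 - 1 / (2 * enn2real p) < \<alpha> \<and> \<alpha> < 3/2 - 1 / (2 * enn2real p)"
    and 3: "p = \<infinity> \<Longrightarrow> 1 \<le> \<alpha> \<and> \<alpha> < 3/2"
  obtains C where "bounded_transl p \<alpha> C"
proof (cases "p = \<infinity>")
  case True
  obtain C where C: "1 \<le> C" "\<And>f y. f \<in> Lpw_space \<infinity> \<alpha> \<Longrightarrow> -1 < y \<Longrightarrow> y \<le> 1 \<Longrightarrow>
       trans_defined \<infinity> y f \<and> Lpw_norm \<infinity> \<alpha> (raw_translation y f) \<le> ennreal C * Lpw_norm \<infinity> \<alpha> f"
    by (rule translation_bounded_inf [of \<alpha>]) (use 3 [OF True] in \<open>auto intro: that\<close>)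
  have "bounded_transl p \<alpha> C"
    unfolding True by unfold_locales (use 3 [OF True] C in auto)
  then show thesis by (rule that)
next
  case fin: False
  define q where "q = enn2real p"
  have q: "1 \<le> q" unfolding q_def by (rule enn2real_ge_1 [OF p fin])
  have \<alpha>: "0 < \<alpha> \<and> (\<exists>s s'. 0 \<le> s \<and> s < 1 / 2 \<and> 0 \<le> s' \<and> s' < 1 / 2 \<and> (\<alpha> - 1) * q = s * (q - 1) - s')"
  proof (cases "p = 1")
    case True
    then have "q = 1" by (simp add: q_def)
    then show ?thesis using 1 [OF True] by (intro conjI exI [of _ 0] exI [of _ "1 - \<alpha>"]) auto
  next
    case False
    then have p1: "1 < p" "p < \<infinity>" using p fin by (auto simp: less_top)
    have "q \<noteq> 1"
    proof
      assume "q = 1"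
      then have "p = ennreal 1" using ennreal_enn2real [of p] p1 by (simp add: q_def)
      then show False using False by simp
    qed
    then have q1: "1 < q" using q by simp
    have a: "1 - 1 / (2 * q) < \<alpha>" "\<alpha> < 3 / 2 - 1 / (2 * q)" using 2 [OF p1] by (auto simp: q_def)
    have "1 / (2 * q) < 1" using q1 by simp
    then have a0: "0 < \<alpha>" using a by linarith
    have lo: "- 1 / 2 < (\<alpha> - 1) * q" using a(1) q1 by (simp add: field_simps)
    have hi: "(\<alpha> - 1) * q < (q - 1) / 2" using a(2) q1 by (simp add: field_simps)
    show ?thesis
    proof (cases "0 \<le> (\<alpha> - 1) * q")
      case True
      have "(\<alpha> - 1) * q / (q - 1) < 1 / 2" using hi q1 by (simp add: pos_divide_less_eq)
      then show ?thesis using True a0 q1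
        by (intro conjI exI [of _ "(\<alpha> - 1) * q / (q - 1)"] exI [of _ 0]) auto
    next
      case False
      then show ?thesis using lo a0 by (intro conjI exI [of _ 0] exI [of _ "- ((\<alpha> - 1) * q)"]) auto
    qed
  qed
  then obtain s s' where s: "0 \<le> s" "s < 1 / 2" "0 \<le> s'" "s' < 1 / 2" "(\<alpha> - 1) * enn2real p = s * (enn2real p - 1) - s'"
    unfolding q_def by blast
  obtain C where C: "1 \<le> C" "\<And>f y. f \<in> Lpw_space p \<alpha> \<Longrightarrow> -1 < y \<Longrightarrow> y \<le> 1 \<Longrightarrow>
       trans_defined p y f \<and> Lpw_norm p \<alpha> (raw_translation y f) \<le> ennreal C * Lpw_norm p \<alpha> f"
    by (rule translation_bounded_finite [OF fin p s]) (rule that; assumption)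
  have "bounded_transl p \<alpha> C"
    by unfold_locales (use p \<alpha> C in auto)
  then show thesis by (rule that)
qed

theorem mainTheorem2:
  fixes p :: ennreal and r :: nat and \<alpha> :: real
  assumes "1 \<le> p" and "1 \<le> r"
    and "p = 1 \<Longrightarrow> 1/2 < \<alpha> \<and> \<alpha> \<le> 1"
    and "1 < p \<Longrightarrow> p < \<infinity> \<Longrightarrow>
           1 - 1 / (2 * enn2real p) < \<alpha> \<and> \<alpha> < 3/2 - 1 / (2 * enn2real p)"
    and "p = \<infinity> \<Longrightarrow> 1 \<le> \<alpha> \<and> \<alpha> < 3/2"
  shows "\<exists>C1 C2 :: real. 0 < C1 \<and> 0 < C2 \<and>
    (\<forall>f\<in>Lpw_space p \<alpha>. \<forall>n::nat. 1 \<le> n \<longrightarrow>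
       ennreal C1 * best_approx p \<alpha> n f \<le> gen_modulus r p \<alpha> f (1 / real n) \<and>
       gen_modulus r p \<alpha> f (1 / real n) \<le>
         ennreal (C2 * (1 / real n ^ (2 * r))) *
         (\<Sum>\<nu>=1..n. ennreal (real \<nu> ^ (2 * r - 1)) * best_approx p \<alpha> \<nu> f))"
proof -
  obtain C where "bounded_transl p \<alpha> C"
    using bounded_transl_exists [OF assms(1) assms(3,4,5)] by blast
  then interpret bounded_transl p \<alpha> C .
  obtain D where D: "0 < D" "\<And>f n. f \<in> sp \<Longrightarrow> 1 \<le> n \<Longrightarrow> best_approx p \<alpha> n f \<le> ennreal D * gen_modulus r p \<alpha> f (1 / real n)"
    by (rule jackson [of r]) (rule that; assumption)
  obtain C2 where C2: "0 < C2" "\<And>f n. f \<in> sp \<Longrightarrow> 1 \<le> n \<Longrightarrow> gen_modulus r p \<alpha> f (1 / real n)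
     \<le> ennreal (C2 * (1 / real n ^ (2 * r))) * (\<Sum>\<nu>=1..n. ennreal (real \<nu> ^ (2 * r - 1)) * best_approx p \<alpha> \<nu> f)"
    by (rule inverse_inequality [OF assms(2)]) (rule that; assumption)
  have "ennreal (1 / D) * best_approx p \<alpha> n f \<le> gen_modulus r p \<alpha> f (1 / real n)" if "f \<in> sp" "1 \<le> n" for f n
  proof -
    have "ennreal (1 / D) * best_approx p \<alpha> n f \<le> ennreal (1 / D) * (ennreal D * gen_modulus r p \<alpha> f (1 / real n))"
      by (intro mult_left_mono D that) auto
    also have "\<dots> = gen_modulus r p \<alpha> f (1 / real n)"
      using D(1) by (simp add: mult.assoc [symmetric] ennreal_mult [symmetric])
    finally show ?thesis .
  qed
  then show ?thesis using D(1) C2 by (intro exI [of _ "1 / D"] exI [of _ C2]) auto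
qed

end
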